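(* Let $2<p<6$ and $2<q<4$. Then there exist a non-compact metric graph $\mathcal{G}$, with exactly $2$ half-lines and at least one vertex of degree $2$, and a value $m>0$, such that ground states of $F_{p,q}$ at mass $m$ on $\mathcal{G}$ do not exist.
   Context: A metric graph $\mathcal{G}=(V,E)$ is connected, has finite vertex set $V$ and finite edge set $E$ (loops and multiple edges allowed); each bounded edge is identified with a compact interval of positive length, each unbounded edge (half-line) with $[0,+\infty)$, whose origin is a vertex (points at infinity are not vertices). $\mathcal{G}$ is non-compact if it has at least one half-line. The degree of a vertex is the number of edge-ends at it (a loop counts twice). $H^1(\mathcal{G})$ is the space of continuous functions on $\mathcal{G}$ with $\int_{\mathcal G}(|u'|^2+|u|^2)\,dx<\infty$ (weak derivative on each edge), and $H^1_\mu(\mathcal{G})=\{u\in H^1(\mathcal{G}):\|u\|_{L^2(\mathcal{G})}^2=\mu\}$ for $\mu>0$. $F_{p,q}(u,\mathcal{G})=\frac12\int_{\mathcal{G}}|u'|^2dx-\frac1p\int_{\mathcal{G}}|u|^pdx-\frac1q\sum_{v\in V}|u(v)|^q$. A ground state of $F_{p,q}$ at mass $\mu$ on $\mathcal{G}$ is a function $u\in H^1_\mu(\mathcal{G})$ with $F_{p,q}(u,\mathcal{G})=\inf_{w\in H^1_\mu(\mathcal{G})}F_{p,q}(w,\mathcal{G})$. *)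

theory Defs
  imports "HOL-Analysis.Analysis"
begin

section \<open>Metric graphs\<close>

text \<open>
  Bounded edges and half-lines share the edge type; an edge is a half-line iff its length is
  infinite.  A half-line has its origin at \<open>tail\<close>, and its \<open>head\<close> carries no information.
\<close>

record ('v, 'e) mgraph =
  verts :: "'v set"
  edges :: "'e set"
  tail :: "'e \<Rightarrow> 'v"
  head :: "'e \<Rightarrow> 'v"
  len :: "'e \<Rightarrow> ereal"

definition bounded_edges :: "('v, 'e) mgraph \<Rightarrow> 'e set" where
  "bounded_edges G = {e \<in> edges G. len G e < \<infinity>}"

definition half_lines :: "('v, 'e) mgraph \<Rightarrow> 'e set" where
  "half_lines G = {e \<in> edges G. len G e = \<infinity>}"

definition adjacency :: "('v, 'e) mgraph \<Rightarrow> ('v \<times> 'v) set" where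
  "adjacency G = (\<Union>e\<in>bounded_edges G. {(tail G e, head G e), (head G e, tail G e)})"

definition metric_graph :: "('v, 'e) mgraph \<Rightarrow> bool" where
  "metric_graph G \<longleftrightarrow>
     finite (verts G) \<and> verts G \<noteq> {} \<and> finite (edges G) \<and>
     (\<forall>e\<in>edges G. 0 < len G e \<and> tail G e \<in> verts G) \<and>
     (\<forall>e\<in>bounded_edges G. head G e \<in> verts G) \<and>
     (\<forall>v\<in>verts G. \<forall>w\<in>verts G. (v, w) \<in> (adjacency G)\<^sup>*)"

definition vertex_degree :: "('v, 'e) mgraph \<Rightarrow> 'v \<Rightarrow> nat" where
  "vertex_degree G v = card {e \<in> edges G. tail G e = v} + card {e \<in> bounded_edges G. head G e = v}"

definition noncompact :: "('v, 'e) mgraph \<Rightarrow> bool" where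
  "noncompact G \<longleftrightarrow> half_lines G \<noteq> {}"


section \<open>Functions on a metric graph\<close>

text \<open>
  The points of \<open>G\<close>: its vertices, and the points \<open>Inner e x\<close> with \<open>0 < x < len G e\<close>.
  A function on \<open>G\<close> is a function on this type, whose values at all other arguments are irrelevant.
  Edge ends lying at the same vertex are thereby identified, and \<open>G\<close> carries the quotient topology
  given by the parametrizations \<open>edge_point G e\<close>.
\<close>

datatype ('v, 'e) point = Vertex 'v | Inner 'e real

definition edge_dom :: "('v, 'e) mgraph \<Rightarrow> 'e \<Rightarrow> real set" where
  "edge_dom G e = {x. 0 \<le> x \<and> ereal x \<le> len G e}"

definition edge_interior :: "('v, 'e) mgraph \<Rightarrow> 'e \<Rightarrow> real set" where
  "edge_interior G e = einterval 0 (len G e)"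

definition edge_point :: "('v, 'e) mgraph \<Rightarrow> 'e \<Rightarrow> real \<Rightarrow> ('v, 'e) point" where
  "edge_point G e x =
     (if x = 0 then Vertex (tail G e)
      else if ereal x = len G e then Vertex (head G e)
      else Inner e x)"

definition on_edge :: "('v, 'e) mgraph \<Rightarrow> (('v, 'e) point \<Rightarrow> real) \<Rightarrow> 'e \<Rightarrow> real \<Rightarrow> real" where
  "on_edge G u e = (\<lambda>x. u (edge_point G e x))"

definition continuous_on_graph :: "('v, 'e) mgraph \<Rightarrow> (('v, 'e) point \<Rightarrow> real) \<Rightarrow> bool" where
  "continuous_on_graph G u \<longleftrightarrow> (\<forall>e\<in>edges G. continuous_on (edge_dom G e) (on_edge G u e))"


section \<open>Weak derivatives and \<open>H\<^sup>1\<close>\<close>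

text \<open>
  Continuously differentiable test functions with compact support in the open interval; smooth ones
  would give the same weak derivatives.
\<close>

definition test_function :: "real set \<Rightarrow> (real \<Rightarrow> real) \<Rightarrow> bool" where
  "test_function S \<phi> \<longleftrightarrow>
     \<phi> C1_differentiable_on UNIV \<and> (\<exists>K. compact K \<and> K \<subseteq> S \<and> (\<forall>x. x \<notin> K \<longrightarrow> \<phi> x = 0))"

definition locally_integrable :: "real set \<Rightarrow> (real \<Rightarrow> real) \<Rightarrow> bool" where
  "locally_integrable S f \<longleftrightarrow> (\<forall>K. compact K \<and> K \<subseteq> S \<longrightarrow> set_integrable lborel K f)"

definition is_weak_deriv :: "real set \<Rightarrow> (real \<Rightarrow> real) \<Rightarrow> (real \<Rightarrow> real) \<Rightarrow> bool" where
  "is_weak_deriv S f g \<longleftrightarrow>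
     locally_integrable S f \<and> locally_integrable S g \<and>
     (\<forall>\<phi>. test_function S \<phi> \<longrightarrow>
        (LINT x:S|lborel. f x * deriv \<phi> x) = - (LINT x:S|lborel. g x * \<phi> x))"

text \<open>A representative; on an open set it is unique up to null sets.\<close>

definition weak_deriv :: "real set \<Rightarrow> (real \<Rightarrow> real) \<Rightarrow> real \<Rightarrow> real" where
  "weak_deriv S f = (SOME g. is_weak_deriv S f g)"

definition edge_deriv :: "('v, 'e) mgraph \<Rightarrow> (('v, 'e) point \<Rightarrow> real) \<Rightarrow> 'e \<Rightarrow> real \<Rightarrow> real" where
  "edge_deriv G u e = weak_deriv (edge_interior G e) (on_edge G u e)"

definition graph_integral :: "('v, 'e) mgraph \<Rightarrow> ('e \<Rightarrow> real \<Rightarrow> real) \<Rightarrow> real" where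
  "graph_integral G f = (\<Sum>e\<in>edges G. LINT x:edge_interior G e|lborel. f e x)"

definition H1 :: "('v, 'e) mgraph \<Rightarrow> (('v, 'e) point \<Rightarrow> real) set" where
  "H1 G = {u. continuous_on_graph G u \<and>
     (\<forall>e\<in>edges G.
        (\<exists>g. is_weak_deriv (edge_interior G e) (on_edge G u e) g) \<and>
        set_integrable lborel (edge_interior G e) (\<lambda>x. \<bar>edge_deriv G u e x\<bar>\<^sup>2) \<and>
        set_integrable lborel (edge_interior G e) (\<lambda>x. \<bar>on_edge G u e x\<bar>\<^sup>2))}"

definition mass :: "('v, 'e) mgraph \<Rightarrow> (('v, 'e) point \<Rightarrow> real) \<Rightarrow> real" where
  "mass G u = graph_integral G (\<lambda>e x. \<bar>on_edge G u e x\<bar>\<^sup>2)"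

definition H1_mass :: "('v, 'e) mgraph \<Rightarrow> real \<Rightarrow> (('v, 'e) point \<Rightarrow> real) set" where
  "H1_mass G \<mu> = {u \<in> H1 G. mass G u = \<mu>}"


section \<open>Energy and ground states\<close>

definition energy :: "real \<Rightarrow> real \<Rightarrow> ('v, 'e) mgraph \<Rightarrow> (('v, 'e) point \<Rightarrow> real) \<Rightarrow> real" where
  "energy p q G u =
     1 / 2 * graph_integral G (\<lambda>e x. \<bar>edge_deriv G u e x\<bar>\<^sup>2)
     - 1 / p * graph_integral G (\<lambda>e x. \<bar>on_edge G u e x\<bar> powr p)
     - 1 / q * (\<Sum>v\<in>verts G. \<bar>u (Vertex v)\<bar> powr q)"

text \<open>
  The infimum is taken in the extended reals, so that it is meaningful even without a
  boundedness result for the energy.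
\<close>

definition ground_state ::
  "real \<Rightarrow> real \<Rightarrow> ('v, 'e) mgraph \<Rightarrow> real \<Rightarrow> (('v, 'e) point \<Rightarrow> real) \<Rightarrow> bool" where
  "ground_state p q G \<mu> u \<longleftrightarrow>
     u \<in> H1_mass G \<mu> \<and> ereal (energy p q G u) = (INF w\<in>H1_mass G \<mu>. ereal (energy p q G w))"

end

theory Submission
  imports Defs
begin

text \<open>
  The graph consists of \<open>n\<^sup>2\<close> edges of length \<open>1/n\<close> and two half-lines, all starting at one vertex; two
  of the edges end at a second vertex, which thus has degree 2, the others are loops.  A ground state
  \<open>u\<close> is compared with functions supported on one half-line.  Joining the restrictions of \<open>u\<close> to
  the two half-lines at their common origin, cutting off far away and rescaling to mass \<open>m\<close> gives
  such a competitor, and since \<open>p > 2\<close> the rescaling gains at least \<open>\<kappa>/m\<close> per unit of the mass \<open>\<delta>\<close> that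
  \<open>u\<close> has on the core, where \<open>-\<kappa> < 0\<close> bounds the energy of suitable competitors.  On the core, \<open>u\<^sup>2\<close> is at
  most \<open>6/n\<close> times the mass plus the kinetic energy there, because the core has total length \<open>n\<close> and
  short edges; as the kinetic energy of \<open>u\<close> is bounded independently of \<open>n\<close>, the nonlinear terms
  of the core are smaller than \<open>(\<kappa>/2m) \<delta>\<close> plus the kinetic energy of the core for large \<open>n\<close>.  Hence
  \<open>\<delta> = 0\<close>, and \<open>u\<close> vanishes at the origin of the half-lines.  Stretching \<open>u\<close> near such a zero would
  lower the energy, so \<open>u\<close> vanishes everywhere.
\<close>

section \<open>Functions of class \<open>H\<^sup>1\<close> on an interval\<close>

text \<open>The order of choices makes the comparison possible. A competitor that lives on one
  half-line and vanishes at its origin carries no vertex term and sees neither \<open>q\<close> nor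
  the core. So \<open>m\<close> and \<open>\<kappa>\<close> come from \<open>p\<close> alone, the
  kinetic bound from \<open>p\<close>, \<open>q\<close> and \<open>m\<close>, and \<open>n\<close>
  can still be taken large afterwards.

  The number and length of the edges are balanced: averaging over \<open>n^2\<close> edges bounds
  the square of the common vertex value by \<open>O(1/n)\<close>, and moving along a single edge of
  length \<open>1/n\<close> again costs only \<open>O(1/n)\<close>.

  A technical obstacle is that \<open>weak_deriv\<close> picks an unspecified representative. All
  estimates are therefore made for pairs \<open>f\<close>, \<open>g\<close> where the increments of
  \<open>f\<close> are integrals of a Borel function \<open>g\<close>; in this form gluing,
  reflecting and stretching are statements about integrals. The section on weak derivatives
  translates in both directions: from \<open>H1\<close> to such pairs for the ground state, and from
  such pairs to \<open>H1\<close> for the competitors.\<close>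

definition H1_on :: "real set \<Rightarrow> (real \<Rightarrow> real) \<Rightarrow> (real \<Rightarrow> real) \<Rightarrow> bool" where
  "H1_on S f g \<longleftrightarrow>
     is_interval S \<and> S \<in> sets borel \<and> g \<in> borel_measurable borel \<and>
     (\<forall>x\<in>S. \<forall>y\<in>S. x \<le> y \<longrightarrow> f y - f x = (LINT t:{x..y}|lborel. g t)) \<and>
     set_integrable lborel S (\<lambda>x. (f x)\<^sup>2) \<and> set_integrable lborel S (\<lambda>x. (g x)\<^sup>2)"

lemma H1_onD:
  assumes "H1_on S f g"
  shows "is_interval S" "S \<in> sets borel" "g \<in> borel_measurable borel"
    "\<And>x y. x \<in> S \<Longrightarrow> y \<in> S \<Longrightarrow> x \<le> y \<Longrightarrow> f y - f x = (LINT t:{x..y}|lborel. g t)"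
    "set_integrable lborel S (\<lambda>x. (f x)\<^sup>2)" "set_integrable lborel S (\<lambda>x. (g x)\<^sup>2)"
  using assms unfolding H1_on_def by blast+

lemma Icc_subset_interval: "is_interval S \<Longrightarrow> x \<in> S \<Longrightarrow> y \<in> S \<Longrightarrow> {x..y::real} \<subseteq> S"
  unfolding is_interval_1 by (meson atLeastAtMost_iff subsetI)

section \<open>Change of variables, monotonicity and gluing for set integrals\<close>

lemma set_integral_affine:
  fixes F :: "real \<Rightarrow> real"
  assumes "\<alpha> \<noteq> 0"
  shows "set_integrable lborel {x. \<alpha> * x + \<beta> \<in> S} (\<lambda>x. F (\<alpha> * x + \<beta>)) \<longleftrightarrow> set_integrable lborel S F"
    and "(LINT x:{x. \<alpha> * x + \<beta> \<in> S}|lborel. F (\<alpha> * x + \<beta>)) = (LINT x:S|lborel. F x) / \<bar>\<alpha>\<bar>"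
proof -
  have ind: "indicator {x. \<alpha> * x + \<beta> \<in> S} x = (indicator S (\<beta> + \<alpha> * x) :: real)" for x
    by (auto simp: indicator_def algebra_simps)
  show "set_integrable lborel {x. \<alpha> * x + \<beta> \<in> S} (\<lambda>x. F (\<alpha> * x + \<beta>)) \<longleftrightarrow> set_integrable lborel S F"
    using lborel_integrable_real_affine_iff[OF assms, of "\<lambda>x. indicator S x *\<^sub>R F x" \<beta>]
    unfolding set_integrable_def ind by (simp add: add.commute)
  show "(LINT x:{x. \<alpha> * x + \<beta> \<in> S}|lborel. F (\<alpha> * x + \<beta>)) = (LINT x:S|lborel. F x) / \<bar>\<alpha>\<bar>"
    using lborel_integral_real_affine[OF assms, of "\<lambda>x. indicator S x *\<^sub>R F x" \<beta>] assms
    unfolding set_lebesgue_integral_def ind by (simp add: add.commute)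
qed

lemma set_integral_nonneg_subset:
  fixes F :: "real \<Rightarrow> real"
  assumes "set_integrable lborel S F" "T \<in> sets borel" "T \<subseteq> S" "\<And>x. x \<in> S \<Longrightarrow> 0 \<le> F x"
  shows "(LINT x:T|lborel. F x) \<le> (LINT x:S|lborel. F x)"
proof -
  have "set_integrable lborel T F" by (rule set_integrable_subset[OF assms(1)]) (use assms in auto)
  then show ?thesis using assms(1) unfolding set_lebesgue_integral_def set_integrable_def
    by (rule integral_mono) (use assms in \<open>auto split: split_indicator\<close>)
qed

text \<open>\<open>S1\<close> and \<open>S2\<close> meet at most in \<open>b\<close>, and
  \<open>{b}\<close> is a null set. The value of \<open>h\<close> at \<open>b\<close> is left open,
  which suits functions defined by \<open>if x \<le> b\<close>; \<open>k\<close> is measurable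
  because it differs from \<open>l\<close> at one point only.\<close>

lemma set_integral_glue:
  fixes h1 h2 :: "real \<Rightarrow> real"
  assumes "set_integrable lborel S1 h1" "set_integrable lborel S2 h2"
    "S1 \<in> sets borel" "S2 \<in> sets borel" "S1 \<subseteq> {..b}" "S2 \<subseteq> {b..}"
    "\<And>x. x \<in> S1 \<Longrightarrow> x < b \<Longrightarrow> h x = h1 x" "\<And>x. x \<in> S2 \<Longrightarrow> b < x \<Longrightarrow> h x = h2 x"
  shows "set_integrable lborel (S1 \<union> S2) h"
    and "(LINT x:S1 \<union> S2|lborel. h x) = (LINT x:S1|lborel. h1 x) + (LINT x:S2|lborel. h2 x)"
proof -
  have *: "has_bochner_integral lborel (\<lambda>x. indicator S1 x *\<^sub>R h1 x + indicator S2 x *\<^sub>R h2 x)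
     ((LINT x:S1|lborel. h1 x) + (LINT x:S2|lborel. h2 x))"
    using assms(1,2) unfolding set_integrable_def set_lebesgue_integral_def
    by (intro has_bochner_integral_add has_bochner_integral_integrable)
  define k where "k x = indicator (S1 \<union> S2) x *\<^sub>R h x" for x
  define l where "l x = indicator S1 x *\<^sub>R h1 x + indicator S2 x *\<^sub>R h2 x" for x
  have kl: "k x = l x" if "x \<noteq> b" for x
    using assms(5-8) that by (cases "x < b") (auto simp: k_def l_def indicator_def)
  have l: "l \<in> borel_measurable lborel" using has_bochner_integral_integrable * unfolding l_def
    by (metis borel_measurable_has_bochner_integral)
  have "k = (\<lambda>x. if x = b then k b else l x)" using kl by auto
  moreover have "(\<lambda>x. if x = b then k b else l x) \<in> borel_measurable lborel"
    using l by measurable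
  ultimately have k: "k \<in> borel_measurable lborel" by simp
  have ae: "AE x in lborel. k x = l x"
    using AE_lborel_singleton[of b] by eventually_elim (use kl in auto)
  have "has_bochner_integral lborel k ((LINT x:S1|lborel. h1 x) + (LINT x:S2|lborel. h2 x))"
    using has_bochner_integral_cong_AE[OF k l ae] * unfolding l_def by simp
  then show "set_integrable lborel (S1 \<union> S2) h"
    and "(LINT x:S1 \<union> S2|lborel. h x) = (LINT x:S1|lborel. h1 x) + (LINT x:S2|lborel. h2 x)"
    unfolding set_integrable_def set_lebesgue_integral_def k_def
    by (auto simp: has_bochner_integral_iff)
qed

lemma set_integrable_Icc_const: "set_integrable lborel {a..b::real} (\<lambda>_. c :: real)"
  by (rule borel_integrable_atLeastAtMost'[OF continuous_on_const])

lemma set_integrable_of_square: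
  fixes g :: "real \<Rightarrow> real"
  assumes "set_integrable lborel {x..y} (\<lambda>x. (g x)\<^sup>2)" "g \<in> borel_measurable borel"
  shows "set_integrable lborel {x..y} g"
proof -
  have "set_integrable lborel {x..y} (\<lambda>x. 1 + (g x)\<^sup>2)"
    by (rule set_integral_add(1)[OF set_integrable_Icc_const assms(1)])
  then show ?thesis
  proof (rule set_integrable_bound)
    show "set_borel_measurable lborel {x..y} g"
      using assms(2) by (simp add: set_borel_measurable_def)
    have "\<bar>t\<bar> \<le> 1 + t\<^sup>2" for t :: real
      using zero_le_power2[of "\<bar>t\<bar> - 1"] by (simp add: power2_eq_square algebra_simps)
    then show "AE t in lborel. t \<in> {x..y} \<longrightarrow> norm (g t) \<le> norm (1 + (g t)\<^sup>2)"
      by (auto simp: abs_of_nonneg add_nonneg_nonneg)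
  qed
qed

lemma H1_on_deriv_integrable:
  assumes "H1_on S f g" "x \<in> S" "y \<in> S"
  shows "set_integrable lborel {x..y} g" "set_integrable lborel {x..y} (\<lambda>t. (g t)\<^sup>2)"
proof -
  show *: "set_integrable lborel {x..y} (\<lambda>t. (g t)\<^sup>2)"
    using Icc_subset_interval[OF H1_onD(1)[OF assms(1)] assms(2,3)]
    by (intro set_integrable_subset[OF H1_onD(6)[OF assms(1)]]) auto
  then show "set_integrable lborel {x..y} g"
    using set_integrable_of_square H1_onD(3)[OF assms(1)] by blast
qed

lemma H1_on_subset:
  assumes "H1_on S f g" "T \<subseteq> S" "is_interval T" "T \<in> sets borel"
  shows "H1_on T f g"
proof -
  note D = H1_onD[OF assms(1)]
  have "set_integrable lborel T (\<lambda>x. (f x)\<^sup>2)" "set_integrable lborel T (\<lambda>x. (g x)\<^sup>2)"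
    using assms(2,4) D(5,6) by (auto intro: set_integrable_subset)
  then show ?thesis using D(3,4) assms(2-4) unfolding H1_on_def by blast
qed

section \<open>Hoelder continuity and pointwise bounds\<close>

lemma set_integral_Icc_const: "(LINT t:{x..y::real}|lborel. c) = (if x \<le> y then (y - x) * c else (0::real))"
  by (simp add: set_lebesgue_integral_def)

text \<open>Cauchy-Schwarz for \<open>g\<close> and the constant 1, read off from the nonnegative
  integral of \<open>(g t - D / d)^2\<close>, where \<open>D / d\<close> is the mean of
  \<open>g\<close>.\<close>

lemma H1_on_holder:
  assumes H: "H1_on S f g" "x \<in> S" "y \<in> S" "x \<le> y"
  shows "(f y - f x)\<^sup>2 \<le> (y - x) * (LINT t:{x..y}|lborel. (g t)\<^sup>2)"
proof (cases "x = y")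
  case False
  define D where "D = f y - f x"
  define d where "d = y - x"
  define K where "K = (LINT t:{x..y}|lborel. (g t)\<^sup>2)"
  have d: "d > 0" using False H d_def by simp
  note I = H1_on_deriv_integrable[OF H(1-3)]
  have D: "D = (LINT t:{x..y}|lborel. g t)" unfolding D_def by (rule H1_onD(4)[OF H])
  note one = set_integrable_Icc_const[of x y]
  have "0 \<le> (LINT t:{x..y}|lborel. (g t - D / d)\<^sup>2)"
    by (auto simp: set_lebesgue_integral_def intro!: integral_nonneg_AE)
  also have "\<dots> = (LINT t:{x..y}|lborel. (g t)\<^sup>2 - (2 * D / d) * g t + (D / d)\<^sup>2)"
    by (rule arg_cong[where f="set_lebesgue_integral _ _"]) (auto simp: power2_diff)
  also have "\<dots> = K - (2 * D / d) * D + d * (D / d)\<^sup>2"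
    using I one H(4) d_def by (subst set_integral_add, auto intro!: set_integral_diff
         simp: K_def D set_integral_Icc_const)
  also have "\<dots> = K - D\<^sup>2 / d" using d by (simp add: field_simps power2_eq_square)
  finally show ?thesis using d by (simp add: D_def d_def K_def field_simps)
qed simp

lemma set_integral_square_nonneg: "0 \<le> (LINT t:S|lborel. (g t :: real)\<^sup>2)"
  by (auto simp: set_lebesgue_integral_def intro!: integral_nonneg_AE)

lemma H1_on_holder_abs:
  assumes H: "H1_on S f g" "x \<in> S" "y \<in> S"
  shows "(f y - f x)\<^sup>2 \<le> \<bar>y - x\<bar> * (LINT t:S|lborel. (g t)\<^sup>2)"
proof -
  have *: "(f y - f x)\<^sup>2 \<le> \<bar>y - x\<bar> * (LINT t:S|lborel. (g t)\<^sup>2)" if "x \<le> y" "x \<in> S" "y \<in> S" for x y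
  proof -
    have "(f y - f x)\<^sup>2 \<le> (y - x) * (LINT t:{x..y}|lborel. (g t)\<^sup>2)"
      by (rule H1_on_holder[OF H(1) that(2,3,1)])
    also have "\<dots> \<le> (y - x) * (LINT t:S|lborel. (g t)\<^sup>2)"
      using that H1_onD[OF H(1)]
      by (intro mult_left_mono set_integral_nonneg_subset Icc_subset_interval) auto
    finally show ?thesis using that by simp
  qed
  show ?thesis using *[of x y] *[of y x] H by (cases "x \<le> y") (auto simp: power2_commute abs_minus_commute)
qed

lemma H1_on_continuous:
  assumes H: "H1_on S f g"
  shows "continuous_on S f"
  unfolding continuous_on_def
proof
  fix x assume x: "x \<in> S"
  define K where "K = (LINT t:S|lborel. (g t)\<^sup>2)"
  show "(f \<longlongrightarrow> f x) (at x within S)"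
  proof (subst LIM_zero_iff[symmetric], rule Lim_null_comparison)
    show "\<forall>\<^sub>F y in at x within S. norm (f y - f x) \<le> sqrt (\<bar>y - x\<bar> * K)"
      unfolding eventually_at_filter
      using H1_on_holder_abs[OF H x] by (auto intro!: always_eventually real_le_rsqrt simp: K_def)
    have "((\<lambda>y. sqrt (\<bar>y - x\<bar> * K)) \<longlongrightarrow> sqrt (\<bar>x - x\<bar> * K)) (at x within S)"
      by (intro tendsto_intros)
    then show "((\<lambda>y. sqrt (\<bar>y - x\<bar> * K)) \<longlongrightarrow> 0) (at x within S)" by simp
  qed
qed

lemma H1_on_set_borel_measurable:
  assumes H: "H1_on S f g"
  shows "set_borel_measurable lborel S f"
  using borel_measurable_continuous_on_indicator[OF H1_onD(2)[OF H] H1_on_continuous[OF H]]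
  by (simp add: set_borel_measurable_def)

text \<open>A pointwise estimate in terms of \<open>f y\<close> is averaged over \<open>y\<close> in
  the interval. The length of the interval trades the mass term against the kinetic term; later
  choices are 1, the edge length, and a value optimized for the kinetic energy.\<close>

lemma H1_on_sup_bound:
  assumes H: "H1_on S f g" and x: "x \<in> {a..b}" and ab: "a < b" and sub: "{a..b} \<subseteq> S"
  shows "(f x)\<^sup>2 \<le> 2 / (b - a) * (LINT t:{a..b}|lborel. (f t)\<^sup>2) + 2 * (b - a) * (LINT t:{a..b}|lborel. (g t)\<^sup>2)"
proof -
  define K where "K = (LINT t:{a..b}|lborel. (g t)\<^sup>2)"
  have H': "H1_on {a..b} f g" by (rule H1_on_subset[OF H sub]) (auto simp: is_interval_cc)
  have K: "K \<ge> 0" unfolding K_def by (rule set_integral_square_nonneg)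
  have *: "(f x)\<^sup>2 \<le> 2 * (f y)\<^sup>2 + 2 * (b - a) * K" if "y \<in> {a..b}" for y
  proof -
    have "(f x - f y)\<^sup>2 \<le> \<bar>x - y\<bar> * K"
      using H1_on_holder_abs[OF H' that x] by (simp add: K_def)
    also have "\<dots> \<le> (b - a) * K" using x that K by (intro mult_right_mono) auto
    finally have "(f x - f y)\<^sup>2 \<le> (b - a) * K" .
    \<comment> \<open>The difference of the two sides is \<open>(f x - 2 * f y)^2\<close>.\<close>
    moreover have "(f x)\<^sup>2 \<le> 2 * (f y)\<^sup>2 + 2 * (f x - f y)\<^sup>2"
      using zero_le_power2[of "f x - 2 * f y"] by (simp add: power2_eq_square algebra_simps)
    ultimately show ?thesis by linarith
  qed
  note one = set_integrable_Icc_const[of a b]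
  have f2: "set_integrable lborel {a..b} (\<lambda>y. 2 * (f y)\<^sup>2)" using H1_onD(5)[OF H'] by simp
  have "(LINT y:{a..b}|lborel. (f x)\<^sup>2) \<le> (LINT y:{a..b}|lborel. 2 * (f y)\<^sup>2 + 2 * (b - a) * K)"
    by (rule set_integral_mono[OF one set_integral_add(1)[OF f2 one]]) (rule *)
  also have "\<dots> = 2 * (LINT t:{a..b}|lborel. (f t)\<^sup>2) + (b - a) * (2 * (b - a) * K)"
    using ab by (subst set_integral_add(2)[OF f2 one]) (simp add: set_integral_Icc_const)
  finally have "(b - a) * (f x)\<^sup>2 \<le> 2 * (LINT t:{a..b}|lborel. (f t)\<^sup>2) + (b - a) * (2 * (b - a) * K)"
    using ab by (simp add: set_integral_Icc_const)
  then show ?thesis using ab by (simp add: K_def field_simps)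
qed

lemma H1_on_sup_bound_length:
  assumes H: "H1_on S f g" and d: "d > 0" and a: "a \<le> x" "x \<le> a + d" "{a..a+d} \<subseteq> S"
  shows "(f x)\<^sup>2 \<le> 2 / d * (LINT t:S|lborel. (f t)\<^sup>2) + 2 * d * (LINT t:S|lborel. (g t)\<^sup>2)"
proof -
  have "(f x)\<^sup>2 \<le> 2 / d * (LINT t:{a..a+d}|lborel. (f t)\<^sup>2) + 2 * d * (LINT t:{a..a+d}|lborel. (g t)\<^sup>2)"
    using H1_on_sup_bound[OF H _ _ a(3), of x] a d by simp
  also have "\<dots> \<le> 2 / d * (LINT t:S|lborel. (f t)\<^sup>2) + 2 * d * (LINT t:S|lborel. (g t)\<^sup>2)"
    using d H1_onD[OF H] a by (intro add_mono mult_left_mono set_integral_nonneg_subset) auto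
  finally show ?thesis .
qed

section \<open>Power integrals, affine substitution and gluing of \<open>H1_on\<close>
  functions\<close>

lemma abs_powr_le:
  fixes y :: real
  assumes "p \<ge> 2" "\<bar>y\<bar> \<le> B"
  shows "\<bar>y\<bar> powr p \<le> B powr (p - 2) * y\<^sup>2"
proof (cases "y = 0")
  case False
  have "\<bar>y\<bar> powr 2 = y\<^sup>2" using False powr_realpow[of "\<bar>y\<bar>" 2] by simp
  then have "\<bar>y\<bar> powr p = \<bar>y\<bar> powr (p - 2) * y\<^sup>2"
    using powr_add[of "\<bar>y\<bar>" "p - 2" 2] by (metis diff_add_cancel)
  also have "\<dots> \<le> B powr (p - 2) * y\<^sup>2"
    using assms by (intro mult_right_mono powr_mono2) auto
  finally show ?thesis .
qed simp

lemma H1_on_powr: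
  assumes H: "H1_on S f g" and p: "p \<ge> 2" and B: "\<And>x. x \<in> S \<Longrightarrow> \<bar>f x\<bar> \<le> B"
  shows "set_integrable lborel S (\<lambda>x. \<bar>f x\<bar> powr p)"
    and "(LINT x:S|lborel. \<bar>f x\<bar> powr p) \<le> B powr (p - 2) * (LINT x:S|lborel. (f x)\<^sup>2)"
proof -
  have f2: "set_integrable lborel S (\<lambda>x. B powr (p - 2) * (f x)\<^sup>2)" using H1_onD(5)[OF H] by simp
  have le: "\<bar>f x\<bar> powr p \<le> B powr (p - 2) * (f x)\<^sup>2" if "x \<in> S" for x
    by (rule abs_powr_le[OF p B[OF that]])
  have [measurable]: "(\<lambda>x. indicator S x * f x) \<in> borel_measurable lborel"
    using H1_on_set_borel_measurable[OF H] by (simp add: set_borel_measurable_def)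
  have eq: "(\<lambda>x. indicator S x *\<^sub>R \<bar>f x\<bar> powr p) = (\<lambda>x. \<bar>indicator S x * f x\<bar> powr p)"
    by (auto simp: indicator_def)
  have m: "set_borel_measurable lborel S (\<lambda>x. \<bar>f x\<bar> powr p)"
    unfolding set_borel_measurable_def eq by measurable
  show i: "set_integrable lborel S (\<lambda>x. \<bar>f x\<bar> powr p)"
    by (rule set_integrable_bound[OF f2 m]) (use le in \<open>auto intro!: AE_I2\<close>)
  show "(LINT x:S|lborel. \<bar>f x\<bar> powr p) \<le> B powr (p - 2) * (LINT x:S|lborel. (f x)\<^sup>2)"
    using set_integral_mono[OF i f2 le] by simp
qed

text \<open>Covers amplitude scaling (\<open>s\<close>), translation, reflection
  (\<open>\<alpha> = -1\<close>) and stretching (\<open>\<alpha> = 1/2\<close>) at once.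
  \<open>h\<close> and \<open>k\<close> enter through equations so that the results stay folded when
  several pieces are glued.\<close>

lemma H1_on_affine:
  assumes H: "H1_on S f g" and \<alpha>: "\<alpha> \<noteq> 0"
    and h: "h = (\<lambda>x. s * f (\<alpha> * x + \<beta>))" and k: "k = (\<lambda>x. s * \<alpha> * g (\<alpha> * x + \<beta>))"
  shows "H1_on {x. \<alpha> * x + \<beta> \<in> S} h k"
    and "(LINT x:{x. \<alpha> * x + \<beta> \<in> S}|lborel. (h x)\<^sup>2) = s\<^sup>2 / \<bar>\<alpha>\<bar> * (LINT x:S|lborel. (f x)\<^sup>2)"
    and "(LINT x:{x. \<alpha> * x + \<beta> \<in> S}|lborel. (k x)\<^sup>2) = s\<^sup>2 * \<bar>\<alpha>\<bar> * (LINT x:S|lborel. (g x)\<^sup>2)"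
    and "(LINT x:{x. \<alpha> * x + \<beta> \<in> S}|lborel. \<bar>h x\<bar> powr p) = \<bar>s\<bar> powr p / \<bar>\<alpha>\<bar> * (LINT x:S|lborel. \<bar>f x\<bar> powr p)"
    and "set_integrable lborel S (\<lambda>x. \<bar>f x\<bar> powr p) \<Longrightarrow> set_integrable lborel {x. \<alpha> * x + \<beta> \<in> S} (\<lambda>x. \<bar>h x\<bar> powr p)"
  unfolding h k
proof -
  note [measurable] = H1_onD(2,3)[OF H]
  have f2: "set_integrable lborel {x. \<alpha> * x + \<beta> \<in> S} (\<lambda>x. (s * f (\<alpha> * x + \<beta>))\<^sup>2)"
    using H1_onD(5)[OF H] set_integral_affine(1)[OF \<alpha>, of \<beta> S "\<lambda>x. (f x)\<^sup>2"]
    by (simp add: power_mult_distrib)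
  have g2: "set_integrable lborel {x. \<alpha> * x + \<beta> \<in> S} (\<lambda>x. (s * \<alpha> * g (\<alpha> * x + \<beta>))\<^sup>2)"
    using H1_onD(6)[OF H] set_integral_affine(1)[OF \<alpha>, of \<beta> S "\<lambda>x. (g x)\<^sup>2"]
    by (simp add: power_mult_distrib)
  show "(LINT x:{x. \<alpha> * x + \<beta> \<in> S}|lborel. (s * f (\<alpha> * x + \<beta>))\<^sup>2) = s\<^sup>2 / \<bar>\<alpha>\<bar> * (LINT x:S|lborel. (f x)\<^sup>2)"
    using set_integral_affine(2)[OF \<alpha>, of \<beta> S "\<lambda>x. (f x)\<^sup>2"] by (simp add: power_mult_distrib)
  show "(LINT x:{x. \<alpha> * x + \<beta> \<in> S}|lborel. (s * \<alpha> * g (\<alpha> * x + \<beta>))\<^sup>2) = s\<^sup>2 * \<bar>\<alpha>\<bar> * (LINT x:S|lborel. (g x)\<^sup>2)"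
    using set_integral_affine(2)[OF \<alpha>, of \<beta> S "\<lambda>x. (g x)\<^sup>2"] \<alpha>
    by (simp add: power_mult_distrib mult.assoc) (simp add: power2_eq_square abs_if)
  show "(LINT x:{x. \<alpha> * x + \<beta> \<in> S}|lborel. \<bar>s * f (\<alpha> * x + \<beta>)\<bar> powr p) = \<bar>s\<bar> powr p / \<bar>\<alpha>\<bar> * (LINT x:S|lborel. \<bar>f x\<bar> powr p)"
    using set_integral_affine(2)[OF \<alpha>, of \<beta> S "\<lambda>x. \<bar>f x\<bar> powr p"]
    by (simp add: abs_mult powr_mult)
  show "set_integrable lborel S (\<lambda>x. \<bar>f x\<bar> powr p) \<Longrightarrow> set_integrable lborel {x. \<alpha> * x + \<beta> \<in> S} (\<lambda>x. \<bar>s * f (\<alpha> * x + \<beta>)\<bar> powr p)"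
    using set_integral_affine(1)[OF \<alpha>, of \<beta> S "\<lambda>x. \<bar>f x\<bar> powr p"]
    by (simp add: abs_mult powr_mult)
  have int: "is_interval {x. \<alpha> * x + \<beta> \<in> S}"
    unfolding is_interval_1
  proof (intro ballI allI impI, elim conjE)
    fix u v x assume uv: "u \<in> {x. \<alpha> * x + \<beta> \<in> S}" "v \<in> {x. \<alpha> * x + \<beta> \<in> S}" "u \<le> x" "x \<le> v"
    have "(\<alpha> * u + \<beta> \<le> \<alpha> * x + \<beta> \<and> \<alpha> * x + \<beta> \<le> \<alpha> * v + \<beta>) \<or> (\<alpha> * v + \<beta> \<le> \<alpha> * x + \<beta> \<and> \<alpha> * x + \<beta> \<le> \<alpha> * u + \<beta>)"
      using uv(3,4) \<alpha> by (cases "\<alpha> > 0") (auto intro: mult_left_mono mult_left_mono_neg)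
    then show "x \<in> {x. \<alpha> * x + \<beta> \<in> S}" using uv(1,2) H1_onD(1)[OF H] unfolding is_interval_1 by blast
  qed
  have eq: "s * f (\<alpha> * y + \<beta>) - s * f (\<alpha> * x + \<beta>) = (LINT t:{x..y}|lborel. s * \<alpha> * g (\<alpha> * t + \<beta>))"
    if xy: "\<alpha> * x + \<beta> \<in> S" "\<alpha> * y + \<beta> \<in> S" "x \<le> y" for x y
  proof (cases "\<alpha> > 0")
    case True
    have S: "{x..y} = {t. \<alpha> * t + \<beta> \<in> {\<alpha> * x + \<beta>..\<alpha> * y + \<beta>}}" using True by auto
    have I: "(LINT t:{x..y}|lborel. g (\<alpha> * t + \<beta>)) = (f (\<alpha> * y + \<beta>) - f (\<alpha> * x + \<beta>)) / \<alpha>"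
      unfolding S using True xy by (subst set_integral_affine(2)[OF \<alpha>], subst H1_onD(4)[OF H]) auto
    show ?thesis using \<alpha> by (simp only: set_integral_mult_right I) (simp add: field_simps)
  next
    case False
    then have neg: "\<alpha> < 0" using \<alpha> by simp
    have S: "{x..y} = {t. \<alpha> * t + \<beta> \<in> {\<alpha> * y + \<beta>..\<alpha> * x + \<beta>}}" using neg by auto
    have I: "(LINT t:{x..y}|lborel. g (\<alpha> * t + \<beta>)) = (f (\<alpha> * x + \<beta>) - f (\<alpha> * y + \<beta>)) / \<bar>\<alpha>\<bar>"
      unfolding S using neg xy by (subst set_integral_affine(2)[OF \<alpha>], subst H1_onD(4)[OF H]) auto
    show ?thesis using neg by (simp only: set_integral_mult_right I) (simp add: field_simps)
  qed
  have mS: "{x. \<alpha> * x + \<beta> \<in> S} \<in> sets borel" by measurable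
  show "H1_on {x. \<alpha> * x + \<beta> \<in> S} (\<lambda>x. s * f (\<alpha> * x + \<beta>)) (\<lambda>x. s * \<alpha> * g (\<alpha> * x + \<beta>))"
    unfolding H1_on_def using int mS f2 g2 eq by auto
qed

text \<open>The common value at \<open>b\<close> makes the increments on both sides add up to an
  increment across \<open>b\<close>; the choice of \<open>g\<close> at \<open>b\<close> itself
  concerns a null set.\<close>

lemma H1_on_glue:
  assumes H1: "H1_on S1 f1 g1" and H2: "H1_on S2 f2 g2" and b: "b \<in> S1" "b \<in> S2" "S1 \<subseteq> {..b}" "S2 \<subseteq> {b..}"
    and eqb: "f1 b = f2 b"
    and f_def: "f = (\<lambda>x. if x \<le> b then f1 x else f2 x)" and g_def: "g = (\<lambda>x. if x \<le> b then g1 x else g2 x)"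
  shows "H1_on (S1 \<union> S2) f g"
    and "(LINT x:S1 \<union> S2|lborel. (f x)\<^sup>2) = (LINT x:S1|lborel. (f1 x)\<^sup>2) + (LINT x:S2|lborel. (f2 x)\<^sup>2)"
    and "(LINT x:S1 \<union> S2|lborel. (g x)\<^sup>2) = (LINT x:S1|lborel. (g1 x)\<^sup>2) + (LINT x:S2|lborel. (g2 x)\<^sup>2)"
    and "set_integrable lborel S1 (\<lambda>x. \<bar>f1 x\<bar> powr p) \<Longrightarrow> set_integrable lborel S2 (\<lambda>x. \<bar>f2 x\<bar> powr p) \<Longrightarrow>
      (LINT x:S1 \<union> S2|lborel. \<bar>f x\<bar> powr p) = (LINT x:S1|lborel. \<bar>f1 x\<bar> powr p) + (LINT x:S2|lborel. \<bar>f2 x\<bar> powr p)"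
    and "set_integrable lborel S1 (\<lambda>x. \<bar>f1 x\<bar> powr p) \<Longrightarrow> set_integrable lborel S2 (\<lambda>x. \<bar>f2 x\<bar> powr p) \<Longrightarrow>
      set_integrable lborel (S1 \<union> S2) (\<lambda>x. \<bar>f x\<bar> powr p)"
proof -
  note D1 = H1_onD[OF H1] and D2 = H1_onD[OF H2]
  note [measurable] = D1(2,3) D2(2,3)
  note glue = set_integral_glue[OF _ _ D1(2) D2(2) b(3,4)]
  have f2: "set_integrable lborel (S1 \<union> S2) (\<lambda>x. (f x)\<^sup>2)"
    by (rule glue(1)[OF D1(5) D2(5)]) (auto simp: f_def)
  show "(LINT x:S1 \<union> S2|lborel. (f x)\<^sup>2) = (LINT x:S1|lborel. (f1 x)\<^sup>2) + (LINT x:S2|lborel. (f2 x)\<^sup>2)"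
    by (rule glue(2)[OF D1(5) D2(5)]) (auto simp: f_def)
  have g2: "set_integrable lborel (S1 \<union> S2) (\<lambda>x. (g x)\<^sup>2)"
    by (rule glue(1)[OF D1(6) D2(6)]) (auto simp: g_def)
  show "(LINT x:S1 \<union> S2|lborel. (g x)\<^sup>2) = (LINT x:S1|lborel. (g1 x)\<^sup>2) + (LINT x:S2|lborel. (g2 x)\<^sup>2)"
    by (rule glue(2)[OF D1(6) D2(6)]) (auto simp: g_def)
  show "set_integrable lborel S1 (\<lambda>x. \<bar>f1 x\<bar> powr p) \<Longrightarrow> set_integrable lborel S2 (\<lambda>x. \<bar>f2 x\<bar> powr p) \<Longrightarrow>
      (LINT x:S1 \<union> S2|lborel. \<bar>f x\<bar> powr p) = (LINT x:S1|lborel. \<bar>f1 x\<bar> powr p) + (LINT x:S2|lborel. \<bar>f2 x\<bar> powr p)"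
    by (rule glue(2)) (auto simp: f_def)
  show "set_integrable lborel S1 (\<lambda>x. \<bar>f1 x\<bar> powr p) \<Longrightarrow> set_integrable lborel S2 (\<lambda>x. \<bar>f2 x\<bar> powr p) \<Longrightarrow>
      set_integrable lborel (S1 \<union> S2) (\<lambda>x. \<bar>f x\<bar> powr p)"
    by (rule glue(1)) (auto simp: f_def)
  have int: "is_interval (S1 \<union> S2)"
    using is_interval_connected_1 D1(1) D2(1) b by (metis IntI connected_Un empty_iff)
  have [measurable]: "g \<in> borel_measurable borel" unfolding g_def by measurable
  have left: "f y - f x = (LINT t:{x..y}|lborel. g t)" if "x \<in> S1" "y \<in> S1" "x \<le> y" for x y
  proof -
    have "x \<le> b" "y \<le> b" using that b by auto
    moreover have "(LINT t:{x..y}|lborel. g t) = (LINT t:{x..y}|lborel. g1 t)"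
      using \<open>y \<le> b\<close> by (intro set_lebesgue_integral_cong) (auto simp: g_def)
    ultimately show ?thesis using D1(4)[OF that] by (simp add: f_def)
  qed
  have right: "f y - f x = (LINT t:{x..y}|lborel. g t)" if "x \<in> S2" "y \<in> S2" "x \<le> y" for x y
  proof -
    have "x \<ge> b" "y \<ge> b" using that b by auto
    then have ff: "f x = f2 x" "f y = f2 y" using eqb by (auto simp: f_def)
    have "AE t in lborel. t \<noteq> b" by (rule AE_lborel_singleton)
    then have "AE t\<in>{x..y} in lborel. g t = g2 t"
      by eventually_elim (use \<open>x \<ge> b\<close> in \<open>auto simp: g_def\<close>)
    then have "(LINT t:{x..y}|lborel. g t) = (LINT t:{x..y}|lborel. g2 t)"
      by (intro set_lebesgue_integral_cong_AE) auto
    then show ?thesis using D2(4)[OF that] ff by simp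
  qed
  have "f y - f x = (LINT t:{x..y}|lborel. g t)" if xy: "x \<in> S1 \<union> S2" "y \<in> S1 \<union> S2" "x \<le> y" for x y
  proof -
    consider "x \<in> S1" "y \<in> S1" | "x \<in> S2" "y \<in> S2" | "x \<in> S1" "y \<in> S2" | "x \<in> S2" "y \<in> S1" using xy by auto
    then show ?thesis
    proof cases
      case 3
      have xb: "x \<le> b" and yb: "b \<le> y" using 3 b by auto
      have i1: "set_integrable lborel {x..b} (\<lambda>t. (g t)\<^sup>2)" "set_integrable lborel {b..y} (\<lambda>t. (g t)\<^sup>2)"
        using 3 b Icc_subset_interval[OF int, of x b] Icc_subset_interval[OF int, of b y]
        by (intro set_integrable_subset[OF g2]; simp)+
      note i = i1[THEN set_integrable_of_square]
      have "{x..y} = {x..b} \<union> {b..y}" using xb yb by auto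
      then have "(LINT t:{x..y}|lborel. g t) = (LINT t:{x..b}|lborel. g t) + (LINT t:{b..y}|lborel. g t)"
        by (simp, intro set_integral_glue(2)[where b=b] i) auto
      then show ?thesis using left[OF 3(1) b(1) xb] right[OF b(2) 3(2) yb] by simp
    next
      case 4
      then have "b \<le> x" "y \<le> b" using b(3,4) by (auto simp: subset_eq)
      then have "x = b" "y = b" using xy by auto
      then show ?thesis using left[OF b(1) b(1)] by simp
    qed (use left right xy in auto)
  qed
  then show "H1_on (S1 \<union> S2) f g" unfolding H1_on_def using int f2 g2 by auto
qed

lemma H1_on_linear:
  "H1_on {a..b} (\<lambda>x. \<alpha> + \<beta> * x) (\<lambda>_. \<beta>)"
proof -
  have "set_integrable lborel {a..b} (\<lambda>x. (\<alpha> + \<beta> * x)\<^sup>2)"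
    by (auto intro!: borel_integrable_atLeastAtMost' continuous_intros)
  moreover have "set_integrable lborel {a..b} (\<lambda>x. \<beta>\<^sup>2)"
    by (auto intro!: borel_integrable_atLeastAtMost' continuous_intros)
  ultimately show ?thesis
    by (auto simp: H1_on_def is_interval_cc set_integral_Icc_const algebra_simps)
qed

lemma H1_on_zero: "is_interval S \<Longrightarrow> S \<in> sets borel \<Longrightarrow> H1_on S (\<lambda>_. 0) (\<lambda>_. 0)"
  by (auto simp: H1_on_def set_integrable_def)

section \<open>Weak derivatives and primitives\<close>

text \<open>\<open>tent\<close> is the hat function on \<open>[0, 1]\<close> with peak 2 and
  integral 1, written with truncated powers; \<open>spline\<close> is its primitive, a
  \<open>C^1\<close> step from 0 to 1, as smooth as \<open>test_function\<close> asks for.\<close>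

definition spline :: "real \<Rightarrow> real" where
  "spline x = 2 * ((max 0 x)\<^sup>2 - 2 * (max 0 (x - 1/2))\<^sup>2 + (max 0 (x - 1))\<^sup>2)"

definition tent :: "real \<Rightarrow> real" where
  "tent x = 4 * (max 0 x - 2 * max 0 (x - 1/2) + max 0 (x - 1))"

lemma DERIV_max_square:
  fixes x :: real
  shows "((\<lambda>x. (max 0 x)\<^sup>2) has_real_derivative 2 * max 0 x) (at x)"
proof -
  consider "x < 0" | "x > 0" | "x = 0" by linarith
  then show ?thesis
  proof cases
    case 1
    have "((\<lambda>x::real. 0::real) has_real_derivative 0) (at x)" by simp
    then have "((\<lambda>x. (max 0 x)\<^sup>2) has_real_derivative 0) (at x)"
      by (rule DERIV_cong_ev[THEN iffD1, rotated -1, OF _ refl _ refl])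
        (use 1 in \<open>auto simp: eventually_nhds max_def intro!: exI[of _ "{..<0}"]\<close>)
    then show ?thesis using 1 by simp
  next
    case 2
    have "((\<lambda>x::real. x\<^sup>2) has_real_derivative 2 * x) (at x)" by (auto intro!: derivative_eq_intros)
    then have "((\<lambda>x. (max 0 x)\<^sup>2) has_real_derivative 2 * x) (at x)"
      by (rule DERIV_cong_ev[THEN iffD1, rotated -1, OF _ refl _ refl])
        (use 2 in \<open>auto simp: eventually_nhds max_def intro!: exI[of _ "{0<..}"]\<close>)
    then show ?thesis using 2 by simp
  next
    case 3
    have "(\<lambda>h. ((max 0 (0 + h))\<^sup>2 - (max 0 0)\<^sup>2) / h) \<midarrow>0\<rightarrow> (0::real)"
    proof (rule Lim_null_comparison)
      show "\<forall>\<^sub>F h in at 0. norm (((max 0 (0 + h))\<^sup>2 - (max 0 0)\<^sup>2) / h) \<le> \<bar>h::real\<bar>"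
        by (auto intro!: always_eventually simp: max_def power2_eq_square)
      show "(\<lambda>h. \<bar>h::real\<bar>) \<midarrow>0\<rightarrow> 0" by (rule tendsto_rabs_zero[OF tendsto_ident_at])
    qed
    then show ?thesis unfolding 3 DERIV_def by simp
  qed
qed

lemma DERIV_spline: "(spline has_real_derivative tent x) (at x)"
proof -
  have *: "((\<lambda>x. (max 0 (x - c))\<^sup>2) has_real_derivative 2 * max 0 (x - c)) (at x)" for c
    using DERIV_shift[of "\<lambda>x. (max 0 x)\<^sup>2" "2 * max 0 (x - c)" x "-c"] DERIV_max_square[of "x - c"] by simp
  have "((\<lambda>x. 2 * ((max 0 (x - 0))\<^sup>2 - 2 * (max 0 (x - 1/2))\<^sup>2 + (max 0 (x - 1))\<^sup>2)) has_real_derivative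
     2 * ((2 * max 0 (x - 0) - 2 * (2 * max 0 (x - 1/2))) + 2 * max 0 (x - 1))) (at x)"
    by (intro DERIV_cmult DERIV_add DERIV_diff *)
  then show ?thesis by (simp add: spline_def[abs_def] tent_def algebra_simps)
qed

lemma continuous_on_tent: "continuous_on A tent"
  unfolding tent_def[abs_def] by (intro continuous_intros)

lemma tent_nonneg: "0 \<le> tent x" and tent_outside: "x \<notin> {0..1} \<Longrightarrow> tent x = 0"
  by (auto simp: tent_def max_def)

lemma spline_0: "x \<le> 0 \<Longrightarrow> spline x = 0" and spline_1: "x \<ge> 1 \<Longrightarrow> spline x = 1"
  by (auto simp: spline_def max_def power2_eq_square algebra_simps)

lemma spline_mono: "x \<le> y \<Longrightarrow> spline x \<le> spline y"
  using DERIV_spline tent_nonneg by (meson DERIV_nonneg_imp_nondecreasing)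

lemma spline_range: "0 \<le> spline x" "spline x \<le> 1"
  using spline_mono[of 0 x] spline_mono[of x 1] spline_0[of x] spline_0[of 0] spline_1[of x] spline_1[of 1] by linarith+

lemma has_bochner_integral_tent: "has_bochner_integral lborel (\<lambda>x. indicator {0..1} x *\<^sub>R tent x) 1"
  using has_bochner_integral_FTC_Icc[of 0 1 spline tent] DERIV_spline continuous_on_tent
  by (simp add: spline_0 spline_1 has_real_derivative_iff_has_vector_derivative has_vector_derivative_at_within)

text \<open>The scaled tents form an approximate identity supported to the right of
  \<open>a\<close>, on \<open>[a, a + 1 / (n + 1)]\<close>. The substitution
  \<open>t = (n + 1) * (x - a)\<close> moves all integrals to \<open>[0, 1]\<close>, where dominated
  convergence applies because \<open>f\<close> is bounded near \<open>a\<close>.\<close>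

lemma mollify_tendsto:
  fixes f :: "real \<Rightarrow> real"
  assumes S: "open S" "a \<in> S" and f: "continuous_on S f"
  shows "(\<lambda>n. LINT x:S|lborel. f x * (real (Suc n) * tent (real (Suc n) * (x - a)))) \<longlonglongrightarrow> f a"
proof -
  obtain r where r: "r > 0" "cball a r \<subseteq> S"
    using S open_contains_cball by blast
  have "{a..a + r} \<subseteq> cball a r" by (auto simp: dist_real_def)
  with r have r: "r > 0" "{a..a + r} \<subseteq> S" by auto
  obtain B where B: "\<And>x. x \<in> {a..a + r} \<Longrightarrow> \<bar>f x\<bar> \<le> B"
    using compact_imp_bounded[OF compact_continuous_image[OF continuous_on_subset[OF f r(2)] compact_Icc]]
    unfolding bounded_iff by (metis imageI real_norm_def)
  define s where "s n t = f (a + t / real (Suc n)) * (indicator {0..1} t *\<^sub>R tent t)" for n t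
  have eq: "(LINT x:S|lborel. f x * (real (Suc n) * tent (real (Suc n) * (x - a)))) = (LINT t|lborel. s n t)"
    if n: "1 / real (Suc n) \<le> r" for n
  proof -
    define N where "N = real (Suc n)"
    have N: "N > 0" "1 / N \<le> r" using n by (auto simp: N_def)
    have "(LINT x:S|lborel. f x * (N * tent (N * (x - a)))) =
       (LINT x|lborel. indicator S x *\<^sub>R (f x * (N * tent (N * (x - a)))))" by (simp add: set_lebesgue_integral_def)
    also have "\<dots> = \<bar>1/N\<bar> *\<^sub>R (LINT t|lborel. indicator S (a + 1/N * t) *\<^sub>R (f (a + 1/N * t) * (N * tent (N * ((a + 1/N*t) - a)))))"
      by (rule lborel_integral_real_affine) (use N in auto)
    also have "\<dots> = (LINT t|lborel. \<bar>1/N\<bar> *\<^sub>R (indicator S (a + 1/N * t) *\<^sub>R (f (a + 1/N * t) * (N * tent (N * ((a + 1/N*t) - a))))))"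
      by (rule integral_scaleR_right[symmetric])
    also have "\<dots> = (LINT t|lborel. s n t)"
    proof (rule Bochner_Integration.integral_cong[OF refl])
      fix t :: real
      show "\<bar>1/N\<bar> *\<^sub>R (indicator S (a + 1/N * t) *\<^sub>R (f (a + 1/N * t) * (N * tent (N * ((a + 1/N*t) - a))))) = s n t"
      proof -
        have s: "s n t = f (a + t / N) * (indicator {0..1} t *\<^sub>R tent t)" by (simp only: s_def N_def)
        have e: "N * ((a + 1/N*t) - a) = t" "a + 1/N * t = a + t / N" using N by simp_all
        show ?thesis
      proof (cases "t \<in> {0..1}")
        case True
        have "t / N \<le> 1 / N" using True N by (intro divide_right_mono) auto
        then have "a + t / N \<in> S" using r(2) True N by (force simp: subset_eq)
        then show ?thesis using N True unfolding s e by simp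
      next
        case False
        then show ?thesis using N unfolding s e by (simp add: tent_outside)
      qed
      qed
    qed
    finally show ?thesis by (simp add: N_def)
  qed
  \<comment> \<open>From index \<open>N0\<close> on, all supports lie in \<open>[a, a + r]\<close>;
    \<open>LIMSEQ_offset\<close> undoes the shift at the end.\<close>
  obtain N0 :: nat where N0: "1 / real (Suc N0) \<le> r"
    using reals_Archimedean[OF r(1)] by (auto simp: inverse_eq_divide intro: less_imp_le)
  have small: "1 / real (Suc (n + N0)) \<le> r" for n
    using N0 by (rule order_trans[rotated]) (auto simp: divide_simps)
  have in_r: "a + t / real (Suc (n + N0)) \<in> {a..a + r}" if "t \<in> {0..1}" for n t
  proof -
    have "t / real (Suc (n + N0)) \<le> 1 / real (Suc (n + N0))" using that by (intro divide_right_mono) auto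
    then show ?thesis using small[of n] that by auto
  qed
  have fr: "continuous_on {a..a+r} f" using continuous_on_subset[OF f r(2)] .
  note T = has_bochner_integral_tent[unfolded has_bochner_integral_iff]
  have "(\<lambda>n. LINT t|lborel. s (n + N0) t) \<longlonglongrightarrow> (LINT t|lborel. f a * (indicator {0..1} t *\<^sub>R tent t))"
  proof (rule integral_dominated_convergence[where w="\<lambda>t. B * (indicator {0..1} t *\<^sub>R tent t)"])
    show "(\<lambda>t. f a * (indicator {0..1} t *\<^sub>R tent t)) \<in> borel_measurable lborel"
      using T by (auto intro: borel_measurable_integrable)
    show "integrable lborel (\<lambda>t. B * (indicator {0..1} t *\<^sub>R tent t))" using T by auto
    show "s (n + N0) \<in> borel_measurable lborel" for n
    proof -
      have "continuous_on {0..1} (\<lambda>t. f (a + t / real (Suc (n + N0))) * tent t)"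
        using in_r by (intro continuous_intros continuous_on_tent continuous_on_compose2[OF fr]) auto
      then have "(\<lambda>t. indicator {0..1} t *\<^sub>R (f (a + t / real (Suc (n + N0))) * tent t)) \<in> borel_measurable borel"
        by (rule borel_measurable_continuous_on_indicator[rotated]) simp
      moreover have "s (n + N0) = (\<lambda>t. indicator {0..1} t *\<^sub>R (f (a + t / real (Suc (n + N0))) * tent t))"
        by (auto simp: s_def fun_eq_iff)
      ultimately show ?thesis by simp
    qed
    show "AE t in lborel. norm (s (n + N0) t) \<le> B * (indicator {0..1} t *\<^sub>R tent t)" for n
      using B in_r tent_nonneg by (intro AE_I2) (auto simp: s_def indicator_def abs_mult intro!: mult_right_mono)
    show "AE t in lborel. (\<lambda>n. s (n + N0) t) \<longlonglongrightarrow> f a * (indicator {0..1} t *\<^sub>R tent t)"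
    proof (intro AE_I2)
      fix t :: real
      show "(\<lambda>n. s (n + N0) t) \<longlonglongrightarrow> f a * (indicator {0..1} t *\<^sub>R tent t)"
      proof (cases "t \<in> {0..1}")
        case True
        have "(\<lambda>n. t / real (Suc (n + N0))) \<longlonglongrightarrow> 0"
          using LIMSEQ_ignore_initial_segment[OF tendsto_divide_0[OF tendsto_const filterlim_compose[OF filterlim_at_top_imp_at_infinity[OF filterlim_real_sequentially] filterlim_Suc]], of t N0] by simp
        then have "(\<lambda>n. a + t / real (Suc (n + N0))) \<longlonglongrightarrow> a" using tendsto_add[OF tendsto_const[of a]] by fastforce
        then have "(\<lambda>n. f (a + t / real (Suc (n + N0)))) \<longlonglongrightarrow> f a"
          by (rule continuous_on_tendsto_compose[OF fr _ _ always_eventually]) (use in_r[OF True] r in auto)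
        then show ?thesis unfolding s_def by (intro tendsto_mult tendsto_const)
      qed (simp add: s_def)
    qed
  qed
  moreover have "(LINT t|lborel. f a * (indicator {0..1} t *\<^sub>R tent t)) = f a" using T by simp
  ultimately have "(\<lambda>n. LINT x:S|lborel. f x * (real (Suc (n + N0)) * tent (real (Suc (n + N0)) * (x - a)))) \<longlonglongrightarrow> f a"
    unfolding eq[OF small] by (simp only:)
  then show ?thesis by (rule LIMSEQ_offset)
qed

text \<open>One step starts at \<open>a\<close>, the other at \<open>b\<close>, each of width
  \<open>1 / (n + 1)\<close>. The support thus sticks out of \<open>[a, b]\<close> on the right
  only.\<close>

lemma test_function_spline:
  assumes "a < b" "{a..b + 1 / real (Suc n)} \<subseteq> S"
  shows "test_function S (\<lambda>x. spline (real (Suc n) * (x - a)) - spline (real (Suc n) * (x - b)))"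
    and "deriv (\<lambda>x. spline (real (Suc n) * (x - a)) - spline (real (Suc n) * (x - b))) x
       = real (Suc n) * tent (real (Suc n) * (x - a)) - real (Suc n) * tent (real (Suc n) * (x - b))"
proof -
  define N where "N = real (Suc n)"
  have N: "N > 0" by (simp add: N_def)
  have D: "((\<lambda>x. spline (N * (x - a)) - spline (N * (x - b))) has_real_derivative
      N * tent (N * (x - a)) - N * tent (N * (x - b))) (at x)" for x
    by (auto intro!: derivative_eq_intros DERIV_chain2[OF DERIV_spline])
  show "deriv (\<lambda>x. spline (real (Suc n) * (x - a)) - spline (real (Suc n) * (x - b))) x
       = real (Suc n) * tent (real (Suc n) * (x - a)) - real (Suc n) * tent (real (Suc n) * (x - b))"
    using DERIV_imp_deriv[OF D[of x]] by (simp add: N_def)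
  have "spline (N * (x - a)) - spline (N * (x - b)) = 0" if "x \<notin> {a..b + 1 / N}" for x
  proof (cases "x < a")
    case True
    then have "N * (x - a) \<le> 0" "N * (x - b) \<le> 0" using N assms(1) by (auto intro!: mult_nonneg_nonpos)
    then show ?thesis by (simp add: spline_0)
  next
    case False
    then have "x > b + 1 / N" using that by auto
    then have "N * (x - b) \<ge> 1" using N by (simp add: field_simps)
    moreover have "N * (x - a) \<ge> N * (x - b)" using N assms(1) by (intro mult_left_mono) auto
    ultimately show ?thesis by (simp add: spline_1)
  qed
  moreover have "(\<lambda>x. spline (N * (x - a)) - spline (N * (x - b))) C1_differentiable_on UNIV"
    unfolding C1_differentiable_on_def
    using D by (intro exI[of _ "\<lambda>x. N * tent (N * (x - a)) - N * tent (N * (x - b))"])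
      (auto simp: has_real_derivative_iff_has_vector_derivative intro!: continuous_intros continuous_on_compose2[OF continuous_on_tent])
  ultimately show "test_function S (\<lambda>x. spline (real (Suc n) * (x - a)) - spline (real (Suc n) * (x - b)))"
    unfolding test_function_def N_def[symmetric] using assms(2)
    by (intro conjI exI[of _ "{a..b + 1 / N}"]) (auto simp: N_def)
qed

text \<open>Tested against a mollified indicator function of \<open>[a, b]\<close>.\<close>

lemma weak_deriv_primitive:
  assumes S: "open S" and w: "is_weak_deriv S f g" and f: "continuous_on S f"
    and ab: "a < b" "{a..b} \<subseteq> S"
  shows "f b - f a = (LINT t:{a..b}|lborel. g t)"
proof -
  have bS: "b \<in> S" "a \<in> S" using ab by auto
  obtain r where r: "r > 0" "cball b r \<subseteq> S" using S bS open_contains_cball by blast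
  have sub: "{a..b + r} \<subseteq> S"
  proof
    fix x assume "x \<in> {a..b + r}"
    then show "x \<in> S" using ab r by (cases "x \<le> b") (auto simp: cball_def dist_real_def subset_eq)
  qed
  obtain N0 :: nat where N0: "1 / real (Suc N0) \<le> r"
    using reals_Archimedean[OF r(1)] by (auto simp: inverse_eq_divide intro: less_imp_le)
  have small: "1 / real (Suc (n + N0)) \<le> r" for n
    using N0 by (rule order_trans[rotated]) (auto simp: divide_simps)
  define \<phi> where "\<phi> n x = spline (real (Suc n) * (x - a)) - spline (real (Suc n) * (x - b))" for n x
  define A where "A n = (LINT x:S|lborel. f x * (real (Suc n) * tent (real (Suc n) * (x - a))))" for n
  define B where "B n = (LINT x:S|lborel. f x * (real (Suc n) * tent (real (Suc n) * (x - b))))" for n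
  have gK: "set_integrable lborel {a..b + r} g"
    using w sub unfolding is_weak_deriv_def locally_integrable_def by auto
  \<comment> \<open>The factor \<open>tent\<close> confines the integrand to the compact interval
    \<open>[c, c + r]\<close>, on which \<open>f\<close> is continuous.\<close>
  have fT: "set_integrable lborel S (\<lambda>x. f x * (real (Suc n) * tent (real (Suc n) * (x - c))))"
    if c: "{c..c + r} \<subseteq> S" and n: "1 / real (Suc n) \<le> r" for n c
  proof -
    define N where "N = real (Suc n)"
    have N: "N > 0" "1 / N \<le> r" using n by (auto simp: N_def)
    have i: "set_integrable lborel {c..c + r} (\<lambda>x. f x * (N * tent (N * (x - c))))"
      using c by (intro borel_integrable_atLeastAtMost' continuous_intros continuous_on_subset[OF f]
         continuous_on_compose2[OF continuous_on_tent[of UNIV]]) auto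
    have out: "tent (N * (x - c)) = 0" if "x \<notin> {c..c + r}" for x
    proof (rule tent_outside, rule notI)
      assume "N * (x - c) \<in> {0..1}"
      then have "0 \<le> x - c" "x - c \<le> 1 / N" using N by (auto simp: field_simps zero_le_mult_iff)
      then show False using that N by auto
    qed
    have "(\<lambda>x. indicator S x *\<^sub>R (f x * (N * tent (N * (x - c))))) =
        (\<lambda>x. indicator {c..c + r} x *\<^sub>R (f x * (N * tent (N * (x - c)))))"
      using out c by (force simp: fun_eq_iff indicator_def)
    then show ?thesis using i unfolding set_integrable_def N_def by simp
  qed
  have subb: "{b..b + r} \<subseteq> S" using sub ab by auto
  have suba: "{a..a + r} \<subseteq> S" using sub ab by (auto simp: subset_eq)
  have key: "A (n + N0) - B (n + N0) = - (LINT x:S|lborel. g x * \<phi> (n + N0) x)" for n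
  proof -
    let ?m = "n + N0"
    have sub': "{a..b + 1 / real (Suc ?m)} \<subseteq> S" using sub small[of n] by (auto simp: subset_eq)
    note t = test_function_spline[OF ab(1) sub']
    have "A ?m - B ?m = (LINT x:S|lborel. f x * (real (Suc ?m) * tent (real (Suc ?m) * (x - a))) - f x * (real (Suc ?m) * tent (real (Suc ?m) * (x - b))))"
      unfolding A_def B_def by (rule set_integral_diff(2)[symmetric]) (intro fT suba subb small)+
    also have "\<dots> = (LINT x:S|lborel. f x * deriv (\<phi> ?m) x)"
      unfolding \<phi>_def[abs_def] t(2) by (simp add: right_diff_distrib)
    also have "\<dots> = - (LINT x:S|lborel. g x * \<phi> ?m x)"
      using w t(1) unfolding is_weak_deriv_def \<phi>_def[abs_def] by blast
    finally show ?thesis .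
  qed
  have "(\<lambda>n. A (n + N0) - B (n + N0)) \<longlonglongrightarrow> f a - f b"
    unfolding A_def B_def
    by (intro tendsto_diff LIMSEQ_ignore_initial_segment mollify_tendsto S bS f)
  \<comment> \<open>Both ramps lie to the right of their base points, so the test functions converge
    pointwise to the indicator of the half-open \<open>{a<..b}\<close>; the point \<open>a\<close>
    is added at the end as a null set.\<close>
  moreover have "(\<lambda>n. LINT x:S|lborel. g x * \<phi> (n + N0) x) \<longlonglongrightarrow> (LINT x:{a<..b}|lborel. g x)"
    unfolding set_lebesgue_integral_def
  proof (rule integral_dominated_convergence[where w="\<lambda>x. \<bar>indicator {a..b + r} x *\<^sub>R g x\<bar>"])
    have out: "\<phi> (n + N0) x = 0" if "x \<notin> {a..b + r}" for n x
    proof (cases "x < a")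
      case True
      then show ?thesis unfolding \<phi>_def using ab by (simp add: spline_0 mult_nonneg_nonpos)
    next
      case False
      then have "x \<ge> b + 1 / real (Suc (n + N0))" using that small[of n] by auto
      then have "real (Suc (n + N0)) * (x - b) \<ge> 1" by (simp add: field_simps)
      moreover have "real (Suc (n + N0)) * (x - a) \<ge> real (Suc (n + N0)) * (x - b)" using ab(1) by (intro mult_left_mono) auto
      ultimately have "spline (real (Suc (n + N0)) * (x - b)) = 1" "spline (real (Suc (n + N0)) * (x - a)) = 1"
        by (intro spline_1; linarith)+
      then show ?thesis unfolding \<phi>_def by linarith
    qed
    have gm: "(\<lambda>x. indicator {a..b + r} x *\<^sub>R g x) \<in> borel_measurable lborel"
      using gK unfolding set_integrable_def by (rule borel_measurable_integrable)
    have splm: "(\<lambda>x. spline (c * (x - d))) \<in> borel_measurable lborel" for c d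
    proof -
      have "continuous_on UNIV (\<lambda>x. spline (c * (x - d)))"
        by (rule continuous_on_compose2[OF DERIV_continuous_on[OF has_field_derivative_at_within[OF DERIV_spline], of UNIV]])
          (auto intro!: continuous_intros)
      then have "(\<lambda>x. spline (c * (x - d))) \<in> borel_measurable borel" by (rule borel_measurable_continuous_onI)
      then show ?thesis by simp
    qed
    have eq: "(\<lambda>x. indicator S x *\<^sub>R (g x * \<phi> (n + N0) x)) = (\<lambda>x. (indicator {a..b + r} x *\<^sub>R g x) * \<phi> (n + N0) x)" for n
    proof
      fix x show "indicator S x *\<^sub>R (g x * \<phi> (n + N0) x) = (indicator {a..b + r} x *\<^sub>R g x) * \<phi> (n + N0) x"
        using out[of x n] sub by (cases "x \<in> {a..b + r}") (auto simp: subset_eq)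
    qed
    show "(\<lambda>x. indicator S x *\<^sub>R (g x * \<phi> (n + N0) x)) \<in> borel_measurable lborel" for n
    proof -
      have "(\<lambda>x. \<phi> (n + N0) x) \<in> borel_measurable lborel"
        unfolding \<phi>_def using splm by (intro borel_measurable_diff)
      then show ?thesis unfolding eq using gm by (intro borel_measurable_times)
    qed
    have "{a<..b} \<subseteq> {a..b+r}" using r by auto
    then have "set_integrable lborel {a<..b} g" using set_integrable_subset[OF gK] by auto
    then show "(\<lambda>x. indicator {a<..b} x *\<^sub>R g x) \<in> borel_measurable lborel"
       unfolding set_integrable_def by (rule borel_measurable_integrable)
    show "integrable lborel (\<lambda>x. \<bar>indicator {a..b + r} x *\<^sub>R g x\<bar>)"
      using gK unfolding set_integrable_def by (rule integrable_abs)
    have \<phi>1: "\<bar>\<phi> n x\<bar> \<le> 1" for n x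
      unfolding \<phi>_def using spline_range[of "real (Suc n) * (x - a)"] spline_range[of "real (Suc n) * (x - b)"] by linarith
    show "AE x in lborel. norm (indicator S x *\<^sub>R (g x * \<phi> (n + N0) x)) \<le> \<bar>indicator {a..b + r} x *\<^sub>R g x\<bar>" for n
      unfolding fun_cong[OF eq] real_norm_def abs_mult using \<phi>1 by (intro AE_I2 mult_left_le) auto
    show "AE x in lborel. (\<lambda>n. indicator S x *\<^sub>R (g x * \<phi> (n + N0) x)) \<longlonglongrightarrow> indicator {a<..b} x *\<^sub>R g x"
    proof (intro AE_I2)
      fix x
      have lim: "\<forall>\<^sub>F n in sequentially. spline (real (Suc (n + N0)) * (x - c)) = (if x \<le> c then 0 else 1)" for c
      proof (cases "x \<le> c")
        case True
        then show ?thesis by (auto intro!: always_eventually spline_0 mult_nonneg_nonpos)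
      next
        case False
        obtain M :: nat where M: "1 / (x - c) \<le> real M" using real_arch_simple by blast
        have "1 \<le> real (Suc (n + N0)) * (x - c)" if "n \<ge> M" for n
        proof -
          have "1 = 1 / (x - c) * (x - c)" using False by simp
          also have "\<dots> \<le> real (Suc (n + N0)) * (x - c)" using M that False by (intro mult_right_mono) auto
          finally show ?thesis .
        qed
        then show ?thesis using False by (auto simp: eventually_sequentially intro!: exI[of _ M] spline_1)
      qed
      have "\<forall>\<^sub>F n in sequentially. indicator S x *\<^sub>R (g x * \<phi> (n + N0) x) = indicator {a<..b} x *\<^sub>R g x"
        using lim[of a] lim[of b]
      proof eventually_elim
        case (elim n)
        show ?case using ab sub r unfolding \<phi>_def elim by (auto simp: indicator_def subset_eq)
      qed
      then show "(\<lambda>n. indicator S x *\<^sub>R (g x * \<phi> (n + N0) x)) \<longlonglongrightarrow> indicator {a<..b} x *\<^sub>R g x"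
        by (rule tendsto_eventually)
    qed
  qed
  then have "(\<lambda>n. A (n + N0) - B (n + N0)) \<longlonglongrightarrow> - (LINT x:{a<..b}|lborel. g x)"
    unfolding key by (rule tendsto_minus)
  ultimately have "f a - f b = - (LINT x:{a<..b}|lborel. g x)" by (rule LIMSEQ_unique)
  moreover have "(LINT x:{a<..b}|lborel. g x) = (LINT x:{a..b}|lborel. g x)"
    by (rule set_integral_discrete_difference[where X="{a}"]) auto
  ultimately show ?thesis by simp
qed

section \<open>Measurability and almost everywhere uniqueness of weak derivatives\<close>

lemma interval_cover_rational:
  fixes S :: "real set"
  assumes "open S" "x \<in> S"
  obtains r s where "r \<in> \<rat>" "s \<in> \<rat>" "x \<in> {r..s}" "r < s" "{r..s} \<subseteq> S"
proof -
  obtain e where e: "e > 0" "cball x e \<subseteq> S" using assms open_contains_cball by blast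
  obtain r where r: "r \<in> \<rat>" "x - e < r" "r < x" using Rats_dense_in_real[of "x - e" x] e by auto
  obtain s where s: "s \<in> \<rat>" "x < s" "s < x + e" using Rats_dense_in_real[of x "x + e"] e by auto
  have "{r..s} \<subseteq> cball x e" using r s by (auto simp: dist_real_def)
  then show ?thesis using that[of r s] r s e by auto
qed

text \<open>Local integrability yields measurability on compact intervals; countably many of them,
  with rational endpoints, cover \<open>S\<close> and together with \<open>- S\<close> permit a
  piecewise argument.\<close>

lemma locally_integrable_borel_measurable:
  assumes S: "open S" and g: "locally_integrable S g"
  shows "(\<lambda>x. indicator S x * g x) \<in> borel_measurable borel"
proof (rule measurable_piecewise_restrict)
  define C where "C = insert (- S) ((\<lambda>(r, s). {r..s}) ` {(r, s). r \<in> \<rat> \<and> s \<in> \<rat> \<and> {r..s} \<subseteq> S})"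
  have "countable {(r, s). r \<in> \<rat> \<and> s \<in> \<rat> \<and> {r..s::real} \<subseteq> S}"
    by (rule countable_subset[OF _ countable_SIGMA[OF countable_rat countable_rat]]) auto
  then show "countable C" unfolding C_def by auto
  show "\<Omega> \<inter> space borel \<in> sets borel" if "\<Omega> \<in> C" for \<Omega>
    using that S unfolding C_def by auto
  show "space borel \<subseteq> \<Union>C"
  proof
    fix x :: real
    show "x \<in> \<Union>C"
    proof (cases "x \<in> S")
      case True
      then obtain r s where "r \<in> \<rat>" "s \<in> \<rat>" "x \<in> {r..s}" "{r..s} \<subseteq> S"
        using interval_cover_rational[OF S] by metis
      then show ?thesis unfolding C_def by (auto intro!: bexI[of _ "(r, s)"])
    qed (auto simp: C_def)
  qed
  show "(\<lambda>x. indicator S x * g x) \<in> borel_measurable (restrict_space borel \<Omega>)" if \<Omega>: "\<Omega> \<in> C" for \<Omega>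
  proof (cases "\<Omega> = - S")
    case True
    have "(\<lambda>x. indicator S x * g x) \<in> borel_measurable (restrict_space borel \<Omega>) \<longleftrightarrow>
       (\<lambda>x. 0 :: real) \<in> borel_measurable (restrict_space borel \<Omega>)"
      by (rule measurable_cong) (auto simp: space_restrict_space True)
    then show ?thesis by simp
  next
    case False
    then obtain r s where rs: "\<Omega> = {r..s}" "{r..s} \<subseteq> S" using \<Omega> unfolding C_def by auto
    have "set_integrable lborel {r..s} g" using g rs unfolding locally_integrable_def by auto
    then have "(\<lambda>x. indicator {r..s} x *\<^sub>R g x) \<in> borel_measurable lborel"
      unfolding set_integrable_def by (rule borel_measurable_integrable)
    then have "g \<in> borel_measurable (restrict_space borel \<Omega>)"
      unfolding rs by (subst borel_measurable_restrict_space_iff) auto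
    moreover have "(\<lambda>x. indicator S x * g x) \<in> borel_measurable (restrict_space borel \<Omega>) \<longleftrightarrow>
       g \<in> borel_measurable (restrict_space borel \<Omega>)"
      by (rule measurable_cong) (use rs in \<open>auto simp: space_restrict_space subset_eq\<close>)
    ultimately show ?thesis by simp
  qed
qed

text \<open>The positive and the negative part of \<open>h\<close> are densities of finite measures
  that agree on all rays \<open>{x<..}\<close>. The measures are therefore equal, and their
  densities coincide almost everywhere.\<close>

lemma AE_eq_0_if_primitive_0:
  fixes h :: "real \<Rightarrow> real"
  assumes h: "integrable lborel h" and z: "\<And>x. (LINT t:{x<..}|lborel. h t) = 0"
  shows "AE x in lborel. h x = 0"
proof -
  define P where "P x = max 0 (h x)" for x
  define N where "N x = max 0 (- h x)" for x
  have hm[measurable]: "h \<in> borel_measurable borel" using borel_measurable_integrable[OF h] by simp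
  have iP: "integrable lborel P" "integrable lborel N" unfolding P_def[abs_def] N_def[abs_def] using h by auto
  have PN: "P x \<ge> 0" "N x \<ge> 0" "h x = P x - N x" for x by (auto simp: P_def N_def)
  have fin: "(\<integral>\<^sup>+ t. ennreal (P t) \<partial>lborel) < \<infinity>"
    using iP(1) PN by (simp add: integrable_iff_bounded)
  have Pm[measurable]: "P \<in> borel_measurable borel" "N \<in> borel_measurable borel"
    unfolding P_def[abs_def] N_def[abs_def] by measurable
  have em: "emeasure (density lborel (\<lambda>t. ennreal (F t))) {x<..} = ennreal (LINT t:{x<..}|lborel. F t)"
    if F: "integrable lborel F" "\<And>t. F t \<ge> 0" for F :: "real \<Rightarrow> real" and x
  proof -
    have Fm: "F \<in> borel_measurable borel" using borel_measurable_integrable[OF F(1)] by simp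
    have i: "integrable lborel (\<lambda>t. indicator {x<..} t *\<^sub>R F t)"
      by (rule integrable_mult_indicator[OF _ F(1)]) (auto intro: borel_open)
    have "emeasure (density lborel (\<lambda>t. ennreal (F t))) {x<..} = (\<integral>\<^sup>+t. ennreal (F t) * indicator {x<..} t \<partial>lborel)"
      using Fm by (subst emeasure_density) auto
    also have "\<dots> = (\<integral>\<^sup>+t. ennreal (indicator {x<..} t *\<^sub>R F t) \<partial>lborel)"
      by (rule nn_integral_cong) (auto simp: indicator_def)
    also have "\<dots> = ennreal (LINT t:{x<..}|lborel. F t)"
      unfolding set_lebesgue_integral_def using i by (rule nn_integral_eq_integral) (use F in auto)
    finally show ?thesis .
  qed
  have si: "set_integrable lborel {x<..} P" "set_integrable lborel {x<..} N" for x
    unfolding set_integrable_def using integrable_mult_indicator[OF _ iP(1), of "{x<..}"] integrable_mult_indicator[OF _ iP(2), of "{x<..}"] by simp_all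
  have eq: "(LINT t:{x<..}|lborel. P t) = (LINT t:{x<..}|lborel. N t)" for x
    using z[of x] set_integral_diff(2)[OF si[of x]] PN(3) by simp
  have "density lborel (\<lambda>t. ennreal (P t)) = density lborel (\<lambda>t. ennreal (N t))"
    by (rule measure_eqI_lessThan) (use em[OF iP(1) PN(1)] em[OF iP(2) PN(2)] eq in auto)
  then have "AE x in lborel. ennreal (P x) = ennreal (N x)"
    using finite_density_unique[of "\<lambda>t. ennreal (P t)" lborel "\<lambda>t. ennreal (N t)"] fin by auto
  then show ?thesis by eventually_elim (use PN in auto)
qed

lemma AE_eq_if_integrals_eq:
  assumes S: "open S" and g1: "locally_integrable S g1" and g2: "locally_integrable S g2"
    and eq: "\<And>a b. a < b \<Longrightarrow> {a..b} \<subseteq> S \<Longrightarrow> (LINT t:{a..b}|lborel. g1 t) = (LINT t:{a..b}|lborel. g2 t)"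
  shows "AE x in lborel. x \<in> S \<longrightarrow> g1 x = g2 x"
proof -
  have 1: "AE x in lborel. x \<in> {a..b} \<longrightarrow> g1 x = g2 x" if ab: "a < b" "{a..b} \<subseteq> S" for a b
  proof -
    have i: "set_integrable lborel {a..b} g1" "set_integrable lborel {a..b} g2"
      using g1 g2 ab unfolding locally_integrable_def by auto
    define h where "h t = indicator {a..b} t *\<^sub>R (g1 t - g2 t)" for t
    have ih: "integrable lborel h"
      using set_integral_diff(1)[OF i] unfolding h_def[abs_def] set_integrable_def .
    have "(LINT t:{x<..}|lborel. h t) = 0" for x
    proof (cases "x < b")
      case True
      define c where "c = max a x"
      have c: "c < b" "{c..b} \<subseteq> S" "{c..b} \<subseteq> {a..b}" using ab True by (auto simp: c_def)
      have j: "set_integrable lborel {c..b} g1" "set_integrable lborel {c..b} g2"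
        using set_integrable_subset[OF i(1), of "{c..b}"] set_integrable_subset[OF i(2), of "{c..b}"] c by auto
      have "(LINT t:{x<..}|lborel. h t) = (LINT t:{c..b}|lborel. g1 t - g2 t)"
        unfolding set_lebesgue_integral_def
      proof (rule integral_cong_AE)
        show "(\<lambda>t. indicator {x<..} t *\<^sub>R h t) \<in> borel_measurable lborel"
          using borel_measurable_integrable[OF ih] by measurable
        show "(\<lambda>t. indicator {c..b} t *\<^sub>R (g1 t - g2 t)) \<in> borel_measurable lborel"
          using set_integral_diff(1)[OF j] unfolding set_integrable_def by (rule borel_measurable_integrable)
        show "AE t in lborel. indicator {x<..} t *\<^sub>R h t = indicator {c..b} t *\<^sub>R (g1 t - g2 t)"
          using AE_lborel_singleton[of x] by eventually_elim (auto simp: h_def c_def indicator_def)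
      qed
      also have "\<dots> = 0" using set_integral_diff(2)[OF j] eq[OF c(1,2)] by simp
      finally show ?thesis .
    next
      case False
      then have "(LINT t:{x<..}|lborel. h t) = (LINT t:{x<..}|lborel. 0)"
        by (intro set_lebesgue_integral_cong) (auto simp: h_def)
      then show ?thesis by simp
    qed
    then have "AE x in lborel. h x = 0" by (rule AE_eq_0_if_primitive_0[OF ih])
    then show ?thesis by eventually_elim (auto simp: h_def)
  qed
  define Q where "Q = {(r, s). r \<in> \<rat> \<and> s \<in> \<rat> \<and> r < s \<and> {r..s::real} \<subseteq> S}"
  have "countable Q" unfolding Q_def
    by (rule countable_subset[OF _ countable_SIGMA[OF countable_rat countable_rat]]) auto
  then have "AE x in lborel. \<forall>(r, s)\<in>Q. x \<in> {r..s} \<longrightarrow> g1 x = g2 x"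
    by (subst AE_ball_countable) (use 1 in \<open>auto simp: Q_def\<close>)
  then show ?thesis
  proof eventually_elim
    case (elim x)
    show ?case
    proof
      assume "x \<in> S"
      then obtain r s where "r \<in> \<rat>" "s \<in> \<rat>" "x \<in> {r..s}" "r < s" "{r..s} \<subseteq> S"
        using interval_cover_rational[OF S] by metis
      then show "g1 x = g2 x" using elim by (auto simp: Q_def)
    qed
  qed
qed

text \<open>Both derivatives reproduce the increments of \<open>f\<close>, so they have the same
  integrals over compact intervals. This frees the estimates from the representative that
  \<open>SOME\<close> picks in \<open>weak_deriv\<close>.\<close>

lemma weak_deriv_unique:
  assumes S: "open S" and w: "is_weak_deriv S f g1" "is_weak_deriv S f g2" and f: "continuous_on S f"
  shows "AE x in lborel. x \<in> S \<longrightarrow> g1 x = g2 x"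
  using w by (intro AE_eq_if_integrals_eq[OF S])
    (auto simp: is_weak_deriv_def weak_deriv_primitive[OF S w(1) f, symmetric] weak_deriv_primitive[OF S w(2) f, symmetric])

section \<open>Primitives as weak derivatives, and extension to closed edges\<close>

lemma is_weak_deriv_weak_deriv: "is_weak_deriv S f g \<Longrightarrow> is_weak_deriv S f (weak_deriv S f)"
  unfolding weak_deriv_def by (rule someI[where P="is_weak_deriv S f"])

text \<open>Integration by parts through Fubini: \<open>f\<close> is known only through its
  increments, so \<open>f x - f a\<close> is written as an integral of \<open>g\<close>, and the
  order of integration over the triangle \<open>t \<le> x\<close> is exchanged.\<close>

lemma primitive_is_weak_deriv:
  assumes H: "H1_on D f g" and S: "open S" "S \<subseteq> D" "is_interval S"
  shows "is_weak_deriv S f g"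
proof -
  have H': "H1_on S f g" using H1_on_subset[OF H S(2,3)] S(1) by auto
  have ivl: "\<exists>a b. a \<le> b \<and> K \<subseteq> {a..b} \<and> {a..b} \<subseteq> S" if K: "compact K" "K \<subseteq> S" "K \<noteq> {}" for K
  proof -
    have "Inf K \<in> K" "Sup K \<in> K" using K compact_imp_closed compact_imp_bounded
      by (auto intro!: closed_contains_Inf closed_contains_Sup bounded_imp_bdd_below bounded_imp_bdd_above)
    moreover have "K \<subseteq> {Inf K..Sup K}" using K compact_imp_bounded[OF K(1)]
      by (auto intro!: cInf_lower cSup_upper bounded_imp_bdd_below bounded_imp_bdd_above)
    ultimately show ?thesis using Icc_subset_interval[OF S(3)] K(2)
      by (intro exI[of _ "Inf K"] exI[of _ "Sup K"]) (auto simp: subset_eq)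
  qed
  have li: "locally_integrable S F"
    if F: "\<And>a b. {a..b} \<subseteq> S \<Longrightarrow> a \<in> S \<Longrightarrow> b \<in> S \<Longrightarrow> set_integrable lborel {a..b} F" for F
    unfolding locally_integrable_def
  proof (intro allI impI, elim conjE)
    fix K :: "real set" assume K: "compact K" "K \<subseteq> S"
    show "set_integrable lborel K F"
    proof (cases "K = {}")
      case False
      then obtain a b where "a \<le> b" "K \<subseteq> {a..b}" "{a..b} \<subseteq> S" using ivl K by metis
      moreover have "K \<in> sets lborel" using K(1) by (simp add: borel_compact)
      moreover have "set_integrable lborel {a..b} F"
        using \<open>a \<le> b\<close> \<open>{a..b} \<subseteq> S\<close> by (intro F) auto
      ultimately show ?thesis by (metis set_integrable_subset)
    qed simp
  qed
  have lf: "locally_integrable S f"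
    using H1_on_continuous[OF H']
    by (intro li borel_integrable_atLeastAtMost') (auto intro: continuous_on_subset)
  have lg: "locally_integrable S g"
    using H1_on_deriv_integrable(1)[OF H'] by (intro li)
  have "(LINT x:S|lborel. f x * deriv \<phi> x) = - (LINT x:S|lborel. g x * \<phi> x)" if \<phi>: "test_function S \<phi>" for \<phi>
  proof -
    obtain D where D: "\<And>x. (\<phi> has_vector_derivative D x) (at x)" "continuous_on UNIV D"
      using \<phi> unfolding test_function_def C1_differentiable_on_def by auto
    have D': "(\<phi> has_real_derivative D x) (at x)" for x using D(1) by (simp add: has_real_derivative_iff_has_vector_derivative)
    have dD: "deriv \<phi> = D" using DERIV_imp_deriv[OF D'] by auto
    obtain K where K: "compact K" "K \<subseteq> S" "\<And>x. x \<notin> K \<Longrightarrow> \<phi> x = 0"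
      using \<phi> unfolding test_function_def by auto
    show ?thesis
    proof (cases "K = {}")
      case True
      then have "\<phi> = (\<lambda>x. 0)" using K by auto
      then show ?thesis by simp
    next
      case False
      then obtain a b where ab: "a \<le> b" "K \<subseteq> {a..b}" "{a..b} \<subseteq> S" using ivl K by metis
      have \<phi>0: "\<phi> x = 0" if "x \<notin> {a..b}" for x using K(3)[of x] ab(2) that by blast
      have cont\<phi>: "isCont \<phi> x" for x using D'[of x] by (rule DERIV_isCont)
      have D0: "D x = 0" if "x \<notin> {a..b}" for x
      proof -
        have "((\<lambda>_. 0) has_real_derivative D x) (at x)"
          using D'[of x]
          by (rule DERIV_cong_ev[THEN iffD1, rotated -1, OF _ refl _ refl])
            (use that \<phi>0 in \<open>auto simp: eventually_nhds intro!: exI[of _ "- {a..b}"]\<close>)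
        then show ?thesis using DERIV_unique DERIV_const by blast
      qed
      \<comment> \<open>\<open>K\<close> may contain \<open>a\<close> or \<open>b\<close>, so the
        endpoint values of \<open>\<phi>\<close> come from its continuity and its vanishing outside
        \<open>[a, b]\<close>.\<close>
      have \<phi>a: "\<phi> a = 0"
      proof -
        have "(\<phi> \<longlongrightarrow> \<phi> a) (at_left a)" using cont\<phi>[of a] unfolding isCont_def by (rule filterlim_at_split[THEN iffD1, THEN conjunct1])
        moreover have "(\<phi> \<longlongrightarrow> 0) (at_left a)"
          by (rule tendsto_eventually) (auto simp: eventually_at_filter intro!: always_eventually \<phi>0)
        ultimately show ?thesis by (rule tendsto_unique[rotated]) simp
      qed
      have \<phi>b: "\<phi> b = 0"
      proof -
        have "(\<phi> \<longlongrightarrow> \<phi> b) (at_right b)" using cont\<phi>[of b] unfolding isCont_def by (rule filterlim_at_split[THEN iffD1, THEN conjunct2])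
        moreover have "(\<phi> \<longlongrightarrow> 0) (at_right b)"
          by (rule tendsto_eventually) (auto simp: eventually_at_filter intro!: always_eventually \<phi>0)
        ultimately show ?thesis by (rule tendsto_unique[rotated]) simp
      qed
      have FTC: "(LINT t:{u..b}|lborel. D t) = - \<phi> u" if "u \<le> b" for u
        unfolding set_lebesgue_integral_def
        using integral_FTC_Icc[OF that, of \<phi> D] D by (simp add: has_vector_derivative_at_within continuous_on_subset \<phi>b)
      define p where "p x = indicator {a..b} x * D x" for x
      define q where "q t = indicator {a..b} t * g t" for t
      have iD: "set_integrable lborel {a..b} D"
        using D(2) by (intro borel_integrable_atLeastAtMost') (auto intro: continuous_on_subset)
      have ig: "set_integrable lborel {a..b} g"
        using lg ab(3) unfolding locally_integrable_def by auto
      have ip: "integrable lborel p" and iq: "integrable lborel q"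
        using iD ig unfolding p_def[abs_def] q_def[abs_def] set_integrable_def by simp_all
      have pm[measurable]: "p \<in> borel_measurable borel" "q \<in> borel_measurable borel"
        using borel_measurable_integrable[OF ip] borel_measurable_integrable[OF iq] by simp_all
      \<comment> \<open>The integrand on the triangle, extended by zero to the plane. Integrating in
        \<open>t\<close> first yields increments of \<open>f\<close>; integrating in
        \<open>x\<close> first yields \<open>\<phi>\<close>.\<close>
      define F where "F x t = p x * q t * (if t \<le> x then 1 else 0)" for x t :: real
      have iPQ: "integrable (lborel \<Otimes>\<^sub>M lborel) (\<lambda>(x, t). p x * q t)"
      proof (rule lborel_pair.Fubini_integrable)
        show "(\<lambda>(x, t). p x * q t) \<in> borel_measurable (lborel \<Otimes>\<^sub>M lborel)" by measurable
        show "integrable lborel (\<lambda>x. LINT y|lborel. norm (case (x, y) of (x, t) \<Rightarrow> p x * q t))"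
          using ip by (simp add: abs_mult)
        show "AE x in lborel. integrable lborel (\<lambda>y. case (x, y) of (x, t) \<Rightarrow> p x * q t)"
          using iq by simp
      qed
      have iF: "integrable (lborel \<Otimes>\<^sub>M lborel) (\<lambda>(x, t). F x t)"
        by (rule Bochner_Integration.integrable_bound[OF iPQ]) (auto simp: F_def)
      have fub: "(LINT t|lborel. (LINT x|lborel. F x t)) = (LINT x|lborel. (LINT t|lborel. F x t))"
        by (rule lborel_pair.Fubini_integral[OF iF])
      have inner1: "(LINT t|lborel. F x t) = p x * (f x - f a)" for x
      proof (cases "x \<in> {a..b}")
        case True
        have "(LINT t|lborel. F x t) = (LINT t|lborel. p x * (indicator {a..x} t *\<^sub>R g t))"
          by (rule Bochner_Integration.integral_cong) (use True in \<open>auto simp: F_def q_def indicator_def\<close>)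
        also have "\<dots> = p x * (LINT t:{a..x}|lborel. g t)" by (simp add: set_lebesgue_integral_def)
        also have "(LINT t:{a..x}|lborel. g t) = f x - f a"
          by (rule H1_onD(4)[OF H', symmetric]) (use True ab(1,3) in auto)
        finally show ?thesis .
      qed (simp add: F_def p_def)
      have inner2: "(LINT x|lborel. F x t) = - (q t * \<phi> t)" for t
      proof (cases "t \<in> {a..b}")
        case True
        have "(LINT x|lborel. F x t) = (LINT x|lborel. q t * (indicator {t..b} x *\<^sub>R D x))"
          by (rule Bochner_Integration.integral_cong) (use True in \<open>auto simp: F_def p_def indicator_def\<close>)
        also have "\<dots> = q t * (LINT x:{t..b}|lborel. D x)" by (simp add: set_lebesgue_integral_def)
        finally show ?thesis using FTC[of t] True by simp
      qed (simp add: F_def q_def)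
      have fD: "set_integrable lborel {a..b} (\<lambda>x. f x * D x)"
        using H1_on_continuous[OF H'] D(2) ab(3)
        by (intro borel_integrable_atLeastAtMost' continuous_intros) (auto intro: continuous_on_subset)
      have "(LINT x:S|lborel. f x * deriv \<phi> x) = (LINT x|lborel. indicator {a..b} x *\<^sub>R (f x * D x))"
        unfolding set_lebesgue_integral_def dD
        by (rule Bochner_Integration.integral_cong) (use D0 ab(3) in \<open>auto simp: indicator_def\<close>)
      \<comment> \<open>The constant \<open>f a\<close> is split off; it contributes
        \<open>f a * (\<phi> b - \<phi> a) = 0\<close>.\<close>
      also have "\<dots> = (LINT x|lborel. p x * (f x - f a) + f a * p x)"
        by (rule Bochner_Integration.integral_cong) (auto simp: p_def algebra_simps)
      also have "\<dots> = (LINT x|lborel. p x * (f x - f a)) + f a * (LINT x|lborel. p x)"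
      proof -
        have "integrable lborel (\<lambda>x. p x * (f x - f a))"
          using lborel_pair.integrable_fst[OF iF] unfolding inner1 .
        then show ?thesis using ip by (subst Bochner_Integration.integral_add) auto
      qed
      also have "(LINT x|lborel. p x) = 0"
        using FTC[OF ab(1)] \<phi>a unfolding p_def[abs_def] set_lebesgue_integral_def by simp
      also have "(LINT x|lborel. p x * (f x - f a)) = (LINT t|lborel. - (q t * \<phi> t))"
        using fub unfolding inner1 inner2 by simp
      also have "\<dots> = - (LINT t:S|lborel. g t * \<phi> t)"
        unfolding set_lebesgue_integral_def integral_minus[symmetric]
        by (rule Bochner_Integration.integral_cong) (use \<phi>0 ab(3) in \<open>auto simp: q_def indicator_def\<close>)
      finally show ?thesis by simp
    qed
  qed
  then show ?thesis unfolding is_weak_deriv_def using lf lg by blast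
qed

lemma set_integral_weak_deriv_square:
  assumes H: "H1_on D f g" and S: "open S" "S \<subseteq> D" "is_interval S"
  shows "set_integrable lborel S (\<lambda>x. \<bar>weak_deriv S f x\<bar>\<^sup>2)"
    and "(LINT x:S|lborel. \<bar>weak_deriv S f x\<bar>\<^sup>2) = (LINT x:S|lborel. (g x)\<^sup>2)"
proof -
  have w: "is_weak_deriv S f g" by (rule primitive_is_weak_deriv[OF assms])
  note w' = is_weak_deriv_weak_deriv[OF w]
  have H': "H1_on S f g" using H1_on_subset[OF H S(2,3)] S(1) by auto
  have ae: "AE x in lborel. x \<in> S \<longrightarrow> weak_deriv S f x = g x"
    by (rule weak_deriv_unique[OF S(1) w' w H1_on_continuous[OF H']])
  have [measurable]: "(\<lambda>x. indicator S x * weak_deriv S f x) \<in> borel_measurable borel"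
    using locally_integrable_borel_measurable[OF S(1)] w' unfolding is_weak_deriv_def by auto
  have [measurable]: "S \<in> sets borel" "g \<in> borel_measurable borel" using H1_onD[OF H'] by auto
  have eq: "indicator S x *\<^sub>R \<bar>weak_deriv S f x\<bar>\<^sup>2 = (indicator S x * weak_deriv S f x)\<^sup>2" for x
    by (simp add: indicator_def)
  have m: "(\<lambda>x. indicator S x *\<^sub>R \<bar>weak_deriv S f x\<bar>\<^sup>2) \<in> borel_measurable lborel"
    unfolding eq by measurable
  have m': "(\<lambda>x. indicator S x *\<^sub>R (g x)\<^sup>2) \<in> borel_measurable lborel" by measurable
  have ae': "AE x in lborel. indicator S x *\<^sub>R \<bar>weak_deriv S f x\<bar>\<^sup>2 = indicator S x *\<^sub>R (g x)\<^sup>2"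
    using ae by eventually_elim (auto simp: indicator_def)
  show "set_integrable lborel S (\<lambda>x. \<bar>weak_deriv S f x\<bar>\<^sup>2)"
    using integrable_cong_AE[OF m m' ae'] H1_onD(6)[OF H'] unfolding set_integrable_def by simp
  show "(LINT x:S|lborel. \<bar>weak_deriv S f x\<bar>\<^sup>2) = (LINT x:S|lborel. (g x)\<^sup>2)"
    using integral_cong_AE[OF m m' ae'] unfolding set_lebesgue_integral_def .
qed

text \<open>Membership in \<open>H1\<close> gives a weak derivative on the open edge and continuity
  on the closed one. Increments over compact intervals inside \<open>S\<close> pass to the points of
  \<open>D - S\<close> by continuity of \<open>f\<close> and integrability of \<open>g\<close> up to
  the boundary.\<close>

lemma H1_on_closure:
  assumes S: "open S" "is_interval S" and D: "is_interval D" "D \<in> sets borel" "S \<subseteq> D" "finite (D - S)"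
    "\<And>x y. x \<in> D \<Longrightarrow> y \<in> D \<Longrightarrow> {x<..<y} \<subseteq> S"
    and f: "continuous_on D f" and w: "is_weak_deriv S f g"
    and f2: "set_integrable lborel S (\<lambda>x. (f x)\<^sup>2)" and g2: "set_integrable lborel S (\<lambda>x. (g x)\<^sup>2)"
  shows "H1_on D f (\<lambda>x. indicator S x * g x)"
proof -
  define h where "h x = indicator S x * g x" for x
  have hm[measurable]: "h \<in> borel_measurable borel"
    using locally_integrable_borel_measurable[OF S(1)] w unfolding is_weak_deriv_def h_def[abs_def] by auto
  have Df2: "set_integrable lborel D (\<lambda>x. (f x)\<^sup>2)"
  proof -
    have "D - S \<in> null_sets lborel" using D(4) by (simp add: finite_imp_null_set_lborel)
    then have "AE x in lborel. x \<notin> D - S" by (rule AE_not_in)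
    have "(\<lambda>x. indicator D x *\<^sub>R f x) \<in> borel_measurable borel"
      by (rule borel_measurable_continuous_on_indicator[OF D(2) f])
    then have "(\<lambda>x. (indicator D x *\<^sub>R f x)\<^sup>2) \<in> borel_measurable lborel" by simp
    also have "(\<lambda>x. (indicator D x *\<^sub>R f x)\<^sup>2) = (\<lambda>x. indicator D x *\<^sub>R (f x)\<^sup>2)" by (auto simp: indicator_def)
    finally have m: "(\<lambda>x. indicator D x *\<^sub>R (f x)\<^sup>2) \<in> borel_measurable lborel" .
    have m': "(\<lambda>x. indicator S x *\<^sub>R (f x)\<^sup>2) \<in> borel_measurable lborel"
      using f2 unfolding set_integrable_def by (rule borel_measurable_integrable)
    have "AE x in lborel. indicator S x *\<^sub>R (f x)\<^sup>2 = indicator D x *\<^sub>R (f x)\<^sup>2"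
      using \<open>AE x in lborel. x \<notin> D - S\<close> by eventually_elim (use D(3) in \<open>auto simp: indicator_def\<close>)
    from integrable_cong_AE[OF m' m this] show ?thesis using f2 unfolding set_integrable_def by simp
  qed
  have ind: "indicator D x *\<^sub>R (h x)\<^sup>2 = indicator S x *\<^sub>R (g x)\<^sup>2" for x
    using D(3) by (auto simp: h_def indicator_def)
  have Dh2: "set_integrable lborel D (\<lambda>x. (h x)\<^sup>2)"
    using g2 unfolding set_integrable_def ind .
  have "f y - f x = (LINT t:{x..y}|lborel. h t)" if xy: "x \<in> D" "y \<in> D" "x < y" for x y
  proof -
    define d where "d = y - x"
    have d: "d > 0" using xy by (simp add: d_def)
    \<comment> \<open>The summand 3 keeps both margins at most \<open>d / 3\<close>, so that
      \<open>X n < Y n\<close> already for \<open>n = 0\<close>.\<close>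
    define X where "X n = x + d / (real n + 3)" for n :: nat
    define Y where "Y n = y - d / (real n + 3)" for n :: nat
    have XY: "x < X n" "X n < Y n" "Y n < y" for n
    proof -
      have "d / (real n + 3) > 0" "d / (real n + 3) \<le> d / 3" using d by (auto simp: field_simps)
      then show "x < X n" "X n < Y n" "Y n < y" using d d_def unfolding X_def Y_def by linarith+
    qed
    have sub: "{X n..Y n} \<subseteq> S" for n
    proof -
      have "{X n..Y n} \<subseteq> {x<..<y}" using XY[of n] by auto
      then show ?thesis using D(5)[OF xy(1,2)] by blast
    qed
    have i: "set_integrable lborel {x..y} h"
      using Icc_subset_interval[OF D(1) xy(1,2)]
      by (intro set_integrable_of_square[OF set_integrable_subset[OF Dh2] hm]) auto
    have lim0: "(\<lambda>n. d / (real n + 3)) \<longlonglongrightarrow> 0" using tendsto_mult[OF tendsto_const[of d] LIMSEQ_ignore_initial_segment[OF lim_inverse_n, of 3]] by (simp add: divide_inverse add.commute)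
    have X: "X \<longlonglongrightarrow> x" unfolding X_def[abs_def] using tendsto_add[OF tendsto_const[of x] lim0] by simp
    have Y: "Y \<longlonglongrightarrow> y" unfolding Y_def[abs_def] using tendsto_diff[OF tendsto_const[of y] lim0] by simp
    have XYD: "X n \<in> D" "Y n \<in> D" for n using sub[of n] D(3) XY[of n] by (auto simp: subset_eq)
    have "(\<lambda>n. f (Y n) - f (X n)) \<longlonglongrightarrow> f y - f x"
      using XYD by (intro tendsto_diff continuous_on_tendsto_compose[OF f X] continuous_on_tendsto_compose[OF f Y] xy always_eventually allI)
    moreover have "(\<lambda>n. LINT t:{X n..Y n}|lborel. h t) \<longlonglongrightarrow> (LINT t:{x..y}|lborel. h t)"
      unfolding set_lebesgue_integral_def
    proof (rule integral_dominated_convergence[where w="\<lambda>t. \<bar>indicator {x..y} t *\<^sub>R h t\<bar>"])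
      show "integrable lborel (\<lambda>t. \<bar>indicator {x..y} t *\<^sub>R h t\<bar>)"
        using i unfolding set_integrable_def by (rule integrable_abs)
      show "AE t in lborel. norm (indicator {X n..Y n} t *\<^sub>R h t) \<le> \<bar>indicator {x..y} t *\<^sub>R h t\<bar>" for n
        using XY[of n] by (intro AE_I2) (auto simp: indicator_def)
      show "AE t in lborel. (\<lambda>n. indicator {X n..Y n} t *\<^sub>R h t) \<longlonglongrightarrow> indicator {x..y} t *\<^sub>R h t"
        using AE_lborel_singleton[of x] AE_lborel_singleton[of y]
      proof eventually_elim
        case (elim t)
        have "\<forall>\<^sub>F n in sequentially. indicator {X n..Y n} t *\<^sub>R h t = indicator {x..y} t *\<^sub>R h t"
        proof (cases "t \<in> {x..y}")
          case True
          then have "x < t" "t < y" using elim by auto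
          then have "\<forall>\<^sub>F n in sequentially. X n < t" "\<forall>\<^sub>F n in sequentially. t < Y n"
            using order_tendstoD(2)[OF X] order_tendstoD(1)[OF Y] by auto
          then show ?thesis by eventually_elim (use True in \<open>auto simp: indicator_def\<close>)
        next
          case False
          have "indicator {X n..Y n} t *\<^sub>R h t = indicator {x..y} t *\<^sub>R h t" for n
            using False XY[of n] by (auto simp: indicator_def)
          then show ?thesis by simp
        qed
        then show ?case by (rule tendsto_eventually)
      qed
    qed auto
    moreover have "f (Y n) - f (X n) = (LINT t:{X n..Y n}|lborel. h t)" for n
    proof -
      have "f (Y n) - f (X n) = (LINT t:{X n..Y n}|lborel. g t)"
        by (rule weak_deriv_primitive[OF S(1) w continuous_on_subset[OF f D(3)] XY(2) sub])
      also have "\<dots> = (LINT t:{X n..Y n}|lborel. h t)"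
        using sub[of n] by (intro set_lebesgue_integral_cong) (auto simp: h_def)
      finally show ?thesis .
    qed
    ultimately show ?thesis using LIMSEQ_unique by simp
  qed
  moreover have "f x - f x = (LINT t:{x..x}|lborel. h t)" for x
  proof -
    have "(LINT t:{x..x}|lborel. h t) = (LINT t:{}|lborel. h t)"
      by (rule set_integral_discrete_difference[where X="{x}"]) auto
    then show ?thesis by (simp add: set_lebesgue_integral_def)
  qed
  ultimately have "\<forall>x\<in>D. \<forall>y\<in>D. x \<le> y \<longrightarrow> f y - f x = (LINT t:{x..y}|lborel. h t)"
    by (metis order_le_less)
  then have "H1_on D f h" unfolding H1_on_def using D(1,2) hm Df2 Dh2 by blast
  then show ?thesis unfolding h_def[abs_def] .
qed

section \<open>The energy of functions on half-lines\<close>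

abbreviation sq_int :: "real set \<Rightarrow> (real \<Rightarrow> real) \<Rightarrow> real" where
  "sq_int S f \<equiv> (LINT x:S|lborel. (f x)\<^sup>2)"

abbreviation powr_int :: "real \<Rightarrow> real set \<Rightarrow> (real \<Rightarrow> real) \<Rightarrow> real" where
  "powr_int p S f \<equiv> (LINT x:S|lborel. \<bar>f x\<bar> powr p)"

lemma powr_int_nonneg: "0 \<le> powr_int p S f"
  by (auto simp: set_lebesgue_integral_def intro!: integral_nonneg_AE)

lemma H1_on_halfline_bound:
  assumes H: "H1_on {0..} f g" and x: "x \<ge> 0"
  shows "\<bar>f x\<bar> \<le> sqrt (2 * sq_int {0..} f + 2 * sq_int {0..} g)"
  using H1_on_sup_bound_length[OF H, of 1 x x] x by (auto intro!: real_le_rsqrt)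

lemma H1_on_halfline_powr:
  assumes H: "H1_on {0..} f g" and p: "p \<ge> 2" and S: "S \<subseteq> {0..}" "S \<in> sets borel"
  shows "set_integrable lborel S (\<lambda>x. \<bar>f x\<bar> powr p)"
  using H1_on_powr(1)[OF H p, of "sqrt (2 * sq_int {0..} f + 2 * sq_int {0..} g)"]
    H1_on_halfline_bound[OF H] S by (intro set_integrable_subset[of lborel "{0..}" _ S]) auto

text \<open>Isolates the one consequence of minimality that enters the argument. The condition
  \<open>h 0 = 0\<close> makes the extension of \<open>h\<close> by zero continuous on the graph and
  removes its vertex terms.\<close>

definition energy_bound :: "real \<Rightarrow> real \<Rightarrow> real \<Rightarrow> bool" where
  "energy_bound p m E \<longleftrightarrow> (\<forall>h g. H1_on {0..} h g \<and> h 0 = 0 \<and> sq_int {0..} h = m \<longrightarrow>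
     E \<le> sq_int {0..} g / 2 - powr_int p {0..} h / p)"

lemma energy_bound_scaled:
  assumes E: "energy_bound p m E" and m: "m > 0" and H: "H1_on {0..} h g" and h0: "h 0 = 0"
    and M: "sq_int {0..} h > 0"
  shows "E \<le> m / sq_int {0..} h * sq_int {0..} g / 2 - (m / sq_int {0..} h) powr (p / 2) * powr_int p {0..} h / p"
proof -
  define s where "s = sqrt (m / sq_int {0..} h)"
  have t: "m / sq_int {0..} h > 0" using m M by simp
  have s: "s > 0" "s\<^sup>2 = m / sq_int {0..} h" using t by (auto simp: s_def)
  have sp: "\<bar>s\<bar> powr p = (m / sq_int {0..} h) powr (p / 2)"
  proof -
    have "\<bar>s\<bar> powr p = ((m / sq_int {0..} h) powr (1/2)) powr p" using t s(1) by (simp add: s_def powr_half_sqrt)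
    also have "\<dots> = (m / sq_int {0..} h) powr (p / 2)" by (simp only: powr_powr) simp
    finally show ?thesis .
  qed
  have T: "{x. 1 * x + 0 \<in> {0..}} = {0::real..}" by auto
  have one: "(1::real) \<noteq> 0" by simp
  define h' where "h' = (\<lambda>x. s * h (1 * x + 0))"
  define g' where "g' = (\<lambda>x. s * 1 * g (1 * x + 0))"
  note A = H1_on_affine[OF H one h'_def g'_def, unfolded T]
  have "E \<le> sq_int {0..} g' / 2 - powr_int p {0..} h' / p"
    using E A(1) h0 A(2) s(2) M unfolding energy_bound_def by (auto simp: h'_def)
  also have "\<dots> = s\<^sup>2 * sq_int {0..} g / 2 - \<bar>s\<bar> powr p * powr_int p {0..} h / p"
    unfolding A(3) A(4) by simp
  finally show ?thesis unfolding s(2) sp .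
qed

section \<open>Two half-line functions as a competitor on the whole line\<close>

lemma H1_on_split:
  assumes H: "H1_on {0..} f g" and a: "a \<ge> 0"
  shows "sq_int {0..} f = sq_int {0..a} f + sq_int {a..} f" "sq_int {0..} g = sq_int {0..a} g + sq_int {a..} g"
proof -
  have S: "{0..} = {0..a} \<union> {a..}" using a by auto
  have i: "set_integrable lborel {0..a} F" "set_integrable lborel {a..} F" if "set_integrable lborel {0..} F" for F :: "real \<Rightarrow> real"
    using a by (auto intro!: set_integrable_subset[OF that])
  note I1 = i[OF H1_onD(5)[OF H]] and I2 = i[OF H1_onD(6)[OF H]]
  show "sq_int {0..} f = sq_int {0..a} f + sq_int {a..} f"
    unfolding S by (rule set_integral_glue(2)[OF I1, of a]) auto
  show "sq_int {0..} g = sq_int {0..a} g + sq_int {a..} g"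
    unfolding S by (rule set_integral_glue(2)[OF I2, of a]) auto
qed

lemma powr_int_split:
  assumes i: "set_integrable lborel {0..} (\<lambda>x. \<bar>f x\<bar> powr p)" and a: "a \<ge> 0"
  shows "powr_int p {0..} f = powr_int p {0..a} f + powr_int p {a..} f"
proof -
  have S: "{0..} = {0..a} \<union> {a..}" using a by auto
  have I: "set_integrable lborel {0..a} (\<lambda>x. \<bar>f x\<bar> powr p)" "set_integrable lborel {a..} (\<lambda>x. \<bar>f x\<bar> powr p)"
    using a by (auto intro!: set_integrable_subset[OF i])
  show ?thesis unfolding S by (rule set_integral_glue(2)[OF I, of a]) auto
qed

text \<open>
  The competitor rises linearly from 0 to \<open>f2 R\<close> on \<open>[0, 1]\<close>, runs through \<open>f2\<close> backwards from \<open>R\<close>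
  to 0, and continues with \<open>f1\<close>.
\<close>

lemma truncated_join:
  assumes H1: "H1_on {0..} f1 g1" and H2: "H1_on {0..} f2 g2" and eq: "f1 0 = f2 0" and p: "p \<ge> 2" and R: "R \<ge> 0"
  shows "\<exists>h g. H1_on {0..} h g \<and> h 0 = 0 \<and>
     sq_int {0..} h = sq_int {0..} f1 + sq_int {0..R} f2 + (f2 R)\<^sup>2 * sq_int {0..1} (\<lambda>x. x) \<and>
     sq_int {0..} g = sq_int {0..} g1 + sq_int {0..R} g2 + (f2 R)\<^sup>2 \<and>
     powr_int p {0..} f1 + powr_int p {0..R} f2 \<le> powr_int p {0..} h"
proof -
  define s where "s = f2 R"
  define k1 where "k1 = (\<lambda>x::real. 0 + s * x)"
  define l1 where "l1 = (\<lambda>x::real. s)"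
  have A: "H1_on {0..1} k1 l1" unfolding k1_def l1_def by (rule H1_on_linear)
  have A2: "sq_int {0..1} k1 = s\<^sup>2 * sq_int {0..1} (\<lambda>x. x)" by (simp add: k1_def power_mult_distrib)
  have A3: "sq_int {0..1} l1 = s\<^sup>2" by (simp add: l1_def set_integral_Icc_const)
  have A5: "set_integrable lborel {0..1} (\<lambda>x. \<bar>k1 x\<bar> powr p)"
    by (rule H1_on_powr(1)[OF A p, of "\<bar>s\<bar>"]) (auto simp: k1_def abs_mult intro: mult_left_le)
  have m1: "(-1::real) \<noteq> 0" by simp
  have H2R: "H1_on {0..R} f2 g2" by (rule H1_on_subset[OF H2]) (auto simp: is_interval_cc)
  have T: "{x. -1 * x + (R + 1) \<in> {0..R}} = {1..R + 1}" by auto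
  define k2 where "k2 = (\<lambda>x. 1 * f2 (-1 * x + (R + 1)))"
  define l2 where "l2 = (\<lambda>x. 1 * -1 * g2 (-1 * x + (R + 1)))"
  define k3 where "k3 = (\<lambda>x. 1 * f1 (1 * x + - (R + 1)))"
  define l3 where "l3 = (\<lambda>x. 1 * 1 * g1 (1 * x + - (R + 1)))"
  note B' = H1_on_affine[OF H2R m1 k2_def l2_def, unfolded T]
  have "set_integrable lborel {0..R} (\<lambda>x. \<bar>f2 x\<bar> powr p)" by (rule H1_on_halfline_powr[OF H2 p]) auto
  note B5' = B'(5)[OF this]
  have one: "(1::real) \<noteq> 0" by simp
  have U: "{x. 1 * x + (- (R + 1)) \<in> {0..}} = {R + 1..}" by auto
  note C' = H1_on_affine[OF H1 one k3_def l3_def, unfolded U]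
  have "set_integrable lborel {0..} (\<lambda>x. \<bar>f1 x\<bar> powr p)" by (rule H1_on_halfline_powr[OF H1 p]) auto
  note C5' = C'(5)[OF this]
  define k12 where "k12 = (\<lambda>x. if x \<le> 1 then k1 x else k2 x)"
  define l12 where "l12 = (\<lambda>x. if x \<le> 1 then l1 x else l2 x)"
  define k where "k = (\<lambda>x. if x \<le> R + 1 then k12 x else k3 x)"
  define l where "l = (\<lambda>x. if x \<le> R + 1 then l12 x else l3 x)"
  have V: "{0..1} \<union> {1..R + 1} = {0..R + 1}" "{0..R + 1} \<union> {R + 1..} = {0..}" using R by auto
  have e12: "k1 1 = k2 1" by (simp add: k1_def k2_def s_def)
  have in1: "1 \<in> {0..1::real}" "1 \<in> {1..R + 1}" "{0..1} \<subseteq> {..1::real}" "{1..R + 1} \<subseteq> {1::real..}" using R by auto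
  note D = H1_on_glue[OF A B'(1) in1 e12 k12_def l12_def, unfolded V(1)]
  have e23: "k12 (R + 1) = k3 (R + 1)" using R eq by (auto simp: k12_def k1_def k2_def k3_def s_def)
  have in2: "R + 1 \<in> {0..R + 1}" "R + 1 \<in> {R + 1..}" "{0..R + 1} \<subseteq> {..R + 1}" "{R + 1..} \<subseteq> {R + 1..}" using R by auto
  note F = H1_on_glue[OF D(1) C'(1) in2 e23 k_def l_def, unfolded V(2)]
  show ?thesis
  proof (intro exI conjI)
    show "H1_on {0..} k l" by (rule F(1))
    show "k 0 = 0" using R by (simp add: k_def k12_def k1_def)
    show "sq_int {0..} k = sq_int {0..} f1 + sq_int {0..R} f2 + (f2 R)\<^sup>2 * sq_int {0..1} (\<lambda>x. x)"
      unfolding F(2) D(2) A2 B'(2) C'(2) by (simp add: s_def)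
    show "sq_int {0..} l = sq_int {0..} g1 + sq_int {0..R} g2 + (f2 R)\<^sup>2"
      unfolding F(3) D(3) A3 B'(3) C'(3) by (simp add: s_def)
    have "powr_int p {0..} k = powr_int p {0..1} k1 + powr_int p {0..R} f2 + powr_int p {0..} f1"
      unfolding F(4)[OF D(5)[OF A5 B5'] C5'] D(4)[OF A5 B5'] B'(4) C'(4) by simp
    then show "powr_int p {0..} f1 + powr_int p {0..R} f2 \<le> powr_int p {0..} k"
      using powr_int_nonneg[of "{0..1}" k1 p] by linarith
  qed
qed

text \<open>A unit window starting at \<open>R\<close> bounds \<open>(f R)^2\<close> by tails of
  convergent integrals.\<close>

lemma H1_on_tendsto_0:
  assumes H: "H1_on {0..} f g"
  shows "((\<lambda>R. (f R)\<^sup>2) \<longlongrightarrow> 0) at_top"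
proof (rule tendsto_sandwich[where f="\<lambda>_. 0" and h="\<lambda>R. 2 * sq_int {R..} f + 2 * sq_int {R..} g"])
  have lim: "((\<lambda>R. (LINT x:{R..}|lborel. F x)) \<longlongrightarrow> 0) at_top" if F: "set_integrable lborel {0..} F" for F :: "real \<Rightarrow> real"
  proof -
    have "((\<lambda>b. (LINT x:{0..b}|lborel. F x)) \<longlongrightarrow> (LINT x:{0..}|lborel. F x)) at_top"
      by (rule tendsto_set_lebesgue_integral_at_top[OF _ F]) auto
    from tendsto_diff[OF tendsto_const this, of "LINT x:{0..}|lborel. F x"]
    have *: "((\<lambda>b. (LINT x:{0..}|lborel. F x) - (LINT x:{0..b}|lborel. F x)) \<longlongrightarrow> 0) at_top"
      by simp
    have "\<forall>\<^sub>F R in at_top. (LINT x:{0..}|lborel. F x) - (LINT x:{0..R}|lborel. F x) = (LINT x:{R..}|lborel. F x)"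
    proof (rule eventually_mono[OF eventually_ge_at_top[of 0]])
      fix R :: real assume R: "R \<ge> 0"
      have S: "{0..} = {0..R} \<union> {R..}" using R by auto
      have I: "set_integrable lborel {0..R} F" "set_integrable lborel {R..} F"
        using R by (auto intro!: set_integrable_subset[OF F])
      have "(LINT x:{0..}|lborel. F x) = (LINT x:{0..R}|lborel. F x) + (LINT x:{R..}|lborel. F x)"
        unfolding S by (rule set_integral_glue(2)[OF I, of R]) auto
      then show "(LINT x:{0..}|lborel. F x) - (LINT x:{0..R}|lborel. F x) = (LINT x:{R..}|lborel. F x)" by simp
    qed
    from tendsto_cong[OF this] * show ?thesis by simp
  qed
  have "((\<lambda>R. 2 * sq_int {R..} f + 2 * sq_int {R..} g) \<longlongrightarrow> 2 * 0 + 2 * 0) at_top"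
    by (intro tendsto_intros lim H1_onD(5,6)[OF H])
  then show "((\<lambda>R. 2 * sq_int {R..} f + 2 * sq_int {R..} g) \<longlongrightarrow> 0) at_top" by simp
  show "\<forall>\<^sub>F R in at_top. (f R)\<^sup>2 \<le> 2 * sq_int {R..} f + 2 * sq_int {R..} g"
  proof (rule eventually_mono[OF eventually_ge_at_top[of 0]])
    fix R :: real assume R: "R \<ge> 0"
    have H': "H1_on {R..} f g" by (rule H1_on_subset[OF H]) (use R in \<open>auto simp: is_interval_ci\<close>)
    show "(f R)\<^sup>2 \<le> 2 * sq_int {R..} f + 2 * sq_int {R..} g"
      using H1_on_sup_bound_length[OF H', of 1 R R] by auto
  qed
qed auto

text \<open>Two halves of a function on the line become comparable with \<open>E\<close>, although
  \<open>energy_bound\<close> speaks of one half-line and a zero at its origin: in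
  \<open>truncated_join\<close> the ramp costs a multiple of \<open>(f2 R)^2\<close>, which tends to
  0. Only the inequality passes to the limit, not the competitors.\<close>

lemma energy_bound_join:
  assumes E: "energy_bound p m E" and m: "m > 0" and p: "p \<ge> 2"
    and H1: "H1_on {0..} f1 g1" and H2: "H1_on {0..} f2 g2" and eq: "f1 0 = f2 0"
    and M: "sq_int {0..} f1 + sq_int {0..} f2 = M" "M > 0"
  shows "E \<le> m / M * (sq_int {0..} g1 + sq_int {0..} g2) / 2
     - (m / M) powr (p / 2) * (powr_int p {0..} f1 + powr_int p {0..} f2) / p"
proof -
  define c where "c = sq_int {0..1} (\<lambda>x. x)"
  define MR where "MR R = sq_int {0..} f1 + sq_int {0..R} f2 + (f2 R)\<^sup>2 * c" for R
  define KR where "KR R = sq_int {0..} g1 + sq_int {0..R} g2 + (f2 R)\<^sup>2" for R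
  define PR where "PR R = powr_int p {0..} f1 + powr_int p {0..R} f2" for R
  have lim: "((\<lambda>b. (LINT x:{0..b}|lborel. F x)) \<longlongrightarrow> (LINT x:{0..}|lborel. F x)) at_top"
    if F: "set_integrable lborel {0..} F" for F :: "real \<Rightarrow> real"
    by (rule tendsto_set_lebesgue_integral_at_top[OF _ F]) auto
  note f2R = H1_on_tendsto_0[OF H2]
  have "(MR \<longlongrightarrow> sq_int {0..} f1 + sq_int {0..} f2 + 0 * c) at_top"
    unfolding MR_def[abs_def] by (intro tendsto_intros lim H1_onD(5)[OF H2] f2R)
  then have MR: "(MR \<longlongrightarrow> M) at_top" using M by simp
  have "(KR \<longlongrightarrow> sq_int {0..} g1 + sq_int {0..} g2 + 0) at_top"
    unfolding KR_def[abs_def] by (intro tendsto_intros lim H1_onD(6)[OF H2] f2R)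
  then have KR: "(KR \<longlongrightarrow> sq_int {0..} g1 + sq_int {0..} g2) at_top" by simp
  have PR: "(PR \<longlongrightarrow> powr_int p {0..} f1 + powr_int p {0..} f2) at_top"
    unfolding PR_def[abs_def] by (intro tendsto_intros lim H1_on_halfline_powr[OF H2 p]) auto
  have "((\<lambda>R. m / MR R * KR R / 2 - (m / MR R) powr (p / 2) * PR R / p) \<longlongrightarrow>
      m / M * (sq_int {0..} g1 + sq_int {0..} g2) / 2
     - (m / M) powr (p / 2) * (powr_int p {0..} f1 + powr_int p {0..} f2) / p) at_top"
    using M m p by (intro tendsto_intros MR KR PR) auto
  moreover have "\<forall>\<^sub>F R in at_top. E \<le> m / MR R * KR R / 2 - (m / MR R) powr (p / 2) * PR R / p"
    using eventually_ge_at_top[of 0] order_tendstoD(1)[OF MR M(2)]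
  proof eventually_elim
    case (elim R)
    obtain h g where h: "H1_on {0..} h g" "h 0 = 0" "sq_int {0..} h = MR R" "sq_int {0..} g = KR R"
      "PR R \<le> powr_int p {0..} h"
      using truncated_join[OF H1 H2 eq p elim(1)] unfolding MR_def KR_def PR_def c_def by blast
    have "E \<le> m / MR R * KR R / 2 - (m / MR R) powr (p / 2) * powr_int p {0..} h / p"
      using energy_bound_scaled[OF E m h(1,2)] elim(2) unfolding h(3,4) by blast
    also have "\<dots> \<le> m / MR R * KR R / 2 - (m / MR R) powr (p / 2) * PR R / p"
      using h(5) p by (intro diff_left_mono divide_right_mono mult_left_mono) auto
    finally show ?case .
  qed
  ultimately show ?thesis by (intro tendsto_lowerbound) auto
qed

text \<open>Stretching a function by the factor 2 to the right of a zero halves the kinetic energy there,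
  while the mass increases only by \<open>O(r\<^sup>2)\<close> times that kinetic energy.\<close>

lemma stretch:
  assumes H: "H1_on {0..} f g" and p: "p \<ge> 2" and a: "a \<ge> 0" and r: "r > 0"
  shows "\<exists>h k. H1_on {0..} h k \<and> h 0 = f 0 \<and>
    sq_int {0..} h = sq_int {0..} f + sq_int {a..a + r} f \<and>
    sq_int {0..} k = sq_int {0..} g - sq_int {a..a + r} g / 2 \<and>
    powr_int p {0..} f \<le> powr_int p {0..} h"
proof -
  have Ha: "H1_on {0..a} f g" by (rule H1_on_subset[OF H]) (auto simp: is_interval_cc)
  have Hr: "H1_on {a..a + r} f g" by (rule H1_on_subset[OF H]) (use a in \<open>auto simp: is_interval_cc\<close>)
  have Ht: "H1_on {a + r..} f g" by (rule H1_on_subset[OF H]) (use a r in \<open>auto simp: is_interval_ci\<close>)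
  have pa: "set_integrable lborel {0..a} (\<lambda>x. \<bar>f x\<bar> powr p)" by (rule H1_on_halfline_powr[OF H p]) auto
  have pr: "set_integrable lborel {a..a + r} (\<lambda>x. \<bar>f x\<bar> powr p)" by (rule H1_on_halfline_powr[OF H p]) (use a in auto)
  have pt: "set_integrable lborel {a + r..} (\<lambda>x. \<bar>f x\<bar> powr p)" by (rule H1_on_halfline_powr[OF H p]) (use a r in auto)
  have half: "(1 / 2 :: real) \<noteq> 0" and one: "(1::real) \<noteq> 0" by auto
  \<comment> \<open>The map \<open>x \<mapsto> x / 2 + a / 2\<close> fixes \<open>a\<close> and
    sends \<open>[a, a + 2 * r]\<close> onto \<open>[a, a + r]\<close>; the tail is moved to the
    right by \<open>r\<close> to match.\<close>
  have T: "{x. 1 / 2 * x + a / 2 \<in> {a..a + r}} = {a..a + 2 * r}" by auto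
  have U: "{x. 1 * x + - r \<in> {a + r..}} = {a + 2 * r..}" by auto
  define k2 where "k2 = (\<lambda>x. 1 * f (1 / 2 * x + a / 2))"
  define l2 where "l2 = (\<lambda>x. 1 * (1 / 2) * g (1 / 2 * x + a / 2))"
  define k3 where "k3 = (\<lambda>x. 1 * f (1 * x + - r))"
  define l3 where "l3 = (\<lambda>x. 1 * 1 * g (1 * x + - r))"
  note B = H1_on_affine[OF Hr half k2_def l2_def, unfolded T]
  note C = H1_on_affine[OF Ht one k3_def l3_def, unfolded U]
  define k23 where "k23 = (\<lambda>x. if x \<le> a + 2 * r then k2 x else k3 x)"
  define l23 where "l23 = (\<lambda>x. if x \<le> a + 2 * r then l2 x else l3 x)"
  define k where "k = (\<lambda>x. if x \<le> a then f x else k23 x)"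
  define l where "l = (\<lambda>x. if x \<le> a then g x else l23 x)"
  have V: "{a..a + 2 * r} \<union> {a + 2 * r..} = {a..}" "{0..a} \<union> {a..} = {0..}" using a r by auto
  have in1: "a + 2 * r \<in> {a..a + 2 * r}" "a + 2 * r \<in> {a + 2 * r..}" "{a..a + 2 * r} \<subseteq> {..a + 2 * r}" "{a + 2 * r..} \<subseteq> {a + 2 * r..}"
    using r by auto
  have e1: "k2 (a + 2 * r) = k3 (a + 2 * r)" by (simp add: k2_def k3_def add_divide_distrib add.commute)
  note D = H1_on_glue[OF B(1) C(1) in1 e1 k23_def l23_def, unfolded V(1)]
  have in2: "a \<in> {0..a}" "a \<in> {a..}" "{0..a} \<subseteq> {..a}" "{a..} \<subseteq> {a..}" using a by auto
  have e2: "f a = k23 a" using r by (simp add: k23_def k2_def)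
  note F = H1_on_glue[OF Ha D(1) in2 e2 k_def l_def, unfolded V(2)]
  have W: "{a..} = {a..a + r} \<union> {a + r..}" using r by auto
  have sf: "sq_int {0..} f = sq_int {0..a} f + (sq_int {a..a + r} f + sq_int {a + r..} f)"
    unfolding H1_on_split(1)[OF H a] W
    by (subst set_integral_glue(2)[OF H1_onD(5)[OF Hr] H1_onD(5)[OF Ht], of "a + r"]) auto
  have sg: "sq_int {0..} g = sq_int {0..a} g + (sq_int {a..a + r} g + sq_int {a + r..} g)"
    unfolding H1_on_split(2)[OF H a] W
    by (subst set_integral_glue(2)[OF H1_onD(6)[OF Hr] H1_onD(6)[OF Ht], of "a + r"]) auto
  have sp: "powr_int p {0..} f = powr_int p {0..a} f + (powr_int p {a..a + r} f + powr_int p {a + r..} f)"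
  proof -
    have "powr_int p {a..} f = powr_int p {a..a + r} f + powr_int p {a + r..} f"
      unfolding W by (rule set_integral_glue(2)[OF pr pt, of "a + r"]) (use a in auto)
    then show ?thesis using powr_int_split[OF H1_on_halfline_powr[OF H p] a] by auto
  qed
  show ?thesis
  proof (intro exI conjI)
    show "H1_on {0..} k l" by (rule F(1))
    show "k 0 = f 0" using a by (simp add: k_def)
    show "sq_int {0..} k = sq_int {0..} f + sq_int {a..a + r} f"
      unfolding F(2) D(2) B(2) C(2) sf by simp
    show "sq_int {0..} l = sq_int {0..} g - sq_int {a..a + r} g / 2"
      unfolding F(3) D(3) B(3) C(3) sg by simp
    have "powr_int p {0..} k = powr_int p {0..a} f + (2 * powr_int p {a..a + r} f + powr_int p {a + r..} f)"
      unfolding F(4)[OF pa D(5)[OF B(5)[OF pr] C(5)[OF pt]]] D(4)[OF B(5)[OF pr] C(5)[OF pt]] B(4) C(4) by simp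
    then show "powr_int p {0..} f \<le> powr_int p {0..} k"
      unfolding sp using powr_int_nonneg[of "{a..a + r}" f p] by linarith
  qed
qed

section \<open>Minimizers with a zero\<close>

lemma sq_int_poincare:
  assumes H: "H1_on {a..b} f g" and ab: "a \<le> b" and fa: "f a = 0"
  shows "sq_int {a..b} f \<le> (b - a)\<^sup>2 * sq_int {a..b} g"
proof -
  have "(f x)\<^sup>2 \<le> (b - a) * sq_int {a..b} g" if x: "x \<in> {a..b}" for x
  proof -
    have "(f x - f a)\<^sup>2 \<le> \<bar>x - a\<bar> * sq_int {a..b} g"
      using H1_on_holder_abs[OF H _ x, of a] ab by simp
    also have "\<dots> \<le> (b - a) * sq_int {a..b} g"
      using x set_integral_square_nonneg by (intro mult_right_mono) auto
    finally show ?thesis using fa by simp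
  qed
  then have "sq_int {a..b} f \<le> (LINT x:{a..b}|lborel. (b - a) * sq_int {a..b} g)"
    by (intro set_integral_mono H1_onD(5)[OF H] set_integrable_Icc_const)
  also have "\<dots> = (b - a)\<^sup>2 * sq_int {a..b} g" using ab by (simp add: set_integral_Icc_const power2_eq_square)
  finally show ?thesis .
qed

text \<open>At a zero, the Poincare inequality bounds the mass gained by stretching by
  \<open>r^2 * Kr\<close>. Scaling back to mass \<open>m\<close> thus costs
  \<open>O(r^2) * Kr\<close>, against a gain of \<open>Kr / 4\<close> in the energy, and for small
  \<open>r\<close> this forces \<open>Kr = 0\<close>.\<close>

lemma minimizer_vanishes_after_zero:
  assumes E: "energy_bound p m E" and m: "m > 0" and p: "2 < p" "p < 6"
    and H1: "H1_on {0..} f1 g1" and H2: "H1_on {0..} f2 g2" and z: "f1 0 = 0" "f2 0 = 0"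
    and M: "sq_int {0..} f1 + sq_int {0..} f2 = m"
    and P: "P = powr_int p {0..} f1 + powr_int p {0..} f2"
    and le: "(sq_int {0..} g1 + sq_int {0..} g2) / 2 - P / p \<le> E"
    and a: "a \<ge> 0" "f1 a = 0" and r: "r > 0" "r\<^sup>2 * P < m / 6" and x: "x \<in> {a..a + r}"
  shows "f1 x = 0"
proof -
  define Kr where "Kr = sq_int {a..a + r} g1"
  define Mr where "Mr = sq_int {a..a + r} f1"
  define K where "K = sq_int {0..} g1 + sq_int {0..} g2"
  have Hr: "H1_on {a..a + r} f1 g1" by (rule H1_on_subset[OF H1]) (use a in \<open>auto simp: is_interval_cc\<close>)
  have nn: "Kr \<ge> 0" "Mr \<ge> 0" unfolding Kr_def Mr_def by (rule set_integral_square_nonneg)+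
  have MK: "Mr \<le> r\<^sup>2 * Kr" using sq_int_poincare[OF Hr _ a(2)] r by (simp add: Kr_def Mr_def)
  have P0: "P \<ge> 0" unfolding P using powr_int_nonneg by (simp add: add_nonneg_nonneg)
  have p2: "p \<ge> 2" using p by simp
  obtain h k where h: "H1_on {0..} h k" "h 0 = f1 0" "sq_int {0..} h = sq_int {0..} f1 + Mr"
    "sq_int {0..} k = sq_int {0..} g1 - Kr / 2" "powr_int p {0..} f1 \<le> powr_int p {0..} h"
    using stretch[OF H1 p2 a(1) r(1)] unfolding Kr_def Mr_def by blast
  define \<theta> where "\<theta> = m / (m + Mr)"
  have \<theta>: "0 < \<theta>" "\<theta> \<le> 1" using m nn by (auto simp: \<theta>_def)
  have "1 - \<theta> = Mr / (m + Mr)" using m nn by (simp add: \<theta>_def field_simps)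
  also have "\<dots> \<le> Mr / m" using m nn by (intro divide_left_mono) auto
  finally have \<theta>M: "1 - \<theta> \<le> Mr / m" .
  have "E \<le> m / (m + Mr) * (sq_int {0..} k + sq_int {0..} g2) / 2
     - (m / (m + Mr)) powr (p / 2) * (powr_int p {0..} h + powr_int p {0..} f2) / p"
    by (rule energy_bound_join[OF E m p2 h(1) H2]) (use h z M m nn in auto)
  then have "E \<le> \<theta> * (K - Kr / 2) / 2 - \<theta> powr (p / 2) * (powr_int p {0..} h + powr_int p {0..} f2) / p"
    unfolding \<theta>_def[symmetric] h(4) K_def by (simp add: algebra_simps)
  also have "\<dots> \<le> \<theta> * (K - Kr / 2) / 2 - \<theta> powr (p / 2) * P / p"
    using h(5) p unfolding P by (intro diff_left_mono divide_right_mono mult_left_mono) auto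
  \<comment> \<open>The 3 comes from \<open>p / 2 < 3\<close>: as \<open>\<theta> \<le> 1\<close>,
    the power \<open>\<theta> powr (p / 2)\<close> is at least \<open>\<theta>^3\<close>, and
    Bernoulli's inequality linearizes the cube.\<close>
  also have "\<dots> \<le> (K - Kr / 2) / 2 - (1 - 3 * (1 - \<theta>)) * P / p"
  proof -
    have "Kr / 2 \<le> K"
    proof -
      have "Kr \<le> sq_int {0..} g1" unfolding Kr_def
        using H1_onD(6)[OF H1] a by (intro set_integral_nonneg_subset) auto
      then show ?thesis unfolding K_def using set_integral_square_nonneg[of "{0..}" g2] nn by linarith
    qed
    then have 1: "\<theta> * (K - Kr / 2) \<le> K - Kr / 2" using \<theta> by (intro mult_left_le_one_le) auto
    have "1 - 3 * (1 - \<theta>) \<le> \<theta> ^ 3"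
    proof -
      have "\<theta> ^ 3 - (1 - 3 * (1 - \<theta>)) = (1 - \<theta>)\<^sup>2 * (\<theta> + 2)" by (simp add: power2_eq_square power3_eq_cube algebra_simps)
      moreover have "\<dots> \<ge> 0" using \<theta> by auto
      ultimately show ?thesis by linarith
    qed
    also have "\<theta> ^ 3 = \<theta> powr 3" using \<theta> by simp
    also have "\<theta> powr 3 \<le> \<theta> powr (p / 2)" using \<theta> p by (intro powr_mono') auto
    finally have "(1 - 3 * (1 - \<theta>)) * P / p \<le> \<theta> powr (p / 2) * P / p"
      using P0 p by (intro divide_right_mono mult_right_mono) auto
    then show ?thesis using 1 by (intro diff_mono) (auto simp: divide_right_mono)
  qed
  also have "\<dots> = K / 2 - Kr / 4 - P / p + 3 * (1 - \<theta>) * P / p"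
    by (simp add: left_diff_distrib diff_divide_distrib)
  finally have "E \<le> K / 2 - Kr / 4 - P / p + 3 * (1 - \<theta>) * P / p" .
  with le have "Kr / 4 \<le> 3 * (1 - \<theta>) * P / p" unfolding K_def by linarith
  also have "\<dots> \<le> 3 * (1 - \<theta>) * P / 2" using p P0 \<theta> by (intro divide_left_mono) auto
  also have "\<dots> \<le> 3 * (r\<^sup>2 * Kr / m) * P / 2"
  proof -
    have "Mr / m \<le> r\<^sup>2 * Kr / m" using MK m by (intro divide_right_mono) auto
    then have "1 - \<theta> \<le> r\<^sup>2 * Kr / m" using \<theta>M by linarith
    then show ?thesis using P0 by (intro divide_right_mono mult_right_mono mult_left_mono) auto
  qed
  also have "\<dots> = Kr * (3 / 2 * (r\<^sup>2 * P) / m)" by (simp add: mult_ac)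
  finally have *: "Kr * (1 / 4 - 3 / 2 * (r\<^sup>2 * P) / m) \<le> 0" by (simp add: algebra_simps)
  \<comment> \<open>The bound \<open>m / 6\<close> on \<open>r^2 * P\<close> is made for this
    inequality, since \<open>3/2 * 1/6 = 1/4\<close>.\<close>
  have "3 / 2 * (r\<^sup>2 * P) / m < 1 / 4" using r(2) m by (simp add: field_simps)
  then have "Kr = 0" using * nn by (simp add: mult_le_0_iff)
  moreover have "(f1 x - f1 a)\<^sup>2 \<le> \<bar>x - a\<bar> * Kr"
    using H1_on_holder_abs[OF Hr _ x, of a] r by (simp add: Kr_def)
  ultimately show ?thesis using a by simp
qed

text \<open>The step length \<open>r\<close> depends only on \<open>m\<close> and the total power
  integral, so the zero set grows by a fixed length each time and exhausts the half-line.\<close>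

lemma minimizer_zero:
  assumes E: "energy_bound p m E" and m: "m > 0" and p: "2 < p" "p < 6"
    and H1: "H1_on {0..} f1 g1" and H2: "H1_on {0..} f2 g2" and z: "f1 0 = 0" "f2 0 = 0"
    and M: "sq_int {0..} f1 + sq_int {0..} f2 = m"
    and le: "(sq_int {0..} g1 + sq_int {0..} g2) / 2 - (powr_int p {0..} f1 + powr_int p {0..} f2) / p \<le> E"
  shows "sq_int {0..} f1 = 0"
proof -
  define P where "P = powr_int p {0..} f1 + powr_int p {0..} f2"
  have P0: "P \<ge> 0" unfolding P_def using powr_int_nonneg by (simp add: add_nonneg_nonneg)
  \<comment> \<open>\<open>P + 1\<close> keeps the denominator positive and makes the bound on
    \<open>r^2 * P\<close> strict.\<close>
  define r where "r = sqrt (m / (6 * (P + 1)))"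
  have r: "r > 0" "r\<^sup>2 * P < m / 6" using m P0 by (auto simp: r_def field_simps)
  have step: "f1 x = 0" if "a \<ge> 0" "f1 a = 0" "x \<in> {a..a + r}" for a x
    by (rule minimizer_vanishes_after_zero[OF E m p H1 H2 z M P_def _ that(1,2) r that(3)]) (use le in \<open>simp add: P_def\<close>)
  have k: "f1 (real k * r) = 0" for k
  proof (induction k)
    case (Suc k)
    show ?case by (rule step[OF _ Suc]) (use r in \<open>auto simp: algebra_simps\<close>)
  qed (use z in simp)
  have "f1 x = 0" if x: "x \<ge> 0" for x
  proof -
    define k where "k = nat \<lfloor>x / r\<rfloor>"
    have "real k \<le> x / r" "x / r < real k + 1"
      using x r unfolding k_def by (auto simp: of_nat_nat)
    then have "real k * r \<le> x" "x \<le> real k * r + r" using r by (auto simp: field_simps)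
    then show ?thesis using r by (intro step[OF _ k[of k]]) auto
  qed
  then have "sq_int {0..} f1 = (LINT x:{0::real..}|lborel. 0)" by (intro set_lebesgue_integral_cong) auto
  then show ?thesis by simp
qed

text \<open>When the mass of a fixed profile is multiplied by \<open>t\<close>, its power term grows
  like \<open>t powr (p / 2)\<close> and its kinetic term like \<open>t\<close>, so the energy is
  negative for large \<open>t\<close>.\<close>

lemma negative_energy_bound:
  assumes p: "p > 2"
  obtains m \<kappa> where "m > 0" "\<kappa> > 0" "\<And>E. energy_bound p m E \<Longrightarrow> E \<le> - \<kappa>"
proof -
  \<comment> \<open>Half of a hat function. \<open>energy_bound_join\<close> pairs it with its
    mirror image, so the value 1 at the origin is harmless.\<close>
  define f where "f = (\<lambda>x::real. if x \<le> 1 then 1 + -1 * x else 0)"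
  define g where "g = (\<lambda>x::real. if x \<le> 1 then -1 else 0 :: real)"
  have V: "{0..1} \<union> {1..} = {0::real..}" by auto
  have Hl: "H1_on {0..1} (\<lambda>x. 1 + -1 * x) (\<lambda>_. -1)" by (rule H1_on_linear)
  have Hz: "H1_on {1..} (\<lambda>_. 0) (\<lambda>_. 0)" by (rule H1_on_zero) (auto simp: is_interval_ci)
  have H: "H1_on {0..} f g"
    using H1_on_glue(1)[OF Hl Hz, of 1, OF _ _ _ _ _ f_def g_def] unfolding V by auto
  have p2: "p \<ge> 2" using p by simp
  define M where "M = sq_int {0..} f + sq_int {0..} f"
  define K where "K = sq_int {0..} g + sq_int {0..} g"
  define P where "P = powr_int p {0..} f + powr_int p {0..} f"
  have "(1 / 2) powr p / 2 = (LINT x:{0..1/2::real}|lborel. (1 / 2) powr p)"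
    by (simp add: set_integral_Icc_const)
  also have "\<dots> \<le> powr_int p {0..1/2} f"
    using p by (intro set_integral_mono set_integrable_Icc_const H1_on_halfline_powr[OF H p2])
      (auto simp: f_def intro!: powr_mono2)
  also have "\<dots> \<le> powr_int p {0..} f"
    by (intro set_integral_nonneg_subset H1_on_halfline_powr[OF H p2]) auto
  finally have "powr_int p {0..} f \<ge> (1 / 2) powr p / 2" .
  then have P0: "powr_int p {0..} f > 0" by (rule less_le_trans[rotated]) simp
  have "powr_int p {0..} f \<le> 1 powr (p - 2) * sq_int {0..} f"
    by (rule H1_on_powr(2)[OF H p2]) (auto simp: f_def)
  then have M: "M > 0" using P0 by (simp add: M_def)
  have P: "P > 0" using P0 by (simp add: P_def)
  have K: "K \<ge> 0" unfolding K_def using set_integral_square_nonneg by (simp add: add_nonneg_nonneg)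
  \<comment> \<open>Chosen so that \<open>t powr (p / 2) * P / p = t * (K / 2 + 1)\<close>. The
    energy is then \<open>- t\<close>, and \<open>t\<close> serves as
    \<open>\<kappa>\<close>.\<close>
  define c where "c = p / P * (K / 2 + 1)"
  have c: "c > 0" using p P K by (simp add: c_def add_nonneg_pos)
  define t where "t = c powr (1 / (p / 2 - 1))"
  have t: "t > 0" using c by (simp add: t_def)
  have "t powr (p / 2 - 1) = c" unfolding t_def powr_powr using p c by (simp add: powr_one)
  then have tp: "t powr (p / 2) = c * t" using powr_add[of t "p / 2 - 1" 1] t by simp
  show ?thesis
  proof (rule that)
    show "t * M > 0" "t > 0" using t M by auto
    fix E assume E: "energy_bound p (t * M) E"
    have tM: "t * M / M = t" using M by simp
    have "E \<le> t * K / 2 - t powr (p / 2) * P / p"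
      using energy_bound_join[OF E _ p2 H H refl M_def[symmetric]] M t unfolding tM K_def P_def by auto
    also have "\<dots> = t * K / 2 - t * (K / 2 + 1)" unfolding tp c_def using p P by (simp add: field_simps)
    also have "\<dots> = - t" by (simp add: algebra_simps)
    finally show "E \<le> - t" .
  qed
qed

section \<open>Estimates on the compact core\<close>

text \<open>
  The hypothesis on \<open>K\<close> is what nonpositive energy gives for the total kinetic energy; it bounds \<open>K\<close>
  because \<open>(p - 2)/4\<close> and \<open>q/4\<close> are smaller than 1.
\<close>

lemma kinetic_bound:
  fixes p q m :: real
  assumes p: "2 < p" "p < 6" and q: "2 < q" "q < 4" and m: "m > 0"
  obtains Ks where "Ks > 0" "\<And>K. K \<ge> 0 \<Longrightarrow>
    K / 2 \<le> m / p * ((4 * m + 6) * sqrt K) powr ((p - 2) / 2) + 2 / q * ((4 * m + 6) * sqrt K) powr (q / 2) \<Longrightarrow> K \<le> Ks"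
proof -
  \<comment> \<open>With \<open>X = D * sqrt K\<close>, the left-hand side is a multiple of
    \<open>X^2\<close>. For \<open>K > 1\<close> also \<open>X \<ge> 1\<close>, so both powers on
    the right are at most \<open>X powr \<theta>\<close> with \<open>\<theta> < 2\<close>.\<close>
  define D where "D = 4 * m + 6"
  define \<theta> where "\<theta> = max ((p - 2) / 2) (q / 2)"
  define C where "C = 2 * D\<^sup>2 * (m / p + 2 / q)"
  define Y where "Y = C powr (1 / (2 - \<theta>))"
  have \<theta>: "\<theta> < 2" using p q by (auto simp: \<theta>_def)
  have D: "D \<ge> 1" using m by (simp add: D_def)
  have C: "C > 0" using D m p q by (auto simp: C_def intro!: mult_pos_pos add_pos_pos)
  show ?thesis
  proof (rule that[of "1 + Y\<^sup>2"])
    show "1 + Y\<^sup>2 > 0" by (simp add: add_pos_nonneg)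
    fix K :: real
    assume K: "K \<ge> 0" and le: "K / 2 \<le> m / p * ((4 * m + 6) * sqrt K) powr ((p - 2) / 2) + 2 / q * ((4 * m + 6) * sqrt K) powr (q / 2)"
    define X where "X = D * sqrt K"
    show "K \<le> 1 + Y\<^sup>2"
    proof (cases "K \<le> 1")
      case True
      then show ?thesis by (simp add: add_increasing2)
    next
      case False
      then have sK: "sqrt K \<ge> 1" by simp
      then have X: "X \<ge> 1" using D mult_mono[of 1 D 1 "sqrt K"] by (simp add: X_def)
      have XK: "X\<^sup>2 = D\<^sup>2 * K" using K by (simp add: X_def power_mult_distrib)
      have "K / 2 \<le> m / p * X powr ((p - 2) / 2) + 2 / q * X powr (q / 2)" using le by (simp add: X_def D_def)
      also have "\<dots> \<le> m / p * X powr \<theta> + 2 / q * X powr \<theta>"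
        using X m p q by (intro add_mono mult_left_mono powr_mono) (auto simp: \<theta>_def)
      finally have "K \<le> 2 * (m / p + 2 / q) * X powr \<theta>" by (simp add: algebra_simps)
      then have "D\<^sup>2 * K \<le> D\<^sup>2 * (2 * (m / p + 2 / q) * X powr \<theta>)" by (intro mult_left_mono) auto
      also have "\<dots> = C * X powr \<theta>" by (simp add: C_def)
      finally have "D\<^sup>2 * K \<le> C * X powr \<theta>" .
      then have "X powr 2 \<le> C * X powr \<theta>" using XK X by simp
      moreover have "X powr 2 = X powr (2 - \<theta>) * X powr \<theta>" by (simp add: powr_add[symmetric])
      ultimately have "X powr (2 - \<theta>) \<le> C" using X by simp
      then have "(X powr (2 - \<theta>)) powr (1 / (2 - \<theta>)) \<le> Y"
        unfolding Y_def using \<theta> by (intro powr_mono2) auto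
      then have XY: "X \<le> Y" using \<theta> X by (simp add: powr_powr)
      have "K \<le> D\<^sup>2 * K" using D K by (simp add: mult_right_mono[of 1 "D\<^sup>2" K, simplified])
      also have "\<dots> \<le> Y\<^sup>2" unfolding XK[symmetric] using X XY by (intro power_mono) auto
      finally show ?thesis by simp
    qed
  qed
qed

text \<open>\<open>6 * (m + Ks) / real n\<close> bounds the square of the ground state on the core.
  In \<open>core_energy\<close> the first inequality controls the coefficient of the core mass, the
  second that of the core kinetic energy.\<close>

lemma eventually_core_small:
  fixes p q m Ks \<epsilon> :: real
  assumes p: "2 < p" and q: "2 < q" and m: "m + Ks > 0" and \<epsilon>: "\<epsilon> > 0"
  shows "\<forall>\<^sub>F n in sequentially.
    (6 * (m + Ks) / real n) powr ((p - 2) / 2) / p + 12 / (real n * q) * (6 * (m + Ks) / real n) powr ((q - 2) / 2) \<le> \<epsilon> \<and>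
    12 / (real n * q) * (6 * (m + Ks) / real n) powr ((q - 2) / 2) \<le> 1 / 2"
proof -
  define \<eta> where "\<eta> n = 6 * (m + Ks) / real n" for n :: nat
  have \<eta>: "\<eta> \<longlonglongrightarrow> 0" unfolding \<eta>_def[abs_def] by (rule lim_const_over_n)
  have pw: "(\<lambda>n. \<eta> n powr a) \<longlonglongrightarrow> 0" if "a > 0" for a
  proof -
    have "(\<lambda>n. \<eta> n powr a) \<longlonglongrightarrow> 0 powr a"
      by (rule tendsto_powr'[OF \<eta> tendsto_const]) (use that m in \<open>auto simp: \<eta>_def intro!: always_eventually\<close>)
    then show ?thesis by simp
  qed
  have n0: "(\<lambda>n. 12 / (real n * q)) \<longlonglongrightarrow> 0"
    using tendsto_mult[OF lim_const_over_n[of "12 / q"] tendsto_const[of 1]] by (simp add: field_simps)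
  have b: "(\<lambda>n. 12 / (real n * q) * \<eta> n powr ((q - 2) / 2)) \<longlonglongrightarrow> 0"
    using tendsto_mult[OF n0 pw[of "(q - 2) / 2"]] q by simp
  have a: "(\<lambda>n. \<eta> n powr ((p - 2) / 2) / p) \<longlonglongrightarrow> 0"
    using tendsto_divide[OF pw[of "(p - 2) / 2"] tendsto_const[of p]] p by simp
  have ab: "(\<lambda>n. \<eta> n powr ((p - 2) / 2) / p + 12 / (real n * q) * \<eta> n powr ((q - 2) / 2)) \<longlonglongrightarrow> 0"
    using tendsto_add[OF a b] by simp
  have "\<forall>\<^sub>F n in sequentially. \<eta> n powr ((p - 2) / 2) / p + 12 / (real n * q) * \<eta> n powr ((q - 2) / 2) < \<epsilon>"
    using order_tendstoD(2)[OF ab \<epsilon>] .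
  moreover have "\<forall>\<^sub>F n in sequentially. 12 / (real n * q) * \<eta> n powr ((q - 2) / 2) < 1 / 2"
    using order_tendstoD(2)[OF b, of "1 / 2"] by simp
  ultimately show ?thesis unfolding \<eta>_def by eventually_elim auto
qed

section \<open>Pointwise bounds along an edge\<close>

lemma square_bound_from_end:
  assumes H: "H1_on {0..l} f g" and x: "x \<in> {0..l}"
  shows "(f x)\<^sup>2 \<le> 2 * (f 0)\<^sup>2 + 2 * l * sq_int {0..l} g"
proof -
  have "(f x - f 0)\<^sup>2 \<le> \<bar>x - 0\<bar> * sq_int {0..l} g" using H1_on_holder_abs[OF H _ x, of 0] x by simp
  also have "\<dots> \<le> l * sq_int {0..l} g" using x set_integral_square_nonneg by (intro mult_right_mono) auto
  finally have "(f x - f 0)\<^sup>2 \<le> l * sq_int {0..l} g" .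
  moreover have "(f x)\<^sup>2 \<le> 2 * (f 0)\<^sup>2 + 2 * (f x - f 0)\<^sup>2"
    using zero_le_power2[of "f x - 2 * f 0"] by (simp add: power2_eq_square algebra_simps)
  ultimately show ?thesis by linarith
qed

text \<open>The bound must not depend on the edge length \<open>l\<close>, which shrinks with
  \<open>n\<close>. A window longer than the edge is placed on the half-line instead, and the value
  at the common vertex is carried along the edge.\<close>

lemma edge_sup_bound:
  assumes H0: "H1_on {0..} f0 g0" and H: "H1_on {0..l} f g" and eq: "f 0 = f0 0"
    and l: "l > 0" and d: "d > 0" and x: "x \<in> {0..l}"
    and m: "sq_int {0..} f0 \<le> m" "sq_int {0..l} f \<le> m" and K: "sq_int {0..} g0 \<le> K" "sq_int {0..l} g \<le> K"
  shows "(f x)\<^sup>2 \<le> 4 * m / d + 6 * d * K"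
proof -
  have nn: "m \<ge> 0" "K \<ge> 0"
    using m(2) K(2) set_integral_square_nonneg[of "{0..l}" f] set_integral_square_nonneg[of "{0..l}" g] by linarith+
  show ?thesis
  proof (cases "d \<le> l")
    case True
    \<comment> \<open>A window of length \<open>d\<close> inside \<open>[0, l]\<close> that contains
      \<open>x\<close>, moved left when \<open>x\<close> is close to the end.\<close>
    define a where "a = min x (l - d)"
    have "(f x)\<^sup>2 \<le> 2 / d * sq_int {0..l} f + 2 * d * sq_int {0..l} g"
      by (rule H1_on_sup_bound_length[OF H d, of a]) (use x True d in \<open>auto simp: a_def min_def\<close>)
    also have "\<dots> \<le> 2 / d * m + 2 * d * K" using m K d by (intro add_mono mult_left_mono) auto
    also have "\<dots> \<le> 4 * m / d + 6 * d * K" using nn d by (intro add_mono mult_right_mono) (auto simp: divide_right_mono)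
    finally show ?thesis .
  next
    case False
    have "(f0 0)\<^sup>2 \<le> 2 / d * sq_int {0..} f0 + 2 * d * sq_int {0..} g0"
      by (rule H1_on_sup_bound_length[OF H0 d, of 0]) (use d in auto)
    also have "\<dots> \<le> 2 / d * m + 2 * d * K" using m K d by (intro add_mono mult_left_mono) auto
    finally have c: "(f 0)\<^sup>2 \<le> 2 / d * m + 2 * d * K" using eq by simp
    have "(f x)\<^sup>2 \<le> 2 * (f 0)\<^sup>2 + 2 * l * sq_int {0..l} g" by (rule square_bound_from_end[OF H x])
    also have "\<dots> \<le> 2 * (2 / d * m + 2 * d * K) + 2 * d * K"
      using c False l K nn set_integral_square_nonneg[of "{0..l}" g] by (intro add_mono mult_mono) auto
    also have "\<dots> = 4 * m / d + 6 * d * K" by (simp add: algebra_simps)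
    finally show ?thesis .
  qed
qed

lemma abs_powr_le_square:
  fixes y :: real
  assumes p: "p \<ge> 2" and y: "y\<^sup>2 \<le> B"
  shows "\<bar>y\<bar> powr p \<le> B powr ((p - 2) / 2) * y\<^sup>2" "\<bar>y\<bar> powr p \<le> B powr (p / 2)"
proof -
  have B: "B \<ge> 0" using y zero_le_power2[of y] by linarith
  have yB: "\<bar>y\<bar> \<le> sqrt B" using y by (simp add: real_le_rsqrt)
  have s: "sqrt B powr a = B powr (a / 2)" for a
    using B by (simp add: powr_half_sqrt[symmetric] powr_powr)
  show "\<bar>y\<bar> powr p \<le> B powr ((p - 2) / 2) * y\<^sup>2" using abs_powr_le[OF p yB] unfolding s .
  show "\<bar>y\<bar> powr p \<le> B powr (p / 2)" using powr_mono2[OF _ _ yB, of p] p unfolding s by simp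
qed

lemma powr_int_le_square:
  assumes H: "H1_on S f g" and p: "p \<ge> 2" and B: "\<And>x. x \<in> S \<Longrightarrow> (f x)\<^sup>2 \<le> B"
  shows "powr_int p S f \<le> B powr ((p - 2) / 2) * sq_int S f"
proof (cases "S = {}")
  case False
  then have B0: "B \<ge> 0" using B zero_le_power2 order_trans by blast
  have "powr_int p S f \<le> sqrt B powr (p - 2) * sq_int S f"
    by (rule H1_on_powr(2)[OF H p]) (use B in \<open>auto intro: real_le_rsqrt\<close>)
  also have "sqrt B powr (p - 2) = B powr ((p - 2) / 2)"
    using B0 by (simp add: powr_half_sqrt[symmetric] powr_powr)
  finally show ?thesis .
qed (simp add: set_lebesgue_integral_def)

text \<open>A hypothetical ground state seen edge by edge: indices 0 and 1 are the half-lines,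
  \<open>A\<close> holds the bounded edges, \<open>c\<close> is the value at the common origin, and
  \<open>d\<close> the value at the second vertex, where \<open>e0\<close> ends. \<open>K\<close>
  and \<open>P\<close> are the total kinetic and power integrals.\<close>

locale core_functions =
  fixes p q m \<kappa> E :: real and n :: nat and A :: "nat set" and f g :: "nat \<Rightarrow> real \<Rightarrow> real" and c d K P Ks :: real and e0 :: nat
  assumes p: "2 < p" "p < 6" and q: "2 < q" "q < 4" and m: "m > 0" and \<kappa>: "\<kappa> > 0"
    and bound: "energy_bound p m E" and E: "E \<le> - \<kappa>" and n: "n \<ge> 1"
    and H0: "H1_on {0..} (f 0) (g 0)" and H1: "H1_on {0..} (f 1) (g 1)"
    and A: "finite A" "card A = n\<^sup>2" "e0 \<in> A"
    and HA: "\<And>e. e \<in> A \<Longrightarrow> H1_on {0..1 / real n} (f e) (g e)"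
    and c: "f 0 0 = c" "f 1 0 = c" "\<And>e. e \<in> A \<Longrightarrow> f e 0 = c" and d: "f e0 (1 / real n) = d"
    and mass: "sq_int {0..} (f 0) + sq_int {0..} (f 1) + (\<Sum>e\<in>A. sq_int {0..1 / real n} (f e)) = m"
    and K: "K = sq_int {0..} (g 0) + sq_int {0..} (g 1) + (\<Sum>e\<in>A. sq_int {0..1 / real n} (g e))"
    and P: "P = powr_int p {0..} (f 0) + powr_int p {0..} (f 1) + (\<Sum>e\<in>A. powr_int p {0..1 / real n} (f e))"
    and energy: "E = K / 2 - P / p - (\<bar>c\<bar> powr q + \<bar>d\<bar> powr q) / q"
    and Ks: "Ks > 0" "\<And>K. K \<ge> 0 \<Longrightarrow>
      K / 2 \<le> m / p * ((4 * m + 6) * sqrt K) powr ((p - 2) / 2) + 2 / q * ((4 * m + 6) * sqrt K) powr (q / 2) \<Longrightarrow> K \<le> Ks"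
    and small: "(6 * (m + Ks) / real n) powr ((p - 2) / 2) / p + 12 / (real n * q) * (6 * (m + Ks) / real n) powr ((q - 2) / 2) \<le> \<kappa> / (2 * m)"
      "12 / (real n * q) * (6 * (m + Ks) / real n) powr ((q - 2) / 2) \<le> 1 / 2"
begin

definition l where "l = 1 / real n"
definition mc where "mc = (\<Sum>e\<in>A. sq_int {0..l} (f e))"
definition Kc where "Kc = (\<Sum>e\<in>A. sq_int {0..l} (g e))"
definition Pc where "Pc = (\<Sum>e\<in>A. powr_int p {0..l} (f e))"

lemma l: "l > 0" "l \<le> 1" using n by (auto simp: l_def)

lemma HA': "e \<in> A \<Longrightarrow> H1_on {0..l} (f e) (g e)" using HA by (simp add: l_def)

lemma nonneg: "mc \<ge> 0" "Kc \<ge> 0" "Pc \<ge> 0" "0 \<le> sq_int S h" "0 \<le> K"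
  using set_integral_square_nonneg powr_int_nonneg
  by (auto simp: mc_def Kc_def Pc_def K intro!: sum_nonneg add_nonneg_nonneg)

lemma edge_le:
  assumes "e \<in> A"
  shows "sq_int {0..l} (f e) \<le> mc" "sq_int {0..l} (g e) \<le> Kc"
  unfolding mc_def Kc_def
  by (rule member_le_sum[OF assms _ A(1)]; rule set_integral_square_nonneg)+

lemma totals: "mc \<le> m" "Kc \<le> K"
  "sq_int {0..} (f 0) \<le> m" "sq_int {0..} (f 1) \<le> m" "sq_int {0..} (g 0) \<le> K" "sq_int {0..} (g 1) \<le> K"
  using mass K nonneg nonneg(4)[of "{0..}" "f 0"] nonneg(4)[of "{0..}" "f 1"]
    nonneg(4)[of "{0..}" "g 0"] nonneg(4)[of "{0..}" "g 1"]
  unfolding mc_def Kc_def l_def by linarith+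

text \<open>Negative energy bounds \<open>K / 2\<close> by the nonlinear terms. These are controlled
  by the estimate of the squared function by \<open>(4 * m + 6) * sqrt K\<close>, whose constant
  does not depend on \<open>n\<close>.\<close>

lemma K_le: "K \<le> Ks"
proof (rule Ks(2)[OF nonneg(5)])
  define X where "X = (4 * m + 6) * sqrt K"
  have sup: "y \<le> X" if y: "\<And>\<delta>. \<delta> > 0 \<Longrightarrow> y \<le> 4 * m / \<delta> + 6 * \<delta> * K" for y
  proof (cases "K = 0")
    case True
    have "y \<le> 0"
    proof (rule ccontr)
      assume "\<not> y \<le> 0"
      \<comment> \<open>This window length turns the assumption into
        \<open>y \<le> y / 2\<close>.\<close>
      then show False using y[of "8 * m / y"] m True by (simp add: field_simps)
    qed
    then show ?thesis by (simp add: X_def True)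
  next
    case False
    then have K0: "sqrt K > 0" using nonneg(5) by simp
    \<comment> \<open>The window length \<open>1 / sqrt K\<close> makes both terms multiples of
      \<open>sqrt K\<close>.\<close>
    have "y \<le> 4 * m / (1 / sqrt K) + 6 * (1 / sqrt K) * K" using K0 by (intro y) simp
    also have "6 * (1 / sqrt K) * K = 6 * sqrt K"
      using nonneg(5) K0 by (simp add: field_simps)
    finally show ?thesis by (simp add: X_def algebra_simps)
  qed
  have half: "(h x)\<^sup>2 \<le> X" if H: "H1_on {0..} h k" "sq_int {0..} h \<le> m" "sq_int {0..} k \<le> K" "x \<in> {0..}" for h k x
  proof (rule sup)
    fix \<delta> :: real assume \<delta>: "\<delta> > 0"
    have "(h x)\<^sup>2 \<le> 2 / \<delta> * sq_int {0..} h + 2 * \<delta> * sq_int {0..} k"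
      by (rule H1_on_sup_bound_length[OF H(1) \<delta>, of x]) (use \<delta> H in auto)
    also have "\<dots> \<le> 2 / \<delta> * m + 2 * \<delta> * K" using H \<delta> by (intro add_mono mult_left_mono) auto
    also have "\<dots> \<le> 4 * m / \<delta> + 6 * \<delta> * K" using m nonneg(5) \<delta> by (intro add_mono mult_right_mono) (auto simp: divide_right_mono)
    finally show "(h x)\<^sup>2 \<le> 4 * m / \<delta> + 6 * \<delta> * K" .
  qed
  have core: "(f e x)\<^sup>2 \<le> X" if "e \<in> A" "x \<in> {0..l}" for e x
    using edge_sup_bound[OF H0 HA'[OF that(1)] _ l(1) _ that(2), of _ m K]
      c that totals edge_le[OF that(1)] by (intro sup) auto
  have p2: "p \<ge> 2" "q \<ge> 2" using p q by auto
  have "P \<le> X powr ((p - 2) / 2) * sq_int {0..} (f 0) + X powr ((p - 2) / 2) * sq_int {0..} (f 1)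
     + (\<Sum>e\<in>A. X powr ((p - 2) / 2) * sq_int {0..l} (f e))"
    unfolding P l_def[symmetric]
    by (intro add_mono sum_mono powr_int_le_square[OF H0 p2(1)] powr_int_le_square[OF H1 p2(1)] powr_int_le_square[OF HA' p2(1)]
        half[OF H0] half[OF H1] totals core)
  also have "\<dots> = X powr ((p - 2) / 2) * m"
    unfolding mass[symmetric] l_def by (simp add: sum_distrib_left algebra_simps)
  finally have P': "P \<le> X powr ((p - 2) / 2) * m" .
  have "c\<^sup>2 \<le> X" using core[OF A(3), of 0] l c A by simp
  then have c': "\<bar>c\<bar> powr q \<le> X powr (q / 2)" by (rule abs_powr_le_square(2)[OF p2(2)])
  have "d\<^sup>2 \<le> X" using core[OF A(3), of l] l d by (simp add: l_def)
  then have d': "\<bar>d\<bar> powr q \<le> X powr (q / 2)" by (rule abs_powr_le_square(2)[OF p2(2)])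
  have "K / 2 \<le> P / p + (\<bar>c\<bar> powr q + \<bar>d\<bar> powr q) / q" using energy E \<kappa> by linarith
  also have "\<dots> \<le> X powr ((p - 2) / 2) * m / p + (X powr (q / 2) + X powr (q / 2)) / q"
    using P' c' d' p q by (intro add_mono divide_right_mono) auto
  also have "\<dots> = m / p * X powr ((p - 2) / 2) + 2 / q * X powr (q / 2)" by (simp add: field_simps)
  finally show "K / 2 \<le> m / p * ((4 * m + 6) * sqrt K) powr ((p - 2) / 2) + 2 / q * ((4 * m + 6) * sqrt K) powr (q / 2)"
    unfolding X_def .
qed

text \<open>Each edge bounds \<open>c^2\<close> by \<open>2 * n\<close> times its mass plus
  \<open>2 / n\<close> times its kinetic energy. Summing over the \<open>n^2\<close> edges and
  dividing by their number gains the factor \<open>1 / n\<close>; moving along one edge adds at most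
  \<open>2 / n\<close> times \<open>Kc\<close>.\<close>

lemma core_sup:
  assumes e: "e \<in> A" and x: "x \<in> {0..l}"
  shows "(f e x)\<^sup>2 \<le> 6 / real n * (mc + Kc)"
proof -
  have n0: "real n \<ge> 1" using n by simp
  have "(real n)\<^sup>2 * c\<^sup>2 = (\<Sum>e\<in>A. c\<^sup>2)" using A(2) by simp
  also have "\<dots> \<le> (\<Sum>e\<in>A. 2 / l * sq_int {0..l} (f e) + 2 * l * sq_int {0..l} (g e))"
  proof (rule sum_mono)
    fix e assume e: "e \<in> A"
    show "c\<^sup>2 \<le> 2 / l * sq_int {0..l} (f e) + 2 * l * sq_int {0..l} (g e)"
      using H1_on_sup_bound_length[OF HA'[OF e] l(1), of 0 0] c(3)[OF e] l by simp
  qed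
  also have "\<dots> = 2 * real n * mc + 2 / real n * Kc"
    by (simp add: sum.distrib mc_def Kc_def sum_distrib_left l_def)
  finally have "(real n)\<^sup>2 * c\<^sup>2 \<le> 2 * real n * mc + 2 / real n * Kc" .
  moreover have "2 / real n * Kc \<le> 2 * real n * Kc"
    using n0 nonneg by (intro mult_right_mono) (auto simp: field_simps intro: order_trans[of _ "real n"])
  ultimately have "real n * (real n * c\<^sup>2) \<le> real n * (2 * (mc + Kc))" by (simp add: algebra_simps power2_eq_square)
  then have "real n * c\<^sup>2 \<le> 2 * (mc + Kc)" using n0 by (subst (asm) mult_le_cancel_left_pos) auto
  then have c2: "c\<^sup>2 \<le> 2 / real n * (mc + Kc)" using n0 by (simp add: field_simps)
  have "(f e x)\<^sup>2 \<le> 2 * (f e 0)\<^sup>2 + 2 * l * sq_int {0..l} (g e)" by (rule square_bound_from_end[OF HA'[OF e] x])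
  also have "\<dots> \<le> 2 * (2 / real n * (mc + Kc)) + 2 * l * (mc + Kc)"
    using c2 c(3)[OF e] edge_le[OF e] nonneg l by (intro add_mono mult_left_mono) auto
  also have "\<dots> = 6 / real n * (mc + Kc)"
  proof -
    have "2 * (2 / N * Y) + 2 * (1 / N) * Y = 6 / N * Y" for N Y :: real by (simp add: divide_inverse)
    then show ?thesis unfolding l_def .
  qed
  finally show ?thesis .
qed

text \<open>Since \<open>p\<close> and \<open>q\<close> exceed 2, a positive power of the small
  bound \<open>\<eta>\<close> can be split off from each nonlinear term. The remaining squares are
  controlled linearly by \<open>mc\<close> and \<open>Kc\<close>.\<close>

lemma core_energy: "- (\<kappa> / (2 * m)) * mc \<le> Kc / 2 - Pc / p - (\<bar>c\<bar> powr q + \<bar>d\<bar> powr q) / q"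
proof -
  define \<eta> where "\<eta> = 6 * (m + Ks) / real n"
  define S where "S = 6 / real n * (mc + Kc)"
  define \<alpha> where "\<alpha> = \<eta> powr ((p - 2) / 2)"
  define \<beta> where "\<beta> = \<eta> powr ((q - 2) / 2)"
  have n0: "real n \<ge> 1" using n by simp
  have p2: "p \<ge> 2" "q \<ge> 2" using p q by auto
  have "6 / real n * (mc + Kc) \<le> 6 / real n * (m + Ks)"
    using totals K_le by (intro mult_left_mono) auto
  then have S\<eta>: "S \<le> \<eta>" by (simp add: S_def \<eta>_def)
  have sup: "(f e x)\<^sup>2 \<le> \<eta>" if "e \<in> A" "x \<in> {0..l}" for e x
    using core_sup[OF that] S\<eta> unfolding S_def by linarith
  have "Pc \<le> (\<Sum>e\<in>A. \<alpha> * sq_int {0..l} (f e))"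
    unfolding Pc_def \<alpha>_def by (intro sum_mono powr_int_le_square[OF HA' p2(1)] sup)
  then have Pc: "Pc \<le> \<alpha> * mc" by (simp add: mc_def sum_distrib_left)
  have vert: "\<bar>f e x\<bar> powr q \<le> \<beta> * S" if "e \<in> A" "x \<in> {0..l}" for e x
  proof -
    have "\<bar>f e x\<bar> powr q \<le> \<beta> * (f e x)\<^sup>2" unfolding \<beta>_def by (rule abs_powr_le_square(1)[OF p2(2) sup[OF that]])
    also have "\<dots> \<le> \<beta> * S" using core_sup[OF that] by (intro mult_left_mono) (auto simp: S_def \<beta>_def)
    finally show ?thesis .
  qed
  have c': "\<bar>c\<bar> powr q \<le> \<beta> * S" using vert[OF A(3), of 0] c(3)[OF A(3)] l by simp
  have d': "\<bar>d\<bar> powr q \<le> \<beta> * S" using vert[OF A(3), of l] d l by (simp add: l_def)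
  \<comment> \<open>There are two vertices, each with squared value at most
    \<open>6 / real n * (mc + Kc)\<close>; hence the 12.\<close>
  define b where "b = 12 / (real n * q) * \<beta>"
  have b: "b \<le> 1 / 2" "\<alpha> / p + b \<le> \<kappa> / (2 * m)" using small unfolding b_def \<alpha>_def \<beta>_def \<eta>_def by simp_all
  have "Pc / p + (\<bar>c\<bar> powr q + \<bar>d\<bar> powr q) / q \<le> \<alpha> * mc / p + (\<beta> * S + \<beta> * S) / q"
    using Pc c' d' p q by (intro add_mono divide_right_mono) auto
  also have "\<dots> = (\<alpha> / p + b) * mc + b * Kc"
    unfolding b_def S_def using p q n0 by (simp add: field_simps)
  also have "\<dots> \<le> \<kappa> / (2 * m) * mc + 1 / 2 * Kc"
    using b nonneg by (intro add_mono mult_right_mono) auto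
  finally show ?thesis by simp
qed

lemma contradiction: False
proof -
  define M where "M = sq_int {0..} (f 0) + sq_int {0..} (f 1)"
  define Kw where "Kw = sq_int {0..} (g 0) + sq_int {0..} (g 1)"
  define Pw where "Pw = powr_int p {0..} (f 0) + powr_int p {0..} (f 1)"
  have p2: "p \<ge> 2" using p by simp
  have M: "M + mc = m" "M \<ge> 0" using mass nonneg(4) by (auto simp: M_def mc_def l_def intro!: add_nonneg_nonneg)
  have Kw: "K = Kw + Kc" by (simp add: K Kw_def Kc_def l_def)
  have Pw: "P = Pw + Pc" by (simp add: P Pw_def Pc_def l_def)
  have Pw0: "Pw \<ge> 0" using powr_int_nonneg by (simp add: Pw_def add_nonneg_nonneg)
  have split: "E = (Kw / 2 - Pw / p) + (Kc / 2 - Pc / p - (\<bar>c\<bar> powr q + \<bar>d\<bar> powr q) / q)"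
    unfolding energy Kw Pw by (simp add: add_divide_distrib)
  then have low: "E \<ge> (Kw / 2 - Pw / p) - \<kappa> / (2 * m) * mc" using core_energy by linarith
  \<comment> \<open>The half-lines carry the fraction \<open>M / m\<close> of the mass and at least
    that fraction of the negative number \<open>E\<close>: scaling their mass up to \<open>m\<close>
    multiplies the kinetic term by \<open>t = m / M\<close> and the power term by
    \<open>t powr (p / 2) \<ge> t\<close>. The case \<open>M = 0\<close>, where \<open>t\<close>
    makes no sense, is separate.\<close>
  have w: "M * E / m \<le> Kw / 2 - Pw / p"
  proof (cases "M = 0")
    case True
    have z: "sq_int {0..} (f 0) = 0" "sq_int {0..} (f 1) = 0"
      using True nonneg(4)[of "{0..}" "f 0"] nonneg(4)[of "{0..}" "f 1"] unfolding M_def by linarith+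
    have zp: "powr_int p {0..} h \<le> 0" if H: "H1_on {0..} h k" "sq_int {0..} h = 0" for h k
      using H1_on_powr(2)[OF H(1) p2 H1_on_halfline_bound[OF H(1)]] H(2) by simp
    have "Pw \<le> 0" unfolding Pw_def using zp[OF H0 z(1)] zp[OF H1 z(2)] by simp
    then have "Pw = 0" using Pw0 by simp
    moreover have "Kw \<ge> 0" unfolding Kw_def by (intro add_nonneg_nonneg nonneg(4))
    ultimately show ?thesis using True by simp
  next
    case False
    then have M0: "M > 0" using M by simp
    define t where "t = m / M"
    have t: "t \<ge> 1" using M0 M nonneg(1) by (simp add: t_def)
    have "E \<le> t * Kw / 2 - t powr (p / 2) * Pw / p"
      unfolding t_def Kw_def Pw_def
      by (rule energy_bound_join[OF bound m p2 H0 H1]) (use c M0 in \<open>auto simp: M_def\<close>)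
    also have "\<dots> \<le> t * Kw / 2 - t * Pw / p"
    proof -
      have "t powr 1 \<le> t powr (p / 2)" using t p by (intro powr_mono) auto
      then have "t \<le> t powr (p / 2)" using t by simp
      then show ?thesis using Pw0 p by (intro diff_left_mono divide_right_mono mult_right_mono) auto
    qed
    also have "\<dots> = t * (Kw / 2 - Pw / p)" by (simp add: right_diff_distrib)
    finally have "E / t \<le> Kw / 2 - Pw / p" using t by (simp add: field_simps)
    then show ?thesis using M0 m by (simp add: t_def mult.commute)
  qed
  \<comment> \<open>Giving up the core mass raises the lower bound by
    \<open>- E / m \<ge> \<kappa> / m\<close> per unit, while the core can return at most
    \<open>\<kappa> / (2 * m)\<close> per unit; so there is no core mass.\<close>
  have "E \<ge> M * E / m - \<kappa> / (2 * m) * mc" using low w by linarith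
  moreover have "M * E / m = E - mc * E / m"
  proof -
    have "M = m - mc" using M(1) by simp
    then show ?thesis using m by (simp add: left_diff_distrib diff_divide_distrib)
  qed
  ultimately have "mc * E / m + \<kappa> / (2 * m) * mc \<ge> 0" by linarith
  then have "m * (mc * E / m + \<kappa> / (2 * m) * mc) \<ge> 0" using m by (intro mult_nonneg_nonneg) auto
  moreover have "m * (mc * E / m + \<kappa> / (2 * m) * mc) = mc * (E + \<kappa> / 2)" using m by (simp add: field_simps)
  ultimately have "mc * (E + \<kappa> / 2) \<ge> 0" by simp
  moreover have "E + \<kappa> / 2 < 0" using E \<kappa> by simp
  ultimately have mc: "mc = 0" using nonneg(1) by (simp add: zero_le_mult_iff)
  \<comment> \<open>\<open>f e0\<close> has zero mass on its edge. If \<open>c\<close> were nonzero,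
    a window \<open>\<delta>\<close> so short that \<open>2 * \<delta> * Kc < c^2\<close> would
    contradict the sup bound.\<close>
  have c0: "c = 0"
  proof (rule ccontr)
    assume "c \<noteq> 0"
    then have c2: "c\<^sup>2 > 0" by simp
    define \<delta> where "\<delta> = min l (c\<^sup>2 / (4 * (Kc + 1)))"
    have \<delta>: "\<delta> > 0" "\<delta> \<le> l" "\<delta> \<le> c\<^sup>2 / (4 * (Kc + 1))" using l c2 nonneg by (auto simp: \<delta>_def add_nonneg_pos)
    have "c\<^sup>2 \<le> 2 / \<delta> * sq_int {0..l} (f e0) + 2 * \<delta> * sq_int {0..l} (g e0)"
      using H1_on_sup_bound_length[OF HA'[OF A(3)] \<delta>(1), of 0 0] c(3)[OF A(3)] \<delta> by simp
    also have "sq_int {0..l} (f e0) = 0" using edge_le(1)[OF A(3)] mc nonneg(4)[of "{0..l}" "f e0"] by simp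
    also have "2 / \<delta> * 0 + 2 * \<delta> * sq_int {0..l} (g e0) = 2 * \<delta> * sq_int {0..l} (g e0)" by simp
    also have "\<dots> \<le> 2 * (c\<^sup>2 / (4 * (Kc + 1))) * Kc"
      by (rule mult_mono[OF mult_left_mono[OF \<delta>(3)] edge_le(2)[OF A(3)]]) (use \<delta> nonneg in auto)
    also have "\<dots> < c\<^sup>2" using c2 nonneg(2) by (simp add: field_simps add_pos_nonneg)
    finally show False by simp
  qed
  have Mm: "M = m" using M mc by simp
  \<comment> \<open>Without core mass, the two half-line functions together have mass
    \<open>m\<close>, energy at most \<open>E\<close> and a zero at the origin, as
    \<open>minimizer_zero\<close> requires.\<close>
  have le: "Kw / 2 - Pw / p \<le> E" using low mc by simp
  have "sq_int {0..} (f 0) = 0"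
    by (rule minimizer_zero[OF bound m p H0 H1]) (use c c0 Mm le in \<open>auto simp: M_def Kw_def Pw_def\<close>)
  moreover have "sq_int {0..} (f 1) = 0"
    by (rule minimizer_zero[OF bound m p H1 H0]) (use c c0 Mm le in \<open>auto simp: M_def Kw_def Pw_def add.commute\<close>)
  ultimately show False using Mm m by (simp add: M_def)
qed

end

section \<open>The graph\<close>

text \<open>Edges 0 and 1 are the half-lines, edges 2 and 3 lead to the vertex 1, all others are loops at 0.\<close>

definition bouquet :: "nat \<Rightarrow> (nat, nat) mgraph" where
  "bouquet n = \<lparr>verts = {0, 1}, edges = {..<n\<^sup>2 + 2}, tail = (\<lambda>_. 0),
     head = (\<lambda>e. if e = 2 \<or> e = 3 then 1 else 0),
     len = (\<lambda>e. if e < 2 then \<infinity> else ereal (1 / real n))\<rparr>"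

lemma bouquet_simps [simp]:
  "verts (bouquet n) = {0, 1}" "edges (bouquet n) = {..<n\<^sup>2 + 2}" "tail (bouquet n) = (\<lambda>_. 0)"
  "head (bouquet n) e = (if e = 2 \<or> e = 3 then 1 else 0)"
  "len (bouquet n) e = (if e < 2 then \<infinity> else ereal (1 / real n))"
  by (simp_all add: bouquet_def)

lemma bouquet_bounded_edges: "bounded_edges (bouquet n) = {2..<n\<^sup>2 + 2}"
  by (auto simp: bounded_edges_def)

lemma bouquet_half_lines: "half_lines (bouquet n) = {0, 1}"
  by (auto simp: half_lines_def)

lemma bouquet_large: "n \<ge> 2 \<Longrightarrow> n\<^sup>2 \<ge> (4::nat)"
  using power_mono[of 2 n 2] by simp

lemma bouquet_metric_graph:
  assumes n: "n \<ge> 2"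
  shows "metric_graph (bouquet n)"
proof -
  have e: "2 \<in> bounded_edges (bouquet n)" using n by (auto simp: bouquet_bounded_edges)
  have "(0, 1) \<in> adjacency (bouquet n)" "(1, 0) \<in> adjacency (bouquet n)"
    unfolding adjacency_def by (rule UN_I[OF e]; simp)+
  then have "\<forall>v\<in>{0, 1}. \<forall>w\<in>{0, 1}. (v, w) \<in> (adjacency (bouquet n))\<^sup>*" by auto
  then show ?thesis using n by (auto simp: metric_graph_def bouquet_bounded_edges)
qed

lemma bouquet_degree:
  assumes n: "n \<ge> 2"
  shows "vertex_degree (bouquet n) 1 = 2"
proof -
  have "{e \<in> bounded_edges (bouquet n). head (bouquet n) e = 1} = {2, 3}"
    using n bouquet_large[OF n] by (auto simp: bouquet_bounded_edges split: if_splits)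
  then show ?thesis by (simp add: vertex_degree_def)
qed

section \<open>Functions on the graph as families of functions on its edges\<close>

lemma bouquet_edge_dom: "edge_dom (bouquet n) e = (if e < 2 then {0..} else {0..1 / real n})"
  by (auto simp: edge_dom_def)

lemma bouquet_edge_interior: "edge_interior (bouquet n) e = (if e < 2 then {0<..} else {0<..<1 / real n})"
  by (auto simp: edge_interior_def einterval_def zero_ereal_def)

lemma bouquet_edge_regular:
  fixes n e :: nat
  defines "S \<equiv> edge_interior (bouquet n) e" and "D \<equiv> edge_dom (bouquet n) e"
  shows "open S" "is_interval S" "is_interval D" "D \<in> sets borel" "S \<subseteq> D" "finite (D - S)"
    "\<And>x y. x \<in> D \<Longrightarrow> y \<in> D \<Longrightarrow> {x<..<y} \<subseteq> S"
proof -
  have "D - S \<subseteq> {0, 1 / real n}" by (auto simp: S_def D_def bouquet_edge_interior bouquet_edge_dom)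
  then show "finite (D - S)" by (rule finite_subset) simp
qed (auto simp: S_def D_def bouquet_edge_interior bouquet_edge_dom is_interval_ci is_interval_cc is_interval_oi is_interval_oo)

lemma set_integral_dom_eq_interior:
  "(LINT x:edge_dom (bouquet n) e|lborel. F x :: real) = (LINT x:edge_interior (bouquet n) e|lborel. F x)"
  by (rule set_integral_discrete_difference[where X="edge_dom (bouquet n) e - edge_interior (bouquet n) e"])
    (use bouquet_edge_regular[where n=n and e=e] in \<open>auto intro: countable_finite\<close>)

text \<open>Outside the open edge \<open>edge_deriv\<close> is arbitrary, so it is cut off there;
  the result is a Borel function on the whole line, as \<open>H1_on\<close> demands.\<close>

lemma H1_bouquet_edge:
  assumes u: "u \<in> H1 (bouquet n)" and e: "e \<in> edges (bouquet n)"
  defines "f \<equiv> on_edge (bouquet n) u e"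
    and "g \<equiv> (\<lambda>x. indicator (edge_interior (bouquet n) e) x * edge_deriv (bouquet n) u e x)"
  shows "H1_on (edge_dom (bouquet n) e) f g"
    and "(LINT x:edge_interior (bouquet n) e|lborel. \<bar>edge_deriv (bouquet n) u e x\<bar>\<^sup>2) = sq_int (edge_dom (bouquet n) e) g"
proof -
  note R = bouquet_edge_regular[where n=n and e=e]
  obtain g' where g': "is_weak_deriv (edge_interior (bouquet n) e) f g'"
    using u e unfolding H1_def f_def by blast
  show "H1_on (edge_dom (bouquet n) e) f g"
    unfolding g_def
  proof (rule H1_on_closure[OF R])
    show "continuous_on (edge_dom (bouquet n) e) f"
      using u e unfolding H1_def continuous_on_graph_def f_def by blast
    show "is_weak_deriv (edge_interior (bouquet n) e) f (edge_deriv (bouquet n) u e)"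
      using is_weak_deriv_weak_deriv[OF g'] unfolding edge_deriv_def f_def .
    show "set_integrable lborel (edge_interior (bouquet n) e) (\<lambda>x. (f x)\<^sup>2)"
      "set_integrable lborel (edge_interior (bouquet n) e) (\<lambda>x. (edge_deriv (bouquet n) u e x)\<^sup>2)"
      using u e unfolding H1_def f_def by auto
  qed
  show "(LINT x:edge_interior (bouquet n) e|lborel. \<bar>edge_deriv (bouquet n) u e x\<bar>\<^sup>2) = sq_int (edge_dom (bouquet n) e) g"
    unfolding set_lebesgue_integral_def
    by (rule Bochner_Integration.integral_cong) (use R(5) in \<open>auto simp: g_def indicator_def\<close>)
qed

definition extend_by_zero :: "(real \<Rightarrow> real) \<Rightarrow> (nat, nat) point \<Rightarrow> real" where
  "extend_by_zero h x = (case x of Vertex v \<Rightarrow> 0 | Inner e t \<Rightarrow> if e = 0 then h t else 0)"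

lemma on_edge_extend_by_zero:
  assumes "h 0 = 0"
  shows "on_edge (bouquet n) (extend_by_zero h) e = (if e = 0 then h else (\<lambda>_. 0))"
  using assms by (auto simp: on_edge_def edge_point_def extend_by_zero_def fun_eq_iff)

lemma energy_extend_by_zero:
  assumes H: "H1_on {0..} h g" and h0: "h 0 = 0"
  shows "extend_by_zero h \<in> H1 (bouquet n)" "mass (bouquet n) (extend_by_zero h) = sq_int {0..} h"
    "energy p q (bouquet n) (extend_by_zero h) = sq_int {0..} g / 2 - powr_int p {0..} h / p"
proof -
  let ?G = "bouquet n"
  define k where "k e = (if e = (0::nat) then g else (\<lambda>_. 0))" for e
  have He: "H1_on (edge_dom ?G e) (on_edge ?G (extend_by_zero h) e) (k e)" for e
    using H H1_on_zero[OF bouquet_edge_regular(3,4)] by (auto simp: on_edge_extend_by_zero[of h, OF h0] k_def bouquet_edge_dom)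
  note R = bouquet_edge_regular
  note W = set_integral_weak_deriv_square[OF He R(1,5,2)]
  show "extend_by_zero h \<in> H1 ?G"
    unfolding H1_def mem_Collect_eq
  proof (intro conjI ballI)
    show "continuous_on_graph ?G (extend_by_zero h)"
      unfolding continuous_on_graph_def using H1_on_continuous[OF He] by blast
    fix e
    show "\<exists>g. is_weak_deriv (edge_interior ?G e) (on_edge ?G (extend_by_zero h) e) g"
      using primitive_is_weak_deriv[OF He R(1,5,2)] by blast
    show "set_integrable lborel (edge_interior ?G e) (\<lambda>x. \<bar>edge_deriv ?G (extend_by_zero h) e x\<bar>\<^sup>2)"
      unfolding edge_deriv_def by (rule W(1))
    show "set_integrable lborel (edge_interior ?G e) (\<lambda>x. \<bar>on_edge ?G (extend_by_zero h) e x\<bar>\<^sup>2)"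
      using set_integrable_subset[OF H1_onD(5)[OF He] _ R(5)] R(1) by auto
  qed
  have single: "(\<Sum>e\<in>edges ?G. F e) = F 0" if "\<And>e. e \<noteq> 0 \<Longrightarrow> F e = 0" for F :: "nat \<Rightarrow> real"
    using sum.mono_neutral_right[of "edges ?G" "{0}" F] that by auto
  have dom0: "edge_dom ?G 0 = {0..}" by (simp add: bouquet_edge_dom)
  show "mass ?G (extend_by_zero h) = sq_int {0..} h"
    unfolding mass_def graph_integral_def set_integral_dom_eq_interior[symmetric]
    by (subst single) (auto simp: on_edge_extend_by_zero[of h, OF h0] dom0)
  have pow: "graph_integral ?G (\<lambda>e x. \<bar>on_edge ?G (extend_by_zero h) e x\<bar> powr p) = powr_int p {0..} h"
    unfolding graph_integral_def set_integral_dom_eq_interior[symmetric]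
    by (subst single) (auto simp: on_edge_extend_by_zero[of h, OF h0] dom0)
  have "sq_int (edge_interior ?G e) (k e) = (if e = 0 then sq_int {0..} g else 0)" for e
    unfolding set_integral_dom_eq_interior[symmetric] by (auto simp: k_def dom0)
  then have kin: "graph_integral ?G (\<lambda>e x. \<bar>edge_deriv ?G (extend_by_zero h) e x\<bar>\<^sup>2) = sq_int {0..} g"
    unfolding graph_integral_def edge_deriv_def W(2) by (subst single) auto
  show "energy p q ?G (extend_by_zero h) = sq_int {0..} g / 2 - powr_int p {0..} h / p"
    unfolding energy_def kin pow by (simp add: extend_by_zero_def)
qed

section \<open>Nonexistence of ground states\<close>

lemma ground_state_energy_bound:
  assumes "ground_state p q (bouquet n) m u"
  shows "energy_bound p m (energy p q (bouquet n) u)"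
  unfolding energy_bound_def
proof (intro allI impI, elim conjE)
  fix h g assume h: "H1_on {0..} h g" "h 0 = 0" "sq_int {0..} h = m"
  have "extend_by_zero h \<in> H1_mass (bouquet n) m"
    using energy_extend_by_zero[OF h(1,2)] h(3) by (simp add: H1_mass_def)
  then have "ereal (energy p q (bouquet n) u) \<le> ereal (energy p q (bouquet n) (extend_by_zero h))"
    using assms unfolding ground_state_def by (metis INF_lower)
  then show "energy p q (bouquet n) u \<le> sq_int {0..} g / 2 - powr_int p {0..} h / p"
    using energy_extend_by_zero(3)[OF h(1,2)] by simp
qed

lemma no_ground_state:
  assumes p: "2 < p" "p < 6" and q: "2 < q" "q < 4" and m: "m > 0" and \<kappa>: "\<kappa> > 0"
    and neg: "\<And>E. energy_bound p m E \<Longrightarrow> E \<le> - \<kappa>"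
    and Ks: "Ks > 0" "\<And>K. K \<ge> 0 \<Longrightarrow>
      K / 2 \<le> m / p * ((4 * m + 6) * sqrt K) powr ((p - 2) / 2) + 2 / q * ((4 * m + 6) * sqrt K) powr (q / 2) \<Longrightarrow> K \<le> Ks"
    and n: "n \<ge> 2"
    and small: "(6 * (m + Ks) / real n) powr ((p - 2) / 2) / p + 12 / (real n * q) * (6 * (m + Ks) / real n) powr ((q - 2) / 2) \<le> \<kappa> / (2 * m)"
      "12 / (real n * q) * (6 * (m + Ks) / real n) powr ((q - 2) / 2) \<le> 1 / 2"
  shows "\<not> ground_state p q (bouquet n) m u"
proof
  assume gs: "ground_state p q (bouquet n) m u"
  let ?G = "bouquet n"
  define E where "E = energy p q ?G u"
  define f where "f = on_edge ?G u"
  define g where "g e x = indicator (edge_interior ?G e) x * edge_deriv ?G u e x" for e x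
  define A where "A = {2..<n\<^sup>2 + 2}"
  have u: "u \<in> H1 ?G" "mass ?G u = m" using gs unfolding ground_state_def H1_mass_def by auto
  have He: "H1_on (edge_dom ?G e) (f e) (g e)"
    and kin: "(LINT x:edge_interior ?G e|lborel. \<bar>edge_deriv ?G u e x\<bar>\<^sup>2) = sq_int (edge_dom ?G e) (g e)"
    if "e \<in> edges ?G" for e
    using H1_bouquet_edge[OF u(1) that] unfolding f_def g_def[abs_def] .
  have edges: "edges ?G = insert 0 (insert 1 A)" by (auto simp: A_def)
  have sum: "(\<Sum>e\<in>edges ?G. F e) = F 0 + F 1 + (\<Sum>e\<in>A. F e)" for F :: "nat \<Rightarrow> real"
    unfolding edges by (simp add: A_def)
  have dom: "edge_dom ?G 0 = {0..}" "edge_dom ?G 1 = {0..}" "e \<in> A \<Longrightarrow> edge_dom ?G e = {0..1 / real n}" for e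
    by (auto simp: bouquet_edge_dom A_def)
  have domsum: "(\<Sum>e\<in>edges ?G. (LINT x:edge_dom ?G e|lborel. F e x)) = (LINT x:{0..}|lborel. F 0 x) + (LINT x:{0..}|lborel. F 1 x)
    + (\<Sum>e\<in>A. (LINT x:{0..1 / real n}|lborel. F e x))" for F :: "nat \<Rightarrow> real \<Rightarrow> real"
    unfolding sum dom(1,2) using dom(3) by simp
  define K where "K = sq_int {0..} (g 0) + sq_int {0..} (g 1) + (\<Sum>e\<in>A. sq_int {0..1 / real n} (g e))"
  define P where "P = powr_int p {0..} (f 0) + powr_int p {0..} (f 1) + (\<Sum>e\<in>A. powr_int p {0..1 / real n} (f e))"
  have kinK: "graph_integral ?G (\<lambda>e x. \<bar>edge_deriv ?G u e x\<bar>\<^sup>2) = K"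
  proof -
    have "graph_integral ?G (\<lambda>e x. \<bar>edge_deriv ?G u e x\<bar>\<^sup>2) = (\<Sum>e\<in>edges ?G. sq_int (edge_dom ?G e) (g e))"
      unfolding graph_integral_def by (rule sum.cong[OF refl kin])
    then show ?thesis unfolding domsum K_def .
  qed
  have powP: "graph_integral ?G (\<lambda>e x. \<bar>on_edge ?G u e x\<bar> powr p) = P"
    unfolding graph_integral_def set_integral_dom_eq_interior[symmetric] domsum P_def f_def ..
  \<comment> \<open>Edge 2 plays the part of \<open>e0\<close>, because it ends at the vertex
    1.\<close>
  interpret core_functions p q m \<kappa> E n A f g "u (Vertex 0)" "u (Vertex 1)" K P Ks 2
  proof (unfold_locales)
    show "energy_bound p m E" unfolding E_def by (rule ground_state_energy_bound[OF gs])
    then show "E \<le> - \<kappa>" by (rule neg)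
    show "n \<ge> 1" using n by simp
    show "H1_on {0..} (f 0) (g 0)" using He[of 0] dom by simp
    show "H1_on {0..} (f 1) (g 1)" using He[of 1] dom by simp
    show "H1_on {0..1 / real n} (f e) (g e)" if "e \<in> A" for e using He[of e] dom(3)[OF that] that by (simp add: A_def)
    show "finite A" "card A = n\<^sup>2" by (simp_all add: A_def)
    show "2 \<in> A" using n by (simp add: A_def)
    show "f 0 0 = u (Vertex 0)" "f 1 0 = u (Vertex 0)" "f e 0 = u (Vertex 0)" for e
      by (simp_all add: f_def on_edge_def edge_point_def)
    show "f 2 (1 / real n) = u (Vertex 1)" using n by (simp add: f_def on_edge_def edge_point_def)
    show "sq_int {0..} (f 0) + sq_int {0..} (f 1) + (\<Sum>e\<in>A. sq_int {0..1 / real n} (f e)) = m"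
      using u(2) unfolding mass_def graph_integral_def set_integral_dom_eq_interior[symmetric] domsum f_def by simp
    show "E = K / 2 - P / p - (\<bar>u (Vertex 0)\<bar> powr q + \<bar>u (Vertex 1)\<bar> powr q) / q"
      unfolding E_def energy_def kinK powP by simp
  qed (fact p q m \<kappa> K_def P_def Ks small)+
  show False by (rule contradiction)
qed

theorem theorem1p9:
  fixes p q :: real
  assumes "2 < p" and "p < 6" and "2 < q" and "q < 4"
  shows "\<exists>(G :: (nat, nat) mgraph) m :: real.
           metric_graph G \<and> noncompact G \<and> card (half_lines G) = 2 \<and>
           (\<exists>v\<in>verts G. vertex_degree G v = 2) \<and>
           m > 0 \<and> \<not> (\<exists>u. ground_state p q G m u)"
proof -
  obtain m \<kappa> where m: "m > 0" "\<kappa> > 0" and neg: "\<And>E. energy_bound p m E \<Longrightarrow> E \<le> - \<kappa>"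
    using negative_energy_bound[OF assms(1)] by blast
  obtain Ks where Ks: "Ks > 0" "\<And>K. K \<ge> 0 \<Longrightarrow>
      K / 2 \<le> m / p * ((4 * m + 6) * sqrt K) powr ((p - 2) / 2) + 2 / q * ((4 * m + 6) * sqrt K) powr (q / 2) \<Longrightarrow> K \<le> Ks"
    using kinetic_bound[OF assms m(1)] by blast
  have "m + Ks > 0" "\<kappa> / (2 * m) > 0" using m Ks(1) by auto
  from eventually_core_small[OF assms(1,3) this] eventually_ge_at_top[of "2::nat"]
  have "\<forall>\<^sub>F n in sequentially. n \<ge> 2 \<and> (\<forall>u. \<not> ground_state p q (bouquet n) m u)"
  proof eventually_elim
    case (elim n)
    then show ?case using no_ground_state[OF assms m neg Ks elim(2)] by blast
  qed
  then obtain n where n: "n \<ge> 2" "\<forall>u. \<not> ground_state p q (bouquet n) m u"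
    using eventually_happens'[OF sequentially_bot] by blast
  show ?thesis
  proof (intro exI conjI)
    show "metric_graph (bouquet n)" by (rule bouquet_metric_graph[OF n(1)])
    show "noncompact (bouquet n)" "card (half_lines (bouquet n)) = 2"
      by (simp_all add: noncompact_def bouquet_half_lines)
    show "\<exists>v\<in>verts (bouquet n). vertex_degree (bouquet n) v = 2"
      using bouquet_degree[OF n(1)] by auto
    show "m > 0" by (rule m(1))
    show "\<not> (\<exists>u. ground_state p q (bouquet n) m u)" using n(2) by blast
  qed
qed

end
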